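(* As $n\to\infty$, $$G(n)\sim \frac{\pi^2}{72e^{2\gamma}}\,\frac{n}{(\log\log n)^2},$$ where $\gamma$ is Euler's constant.
   Context: Let $\psi(x)=1/2-\{x\}$ with $\{x\}$ the fractional part. For a list $\mathfrak a=[a_1,\ldots,a_n]$ of non-zero integers, let $\mathfrak a(x)=\sum_j\psi(a_jx)$ and $N(\mathfrak a)=\int_0^1\mathfrak a(x)^2dx$. A list is degenerate if it contains both $a$ and $-a$ for some $a$. $G(n)$ is the infimum of $N(\mathfrak a)$ over all non-degenerate lists of length $n$. *)

theory Defs
  imports "HOL-Analysis.Analysis" "HOL-Library.Landau_Symbols"
begin

definition psi :: "real \<Rightarrow> real" where
  "psi x = 1 / 2 - frac x"

definition list_fun :: "int list \<Rightarrow> real \<Rightarrow> real" where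
  "list_fun as x = (\<Sum>a\<leftarrow>as. psi (of_int a * x))"

definition N :: "int list \<Rightarrow> real" where
  "N as = integral {0..1} (\<lambda>x. (list_fun as x)\<^sup>2)"

definition degenerate :: "int list \<Rightarrow> bool" where
  "degenerate as \<longleftrightarrow> (\<exists>a. a \<in> set as \<and> - a \<in> set as)"

text \<open>
  Entries are non-zero and may be repeated. The infimum is over a non-empty set
  (it contains the list of \<open>n\<close> ones) which is bounded below by 0, so the
  conditionally complete \<^const>\<open>Inf\<close> on the reals is the actual infimum.
\<close>

definition G :: "nat \<Rightarrow> real" where
  "G n = (INF as\<in>{as. length as = n \<and> 0 \<notin> set as \<and> \<not> degenerate as}. N as)"

end

theory Submission
  imports Defs "HOL-Number_Theory.Cong" "HOL-Real_Asymp.Real_Asymp"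
begin

text \<open>
  Since \<open>\<Sum>\<^sub>j psi (x + j / b) = psi (b x)\<close>, the integral of \<open>psi (a x) psi (b x)\<close> is
  \<open>gcd(a,b)\<^sup>2 / (12 a b)\<close>, so \<open>12 N\<close> is a GCD quadratic form. Its kernel factors over the primes into
  the Toeplitz kernels \<open>p\<^bsup>-|\<alpha>-\<beta>|\<^esup>\<close>, whose symbol is the Poisson kernel
  \<open>(1 - 1/p\<^sup>2) / |1 - z/p|\<^sup>2\<close>, with minimum \<open>(1 - 1/p) / (1 + 1/p)\<close> at \<open>z = -1\<close>. By Mertens' third
  theorem the product of these minima over \<open>p \<le> y\<close> is asymptotic to
  \<open>(\<pi>\<^sup>2 / 6) e\<^bsup>-2\<gamma>\<^esup> / (log y)\<^sup>2\<close>.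

  For the lower bound write the form as the mean of \<open>|F|\<^sup>2\<close> times the product of the Poisson kernels,
  where \<open>F\<close> is the sum of the signed list entries with each prime replaced by an independent uniform
  unimodular variable. The mean of \<open>|F|\<^sup>2\<close> is at least \<open>n\<close> and \<open>|F| \<le> n\<close>. The primes above
  \<open>y = log n log log n\<close> contribute a factor close to 1 outside an event of probability \<open>n\<^bsup>-2\<^esup>\<close>.

  For the upper bound take the entries \<open>\<lambda>(m) m\<close>, with \<open>\<lambda>\<close> the Liouville function and \<open>m\<close> running over
  all products of primes \<open>p \<le> y\<close> with exponents below \<open>y\<^sup>2\<close>: this concentrates every variable near \<open>-1\<close>.
  Copies of such a block, dilated by rapidly growing factors, are almost orthogonal, so \<open>G\<close> is
  subadditive and the estimate extends to all lengths.
\<close>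

section \<open>Mertens' third theorem\<close>

text \<open>The two bounds meet because the cutoff enters only through \<open>(log y)^2\<close>: any
  two cutoffs with \<open>log y ~ log log n\<close> give the same constant. From below,
  \<open>|F|^2\<close> may be as large as \<open>n^2\<close> on the exceptional event while its mean
  is only guaranteed to be \<open>n\<close>, so the event has to have probability
  \<open>o(1/n)\<close>; exponential moments of the sum over the large primes give
  \<open>exp (- e^2 y / 4)\<close>, which asks for \<open>y\<close> slightly larger than
  \<open>log n\<close>. From above, a block has length \<open>y^2\<close> to the number of primes up
  to \<open>y\<close>, and this must be \<open>o(n / (log log n)^2)\<close>, which asks for
  \<open>y\<close> slightly smaller than \<open>log n\<close>. Non-degeneracy is what makes the mean
  of \<open>|F|^2\<close> at least \<open>n\<close>: distinct monomials are orthogonal, and entries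
  with the same monomial have the same absolute value, hence the same sign, so they cannot
  cancel.\<close>

definition primes_upto :: "nat \<Rightarrow> nat set" where
  "primes_upto n = {p. prime p \<and> p \<le> n}"

lemma finite_primes_upto [simp]: "finite (primes_upto n)"
  by (rule finite_subset[of _ "{..n}"]) (auto simp: primes_upto_def)

lemma primes_upto_Suc:
  "primes_upto (Suc n) = (if prime (Suc n) then insert (Suc n) (primes_upto n) else primes_upto n)"
  by (auto simp: primes_upto_def le_Suc_eq)

lemma primes_upto_gt_1: "p \<in> primes_upto n \<Longrightarrow> 1 < p"
  using prime_gt_1_nat by (auto simp: primes_upto_def)

lemma card_primes_upto_le: "card (primes_upto n) \<le> n"
proof -
  have "card (primes_upto n) \<le> card {1..n}"
    by (rule card_mono) (auto simp: primes_upto_def dest: prime_gt_0_nat)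
  then show ?thesis by simp
qed

section \<open>Chebyshev's upper bound\<close>

lemma prod_primes_dvd:
  fixes x :: nat
  assumes "finite S" "\<And>p. p \<in> S \<Longrightarrow> prime p \<and> p dvd x"
  shows "\<Prod>S dvd x"
  using assms
proof (induction S rule: finite_induct)
  case (insert p S)
  have "coprime p (\<Prod>S)"
    using insert by (intro prod_coprime_right) (auto intro: primes_coprime)
  then show ?case
    using insert by (simp add: divides_mult)
qed simp

text \<open>Every prime in this range divides \<open>(2m+1) choose m\<close>, since it divides
  \<open>(2m+1)!\<close> but neither \<open>m!\<close> nor \<open>(m+1)!\<close>; the coefficient is
  at most \<open>2^(2m+1)\<close>.\<close>

lemma sum_ln_primes_between_le:
  "(\<Sum>p | prime p \<and> m + 1 < p \<and> p \<le> 2 * m + 1. ln (real p)) \<le> real (2 * m + 1) * ln 2" for m :: nat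
proof -
  define S where "S = {p. prime p \<and> m + 1 < p \<and> p \<le> 2 * m + 1}"
  have fin: "finite S" unfolding S_def by (rule finite_subset[of _ "{..2*m+1}"]) auto
  have eq: "fact (2*m+1) = (fact m * fact (m+1)) * ((2*m+1) choose m :: nat)"
    using binomial_fact_lemma[of m "2*m+1"] by (simp add: mult_2)
  have "\<Prod>S dvd ((2*m+1) choose m)"
  proof (rule prod_primes_dvd[OF fin])
    fix p assume p: "p \<in> S"
    then have "p dvd fact (2*m+1)" "\<not> p dvd fact m" "\<not> p dvd fact (m+1)"
      by (auto simp: S_def prime_dvd_fact_iff simp del: fact_Suc)
    with eq p show "prime p \<and> p dvd ((2*m+1) choose m)"
      by (metis (no_types, lifting) S_def mem_Collect_eq prime_dvd_mult_iff)
  qed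
  then have "\<Prod>S \<le> ((2*m+1) choose m)" by (rule dvd_imp_le) simp
  also have "\<dots> \<le> 2 ^ (2*m+1)" by (rule binomial_le_pow2)
  finally have le: "\<Prod>S \<le> 2 ^ (2*m+1)" .
  have pos: "p > 0" if "p \<in> S" for p using that by (auto simp: S_def)
  have "(\<Sum>p\<in>S. ln (real p)) = ln (real (\<Prod>S))"
    using pos fin by (simp add: ln_prod)
  also have "\<dots> \<le> ln (real (2 ^ (2*m+1)))"
    using le fin pos by (subst ln_le_cancel_iff) (auto simp: of_nat_le_iff prod_pos simp del: of_nat_power of_nat_prod)
  also have "\<dots> = (2*m+1) * ln 2"
    unfolding of_nat_power by (subst ln_realpow) simp_all
  finally show ?thesis by (simp add: S_def)
qed

lemma sum_ln_primes_upto_le: "(\<Sum>p\<in>primes_upto n. ln (real p)) \<le> 3 * ln 2 * n"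
proof (induction n rule: less_induct)
  case (less n)
  consider "n < 2" | "n = 2" | k where "n = Suc k" "\<not> prime n" | m where "n = 2 * m + 1" "m \<ge> 1"
  proof (cases "n \<le> 2")
    case False
    show ?thesis
    proof (cases "prime n")
      case True
      then have "odd n" using False prime_odd_nat by auto
      then show ?thesis using that(4) False by (auto elim!: oddE)
    next
      case 2: False
      then show ?thesis using that(3) False by (cases n) auto
    qed
  qed (use that in linarith)
  then show ?case
  proof cases
    case 1
    then have "primes_upto n = {}" by (auto simp: primes_upto_def dest: prime_ge_2_nat)
    then show ?thesis by simp
  next
    case 2
    then have "primes_upto n = {2}" by (auto simp: primes_upto_def dest: prime_ge_2_nat)
    then show ?thesis using 2 by simp
  next
    case 3
    then have "primes_upto n = primes_upto k" by (simp add: primes_upto_Suc)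
    then have "(\<Sum>p\<in>primes_upto n. ln (real p)) \<le> 3 * ln 2 * k"
      using less.IH[of k] 3 by simp
    also have "\<dots> \<le> 3 * ln 2 * n" using 3 by simp
    finally show ?thesis .
  next
    case 4
    have "primes_upto n = primes_upto (m+1) \<union> {p. prime p \<and> m + 1 < p \<and> p \<le> 2 * m + 1}"
      using 4 by (auto simp: primes_upto_def)
    then have "(\<Sum>p\<in>primes_upto n. ln (real p)) =
      (\<Sum>p\<in>primes_upto (m+1). ln (real p)) +
      (\<Sum>p | prime p \<and> m + 1 < p \<and> p \<le> 2 * m + 1. ln (real p))"
      using finite_subset[of "{p. prime p \<and> m + 1 < p \<and> p \<le> 2 * m + 1}" "{..2*m+1}"]
      by simp (subst sum.union_disjoint; auto simp: primes_upto_def)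
    also have "\<dots> \<le> 3 * ln 2 * real (m+1) + real (2 * m + 1) * ln 2"
      using 4 by (intro add_mono less.IH sum_ln_primes_between_le) auto
    also have "\<dots> = ln 2 * (5 * m + 4)" by (simp add: algebra_simps)
    \<comment> \<open>This is \<open>5m + 4 <= 3(2m + 1)\<close>, that is \<open>m >= 1\<close>; the
      case \<open>m = 1\<close> is what requires the constant 3.\<close>
    also have "\<dots> \<le> ln 2 * (3 * n)" using 4 by (intro mult_left_mono) auto
    finally show ?thesis by (simp add: mult_ac)
  qed
qed

section \<open>Legendre's formula and Mertens' first theorem\<close>

lemma card_multiples: "d > 0 \<Longrightarrow> card {n\<in>{1..m}. d dvd n} = m div (d::nat)"
proof -
  assume d: "d > 0"
  have "{n\<in>{1..m}. d dvd n} = (\<lambda>k. d * k) ` {1..m div d}"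
    using d by (auto simp: image_iff less_eq_div_iff_mult_less_eq mult.commute elim!: dvdE)
  moreover have "inj_on (\<lambda>k. d * k) {1..m div d}" using d by (auto simp: inj_on_def)
  ultimately show ?thesis by (simp add: card_image)
qed

text \<open>The range \<open>m\<close> does not depend on \<open>n\<close>, so that in Legendre's
  formula the sums over \<open>k\<close> and over \<open>n <= m\<close> can be exchanged; powers
  beyond the multiplicity contribute nothing.\<close>

lemma multiplicity_eq_card_powers:
  fixes p n m :: nat
  assumes p: "prime p" and n: "0 < n" "n \<le> m"
  shows "multiplicity p n = card {k\<in>{1..m}. p ^ k dvd n}"
proof -
  have "multiplicity p n < p ^ multiplicity p n"
    using prime_gt_1_nat[OF p] by (intro power_gt_expt) simp
  also have "\<dots> \<le> n" using n(1) by (intro dvd_imp_le multiplicity_dvd)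
  finally have "{k\<in>{1..m}. p ^ k dvd n} = {1..multiplicity p n}"
    using n not_prime_unit[of p] p by (auto intro!: multiplicity_geI intro: multiplicity_dvd')
  then show ?thesis by simp
qed

lemma multiplicity_fact:
  fixes p m :: nat
  assumes p: "prime p"
  shows "multiplicity p (fact m) = (\<Sum>k=1..m. m div p ^ k)"
proof -
  have "multiplicity p (fact m) = (\<Sum>n=1..m. multiplicity p n)"
  proof (induction m)
    case (Suc m)
    then show ?case using p
      by (simp add: prime_elem_multiplicity_mult_distrib del: mult_Suc)
  qed simp
  also have "\<dots> = (\<Sum>n=1..m. card {k\<in>{1..m}. p ^ k dvd n})"
    using p by (intro sum.cong refl multiplicity_eq_card_powers) auto
  also have "\<dots> = (\<Sum>n=1..m. \<Sum>k=1..m. if p ^ k dvd n then 1 else 0)"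
    by (simp add: sum.If_cases Int_def)
  also have "\<dots> = (\<Sum>k=1..m. \<Sum>n=1..m. if p ^ k dvd n then 1 else 0)"
    by (rule sum.swap)
  also have "\<dots> = (\<Sum>k=1..m. card {n\<in>{1..m}. p ^ k dvd n})"
    by (simp add: sum.If_cases Int_def)
  also have "\<dots> = (\<Sum>k=1..m. m div p ^ k)"
    using p by (intro sum.cong refl card_multiples) (auto simp: prime_gt_0_nat)
  finally show ?thesis .
qed

lemma multiplicity_fact_upper:
  fixes p m :: nat
  assumes p: "prime p"
  shows "real (multiplicity p (fact m)) \<le> m / (p - 1)"
proof -
  have p1: "real p > 1" using p prime_gt_1_nat by auto
  have "real (multiplicity p (fact m)) = (\<Sum>k=1..m. real (m div p ^ k))"
    by (simp add: multiplicity_fact[OF p])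
  also have "\<dots> \<le> (\<Sum>k=1..m. m * (1/p) ^ k)"
  proof (intro sum_mono)
    fix k
    have "real (m div p ^ k) \<le> real m / real (p ^ k)" by (rule of_nat_div_le_of_nat)
    then show "real (m div p ^ k) \<le> m * (1/p) ^ k" by (simp add: power_one_over)
  qed
  also have "\<dots> = m * (\<Sum>k=1..m. (1/p) ^ k)" by (simp add: sum_distrib_left)
  also have "(\<Sum>k=1..m. (1/p) ^ k) \<le> 1 / (p - 1 :: real)"
  proof -
    have "(\<Sum>k=1..m. x ^ k) * (1 - x) = x - x ^ Suc m" for x :: real
      using sum_gp_multiplied[of 1 m x] by (cases "m = 0") (auto simp: mult.commute)
    from this[of "1/p"] have "(\<Sum>k=1..m. (1/p) ^ k) * (1 - 1/p) \<le> 1/p" using p1 by simp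
    then have "(\<Sum>k=1..m. (1/p) ^ k) \<le> (1/p) / (1 - 1/p)"
      using p1 by (subst pos_le_divide_eq) simp_all
    also have "\<dots> = 1 / (p - 1 :: real)" using p1 by (simp add: field_simps)
    finally show ?thesis .
  qed
  finally show ?thesis using p1 by (simp add: mult_left_mono)
qed

text \<open>Only the term \<open>k = 1\<close> of Legendre's formula is kept. The loss of at most 1
  per prime is later paid for by Chebyshev's bound.\<close>

lemma multiplicity_fact_lower:
  fixes p m :: nat
  assumes p: "prime p" and "p \<le> m"
  shows "real (multiplicity p (fact m)) \<ge> m / p - 1"
proof -
  have "m / p - 1 \<le> real_of_int \<lfloor>real m / real p\<rfloor>" by linarith
  also have "\<dots> = real (m div p)" by (simp add: floor_divide_of_nat_eq)
  also have "m div p = (\<Sum>k\<in>{1}. m div p ^ k)" by simp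
  also have "\<dots> \<le> (\<Sum>k=1..m. m div p ^ k)"
    using assms prime_ge_1_nat[OF p] by (intro sum_mono2) auto
  finally show ?thesis by (simp add: multiplicity_fact[OF p])
qed

lemma ln_fact_eq: "ln (fact m) = (\<Sum>p\<in>primes_upto m. multiplicity p (fact m) * ln (real p))"
proof -
  have "prime_factors (fact m :: nat) = primes_upto m"
    by (auto simp: primes_upto_def prime_factors_dvd prime_dvd_fact_iff)
  then have "(fact m :: nat) = (\<Prod>p\<in>primes_upto m. p ^ multiplicity p (fact m))"
    using prime_factorization_nat[of "fact m"] by simp
  then have "ln (fact m) = ln (real (\<Prod>p\<in>primes_upto m. p ^ multiplicity p (fact m)))"
    by (metis of_nat_fact)
  also have "\<dots> = (\<Sum>p\<in>primes_upto m. multiplicity p (fact m) * ln (real p))"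
    by (subst of_nat_prod, subst ln_prod)
       (auto simp: ln_realpow dest!: primes_upto_gt_1 intro!: sum.cong)
  finally show ?thesis .
qed

lemma ln_fact_bounds:
  assumes "n \<ge> 1"
  shows "n * ln n - n \<le> ln (fact n)" "ln (fact n) \<le> n * ln (real n)"
proof -
  have "ln (fact n) \<le> ln (real (n ^ n))"
    using assms fact_le_power[of n, where 'a=real] by (subst ln_le_cancel_iff) auto
  then show "ln (fact n) \<le> n * ln (real n)" using assms by (simp add: ln_realpow)
  show "n * ln n - n \<le> ln (fact n)"
    using assms
  proof (induction n rule: dec_induct)
    case (step m)
    have "ln (1 + 1 / real m) \<le> 1 / real m" using step by (intro ln_add_one_self_le_self) auto
    moreover have "ln (1 + 1 / real m) = ln (real (Suc m)) - ln (real m)"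
      using step by (subst ln_divide_pos [symmetric]) (auto simp: field_simps)
    ultimately have "ln (real (Suc m)) - ln m \<le> 1 / m" by linarith
    then have "m * (ln (real (Suc m)) - ln m) \<le> m * (1 / m)" by (rule mult_left_mono) simp
    also have "m * (1 / m) = (1 :: real)" using step by simp
    finally have "m * (ln (real (Suc m)) - ln m) \<le> 1" .
    moreover have "ln (fact (Suc m)) = ln (real (Suc m)) + ln (fact m)"
      by (simp add: ln_mult del: of_nat_Suc)
    ultimately show ?case using step.IH by (simp add: algebra_simps)
  qed simp
qed


text \<open>Legendre's formula turns \<open>ln (n!) = n ln n + O(n)\<close> into an estimate for the
  sum of \<open>ln p / p\<close>. The weight \<open>- ln (1 - 1/p)\<close> replaces
  \<open>1/p\<close> because it is the logarithm of an Euler factor at 1; the two differ by at most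
  \<open>1/(p-1) - 1/p\<close>, which is summable even after multiplication by
  \<open>ln p\<close>.\<close>

lemma Mertens_first_theorem:
  obtains K where "\<And>n. n \<ge> 1 \<Longrightarrow> \<bar>(\<Sum>p\<in>primes_upto n. - ln (1 - 1 / p) * ln (real p)) - ln n\<bar> \<le> K"
proof -
  have aux: "0 \<le> ln (real p) * (1 / real (p - 1) - 1 / p)"
            "ln (real p) * (1 / real (p - 1) - 1 / p) \<le> 4 * (1 / real p powr (3/2))"
    if "p \<ge> 2" for p :: nat
  proof -
    have eq: "1 / real (p - 1) - 1 / p = 1 / (real p * (real p - 1))"
      using that by (simp add: of_nat_diff field_simps)
    show "0 \<le> ln (real p) * (1 / real (p - 1) - 1 / p)"
      using that unfolding eq by simp
    \<comment> \<open>The exponent 1/2 gives \<open>ln p <= 2 sqrt p\<close>; with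
      \<open>1/(p(p-1)) <= 2/p^2\<close> this yields the summable majorant
      \<open>4 / p^(3/2)\<close>.\<close>
    have "ln (real p) \<le> real p powr (1/2) / (1/2)"
      using that by (intro ln_powr_bound) auto
    moreover have "1 / (real p * (real p - 1)) \<le> 2 / (real p * real p)"
      using that by (simp add: field_simps)
    ultimately have "ln (real p) * (1 / (real p * (real p - 1))) \<le>
        (real p powr (1/2) / (1/2)) * (2 / (real p * real p))"
      using that by (intro mult_mono) auto
    also have "real p powr (1/2) = real p * real p / real p powr (3/2)"
    proof -
      have "real p powr (1/2) * real p powr (3/2) = real p powr 2"
        by (simp flip: powr_add)
      then show ?thesis using that by (simp add: field_simps power2_eq_square)
    qed
    finally show "ln (real p) * (1 / real (p - 1) - 1 / p) \<le> 4 * (1 / real p powr (3/2))"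
      using that unfolding eq by (simp add: field_simps)
  qed
  have summ: "summable (\<lambda>p. 1 / real p powr (3/2))"
    using summable_real_powr_iff[of "-3/2"] by (simp add: powr_minus field_simps)
  define B where "B = 4 * (\<Sum>p. 1 / real p powr (3/2))"
  have diff: "(\<Sum>p\<in>primes_upto n. ln (real p) * (1 / real (p - 1) - 1 / p)) \<le> B" for n
  proof -
    have "(\<Sum>p\<in>primes_upto n. ln (real p) * (1 / real (p - 1) - 1 / p)) \<le>
        (\<Sum>p\<in>primes_upto n. 4 * (1 / real p powr (3/2)))"
      using aux(2) by (intro sum_mono) (auto simp: primes_upto_def dest: prime_ge_2_nat)
    also have "\<dots> \<le> (\<Sum>p. 4 * (1 / real p powr (3/2)))"
      using summ by (intro sum_le_suminf summable_mult) auto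
    also have "\<dots> = B" unfolding B_def using summ by (rule suminf_mult)
    finally show ?thesis .
  qed
  have "\<bar>(\<Sum>p\<in>primes_upto n. - ln (1 - 1 / p) * ln (real p)) - ln n\<bar> \<le> 3 * ln 2 + 1 + B" if n: "n \<ge> 1" for n
  proof -
    define S where "S = (\<Sum>p\<in>primes_upto n. ln (real p) / p)"
    have "n * S - (\<Sum>p\<in>primes_upto n. ln (real p)) =
        (\<Sum>p\<in>primes_upto n. (n / p - 1) * ln (real p))"
      by (simp add: S_def sum_distrib_left sum_subtractf algebra_simps)
    also have "\<dots> \<le> (\<Sum>p\<in>primes_upto n. multiplicity p (fact n) * ln (real p))"
      by (intro sum_mono mult_right_mono multiplicity_fact_lower)
         (auto simp: primes_upto_def dest: prime_ge_1_nat)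
    also have "\<dots> = ln (fact n)" by (rule ln_fact_eq [symmetric])
    finally have "n * S \<le> n * ln n + 3 * ln 2 * n"
      using ln_fact_bounds(2)[OF n] sum_ln_primes_upto_le[of n] by linarith
    then have "n * S \<le> n * (ln n + 3 * ln 2)" by (simp add: algebra_simps)
    then have upper: "S \<le> ln n + 3 * ln 2" using n by simp
    have "ln (fact n) = (\<Sum>p\<in>primes_upto n. multiplicity p (fact n) * ln (real p))"
      by (rule ln_fact_eq)
    also have "\<dots> \<le> (\<Sum>p\<in>primes_upto n. n / (p - 1) * ln (real p))"
      by (intro sum_mono mult_right_mono multiplicity_fact_upper)
         (auto simp: primes_upto_def dest: prime_ge_1_nat)
    also have "\<dots> = n * (S + (\<Sum>p\<in>primes_upto n. ln (real p) * (1 / real (p - 1) - 1 / p)))"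
      by (simp add: S_def sum_distrib_left algebra_simps flip: sum.distrib)
    also have "\<dots> \<le> n * (S + B)" using diff[of n] by (intro mult_left_mono) auto
    finally have "n * (ln n - 1) \<le> n * (S + B)" using ln_fact_bounds(1)[OF n] by (simp add: algebra_simps)
    then have "ln n - 1 \<le> S + B" using n by simp
    moreover have "B \<ge> 0" unfolding B_def by (intro mult_nonneg_nonneg suminf_nonneg summ) auto
    \<comment> \<open>The weight lies between \<open>1/p\<close> and \<open>1/(p-1)\<close>, so the
      weighted sum lies between \<open>S\<close> and \<open>S + B\<close>.\<close>
    moreover have "S \<le> (\<Sum>p\<in>primes_upto n. - ln (1 - 1 / p) * ln (real p))"
      unfolding S_def
    proof (rule sum_mono)
      fix p assume "p \<in> primes_upto n"
      then have p: "p > 1" by (rule primes_upto_gt_1)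
      have "1 / p \<le> - ln (1 - 1 / p)" using ln_le_minus_one[of "1 - 1 / p"] p by simp
      from mult_right_mono[OF this, of "ln (real p)"] p
      show "ln (real p) / p \<le> - ln (1 - 1 / p) * ln (real p)" by simp
    qed
    moreover have "(\<Sum>p\<in>primes_upto n. - ln (1 - 1 / p) * ln (real p)) \<le>
        (\<Sum>p\<in>primes_upto n. ln (real p) / p + ln (real p) * (1 / real (p - 1) - 1 / p))"
    proof (rule sum_mono)
      fix p assume "p \<in> primes_upto n"
      then have p: "p > 1" by (rule primes_upto_gt_1)
      have "- ln (1 - 1 / p) = ln (1 / (1 - 1 / p))" using p by (simp add: ln_divide_pos)
      also have "\<dots> \<le> 1 / (1 - 1 / p) - 1" using p by (intro ln_le_minus_one) auto
      also have "\<dots> = 1 / real (p - 1)" using p by (simp add: of_nat_diff field_simps)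
      finally have "- ln (1 - 1 / p) * ln (real p) \<le> 1 / real (p - 1) * ln (real p)"
        using p by (intro mult_right_mono) auto
      then show "- ln (1 - 1 / p) * ln (real p) \<le> ln (real p) / p + ln (real p) * (1 / real (p - 1) - 1 / p)"
        by (simp add: algebra_simps)
    qed
    then have "(\<Sum>p\<in>primes_upto n. - ln (1 - 1 / p) * ln (real p)) \<le> S + B"
      using diff[of n] unfolding S_def sum.distrib by linarith
    ultimately show ?thesis using upper ln_ge_zero[of 2] by linarith
  qed
  then show ?thesis by (rule that)
qed

section \<open>Summation by parts and existence of the Mertens limit\<close>

lemma sum_by_parts:
  fixes a v :: "nat \<Rightarrow> real"
  shows "(\<Sum>k<n. a k * v k) = (\<Sum>k<n. a k) * v n + (\<Sum>k<n. (\<Sum>j\<le>k. a j) * (v k - v (Suc k)))"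
proof (induction n)
  case (Suc n)
  have "(\<Sum>j\<le>n. a j) = (\<Sum>j<n. a j) + a n" by (simp flip: lessThan_Suc_atMost)
  with Suc.IH show ?case by (simp add: algebra_simps)
qed simp

text \<open>Summation by parts leaves a boundary term tending to 0 and a series dominated by the
  telescoping \<open>K * (v k - v (Suc k))\<close>.\<close>

lemma Dirichlet_test:
  fixes a v :: "nat \<Rightarrow> real"
  assumes bound: "\<And>n. \<bar>\<Sum>k<n. a k\<bar> \<le> K"
    and dec: "decseq v" and lim: "v \<longlonglongrightarrow> 0"
  shows "convergent (\<lambda>n. \<Sum>k<n. a k * v k)"
proof -
  have "summable (\<lambda>k. v k - v (Suc k))"
    using telescope_sums'[OF lim] by (rule sums_summable)
  then have "summable (\<lambda>k. K * (v k - v (Suc k)))" by (rule summable_mult)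
  moreover have "norm ((\<Sum>j\<le>k. a j) * (v k - v (Suc k))) \<le> K * (v k - v (Suc k))" for k
  proof -
    have "v (Suc k) \<le> v k" using dec by (simp add: decseq_Suc_iff)
    moreover have "\<bar>\<Sum>j\<le>k. a j\<bar> \<le> K" using bound[of "Suc k"] by (simp only: lessThan_Suc_atMost)
    ultimately show ?thesis by (simp only: abs_mult real_norm_def) (rule mult_mono; simp)
  qed
  ultimately have "summable (\<lambda>k. (\<Sum>j\<le>k. a j) * (v k - v (Suc k)))"
    by (rule summable_comparison_test'[where N=0])
  then have "convergent (\<lambda>n. \<Sum>k<n. (\<Sum>j\<le>k. a j) * (v k - v (Suc k)))"
    by (simp add: summable_iff_convergent)
  moreover have "(\<lambda>n. (\<Sum>k<n. a k) * v n) \<longlonglongrightarrow> 0"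
  proof (rule Lim_null_comparison)
    show "\<forall>\<^sub>F n in sequentially. norm ((\<Sum>k<n. a k) * v n) \<le> K * \<bar>v n\<bar>"
      using bound by (intro always_eventually allI) (simp add: abs_mult mult_right_mono)
    show "(\<lambda>n. K * \<bar>v n\<bar>) \<longlonglongrightarrow> 0"
      using tendsto_mult_right_zero[OF tendsto_rabs_zero[OF lim]] .
  qed
  ultimately show ?thesis
    unfolding sum_by_parts[of a v] by (intro convergent_add) (auto simp only: convergent_def)
qed

definition prime_weight_sum :: "nat \<Rightarrow> real" where
  "prime_weight_sum n = (\<Sum>p\<in>primes_upto n. - ln (1 - 1 / p))"

lemma sum_primes_upto_conv:
  "(\<Sum>p\<in>primes_upto n. f p) = (\<Sum>k<Suc n. if prime k then f k else (0::real))"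
proof -
  have "primes_upto n = {k. k < Suc n \<and> prime k}" by (auto simp: primes_upto_def)
  then show ?thesis by (simp add: sum.If_cases lessThan_def Int_def del: sum.lessThan_Suc)
qed

text \<open>\<open>D\<close> is the error of one step of the right-endpoint sum for the integral of
  \<open>d(ln t) / ln t\<close>, whose primitive is \<open>ln (ln t)\<close>. Both bounds come from
  \<open>ln x <= x - 1\<close>; the lower one is a telescoping difference, hence summable.\<close>

lemma ln_ln_diff_bounds:
  assumes "n \<ge> 3"
  defines "D \<equiv> (ln n - ln (n - 1)) / ln n - (ln (ln n) - ln (ln (n - 1 :: real)))"
  shows "D \<le> 0" "- (1 / ln (n - 1) - 1 / ln n) \<le> D"
proof -
  define L l where "L = ln n" and "l = ln (n - 1)"
  have l: "0 < l" "l < L" unfolding L_def l_def using assms by auto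
  have "L - l = ln (n / (n - 1))" unfolding L_def l_def using assms by (simp add: ln_divide_pos)
  also have "\<dots> \<le> n / (n - 1) - 1" using assms by (intro ln_le_minus_one) auto
  also have "\<dots> \<le> 1" using assms by (simp add: field_simps)
  finally have L1: "L - l \<le> 1" .
  have D: "D = (L - l) / L - ln (L / l)" unfolding D_def L_def l_def
    using l by (simp add: ln_divide_pos L_def l_def)
  have "ln (l / L) \<le> l / L - 1" using l by (intro ln_le_minus_one) auto
  moreover have "ln (l / L) = - ln (L / l)" using l by (simp add: ln_divide_pos)
  moreover have "l / L - 1 = - ((L - l) / L)" using l by (simp add: field_simps)
  ultimately show "D \<le> 0" unfolding D by simp
  have "ln (L / l) \<le> L / l - 1" using l by (intro ln_le_minus_one) auto
  then have "D \<ge> (L - l) / L - (L / l - 1)" unfolding D by simp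
  also have "(L - l) / L - (L / l - 1) = - ((L - l) * (1 / l - 1 / L))" using l by (simp add: field_simps)
  finally have ge: "- ((L - l) * (1 / l - 1 / L)) \<le> D" .
  have "1 / L \<le> 1 / l" using l by (simp add: field_simps)
  then have "(L - l) * (1 / l - 1 / L) \<le> 1 * (1 / l - 1 / L)"
    using L1 by (intro mult_right_mono) auto
  then have "- (1 / l - 1 / L) \<le> - ((L - l) * (1 / l - 1 / L))" by simp
  from order_trans[OF this ge] show "- (1 / ln (n - 1) - 1 / ln n) \<le> D" unfolding L_def l_def .
qed

lemma ln_ln_diff_sum_converges:
  "\<exists>c. (\<lambda>n. (\<Sum>k=2..n. (ln k - ln (real k - 1)) / ln k) - ln (ln n)) \<longlonglongrightarrow> c"
proof -
  define D where "D k = (ln (real (k+3)) - ln (real (k+2))) / ln (real (k+3)) -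
    (ln (ln (real (k+3))) - ln (ln (real (k+2))))" for k :: nat
  have "(\<lambda>k. 1 / ln (real (k+2))) \<longlonglongrightarrow> 0" by real_asymp
  from telescope_sums'[OF this] have "summable (\<lambda>k. 1 / ln (real (k+2)) - 1 / ln (real (k+3)))"
    by (simp add: sums_iff add_ac)
  moreover have "norm (D k) \<le> 1 / ln (real (k+2)) - 1 / ln (real (k+3))" for k
    using ln_ln_diff_bounds[of "real (k+3)"] unfolding D_def by (auto simp: add_ac)
  ultimately have "summable D" by (rule summable_comparison_test'[where N=0])
  then have lim: "(\<lambda>n. \<Sum>k<n. D k) \<longlonglongrightarrow> suminf D" by (rule summable_LIMSEQ)
  define U where "U n = (\<Sum>k=2..n. (ln k - ln (real k - 1)) / ln k) - ln (ln n)" for n :: nat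
  \<comment> \<open>The series \<open>D\<close> starts with the step from 2 to 3, because
    \<open>ln (ln 1)\<close> is not meaningful; the term \<open>k = 2\<close> of the sum equals
    1.\<close>
  have eq: "U (n + 2) = (\<Sum>k<n. D k) + (1 - ln (ln 2))" for n
  proof (induction n)
    case (Suc n)
    have "(\<Sum>k=2..Suc (n+2). (ln k - ln (real k - 1)) / ln k) =
      (\<Sum>k=2..n+2. (ln k - ln (real k - 1)) / ln k) + (ln (real (n+3)) - ln (real (n+2))) / ln (real (n+3))"
      by (subst sum.cl_ivl_Suc) (simp add: algebra_simps)
    then have "U (Suc n + 2) = U (n + 2) + D n"
      by (simp add: U_def D_def algebra_simps)
    with Suc.IH show ?case by simp
  qed (simp add: U_def)
  have "(\<lambda>n. U (n + 2)) \<longlonglongrightarrow> suminf D + (1 - ln (ln 2))"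
    unfolding eq by (rule tendsto_add[OF lim tendsto_const])
  from LIMSEQ_offset[OF this] show ?thesis unfolding U_def by blast
qed

text \<open>By Mertens' first theorem the weights times \<open>ln k\<close>, compared with the
  increments of \<open>ln\<close>, have bounded partial sums; division by \<open>ln k\<close> is
  then a case of the Dirichlet test. The value of the limit remains open at this point.\<close>

lemma prime_weight_sum_converges: "\<exists>C. (\<lambda>n. prime_weight_sum n - ln (ln n)) \<longlonglongrightarrow> C"
proof -
  obtain K where K: "\<And>n. n \<ge> 1 \<Longrightarrow> \<bar>(\<Sum>p\<in>primes_upto n. - ln (1 - 1 / p) * ln (real p)) - ln n\<bar> \<le> K"
    using Mertens_first_theorem by blast
  define b where "b k = (if k \<ge> 2 then ln (real k) - ln (real k - 1) else 0)" for k :: nat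
  define a where "a k = (if prime k then - ln (1 - 1 / k) * ln (real k) else 0) - b k" for k :: nat
  \<comment> \<open>\<open>max 2\<close> makes \<open>v\<close> constant up to 2; the default value
    \<open>1 / ln 1 = 0\<close> would destroy monotonicity.\<close>
  define v where "v k = 1 / ln (real (max 2 k))" for k :: nat
  have sum_b: "(\<Sum>k<Suc n. b k) = ln n" for n
  proof (induction n)
    case (Suc n)
    then show ?case by (cases "n = 0") (auto simp: b_def)
  qed (auto simp: b_def)
  have bound: "\<bar>\<Sum>k<n. a k\<bar> \<le> K" for n
  proof (cases "n \<ge> 2")
    case False
    then have "\<forall>k<n. \<not> prime k" by (auto dest!: prime_ge_2_nat)
    then have "(\<Sum>k<n. a k) = 0" using False by (intro sum.neutral) (auto simp: a_def b_def)
    then show ?thesis using K[of 1] by simp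
  next
    case True
    then obtain m where m: "n = Suc m" "m \<ge> 1" by (cases n) auto
    have "(\<Sum>k<n. a k) = (\<Sum>p\<in>primes_upto m. - ln (1 - 1 / p) * ln (real p)) - ln m"
      unfolding a_def sum_subtractf m sum_b sum_primes_upto_conv ..
    then show ?thesis using K[of m] m by simp
  qed
  have "convergent (\<lambda>n. \<Sum>k<n. a k * v k)"
  proof (rule Dirichlet_test[OF bound])
    show "decseq v" unfolding v_def by (intro decseq_SucI) (auto simp: max_def field_simps)
    show "v \<longlonglongrightarrow> 0"
    proof (rule Lim_transform_eventually)
      show "(\<lambda>k. 1 / ln (real k)) \<longlonglongrightarrow> 0" by real_asymp
      show "\<forall>\<^sub>F x in sequentially. 1 / ln (real x) = v x"
        using eventually_ge_at_top[of 2] by eventually_elim (auto simp: v_def max_def)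
    qed
  qed
  then obtain c1 where c1: "(\<lambda>n. \<Sum>k<Suc n. a k * v k) \<longlonglongrightarrow> c1"
    by (auto simp: convergent_def dest: LIMSEQ_Suc)
  have eq: "(\<Sum>k<Suc n. a k * v k) = prime_weight_sum n - (\<Sum>k=2..n. (ln k - ln (real k - 1)) / ln k)" for n
  proof -
    have "(\<Sum>k<Suc n. a k * v k) = (\<Sum>k<Suc n. (if prime k then - ln (1 - 1 / k) else 0) - b k * v k)"
    proof (rule sum.cong)
      fix k assume "k \<in> {..<Suc n}"
      show "a k * v k = (if prime k then - ln (1 - 1 / k) else 0) - b k * v k"
        using prime_ge_2_nat[of k] by (auto simp: a_def v_def algebra_simps max_def)
    qed simp
    also have "\<dots> = prime_weight_sum n - (\<Sum>k<Suc n. b k * v k)"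
      unfolding prime_weight_sum_def sum_primes_upto_conv sum_subtractf ..
    also have "(\<Sum>k<Suc n. b k * v k) = (\<Sum>k=2..n. (ln k - ln (real k - 1)) / ln k)"
      by (intro sum.mono_neutral_cong_right) (auto simp: b_def v_def max_def)
    finally show ?thesis .
  qed
  obtain c2 where c2: "(\<lambda>n. (\<Sum>k=2..n. (ln k - ln (real k - 1)) / ln k) - ln (ln n)) \<longlonglongrightarrow> c2"
    using ln_ln_diff_sum_converges by blast
  have "(\<lambda>n. prime_weight_sum n - ln (ln n)) \<longlonglongrightarrow> c1 + c2"
    using tendsto_add[OF c1[unfolded eq] c2] by simp
  then show ?thesis by blast
qed

text \<open>The weights \<open>x^k - x^(k+1)\<close> are nonnegative with sum 1, so the power series
  is a weighted mean of the partial sums \<open>S k\<close>. As \<open>x\<close> tends to 1 every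
  single weight vanishes, and only the tail, where \<open>S k\<close> is close to \<open>s\<close>,
  counts.\<close>

lemma Abel_limit:
  fixes f :: "nat \<Rightarrow> real"
  assumes f: "f sums s"
  shows "((\<lambda>x. \<Sum>k. f k * x ^ k) \<longlongrightarrow> s) (at_left 1)"
    and "\<And>x. 0 < x \<Longrightarrow> x < 1 \<Longrightarrow> summable (\<lambda>k. f k * x ^ k)"
proof -
  define S where "S k = (\<Sum>j\<le>k. f j)" for k
  have S: "S \<longlonglongrightarrow> s" using f unfolding S_def sums_def_le .
  then obtain B where B: "\<And>k. \<bar>S k\<bar> \<le> B"
    using convergent_imp_Bseq[of S] by (auto simp: Bseq_def convergent_def)
  have sums: "(\<lambda>k. f k * x ^ k) sums (\<Sum>k. S k * (x ^ k - x ^ Suc k))"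
       "summable (\<lambda>k. S k * (x ^ k - x ^ Suc k))" if x: "0 < x" "x < 1" for x
  proof -
    have "summable (\<lambda>k. x ^ k - x ^ Suc k)"
      using x by (intro summable_diff summable_geometric) (auto simp: summable_geometric)
    then show *: "summable (\<lambda>k. S k * (x ^ k - x ^ Suc k))"
    proof (rule summable_comparison_test'[OF summable_mult[of _ B], where N=0])
      fix n
      show "norm (S n * (x ^ n - x ^ Suc n)) \<le> B * (x ^ n - x ^ Suc n)"
        using B[of n] x by (auto simp: abs_mult mult_left_le_one_le intro!: mult_mono)
    qed
    have "(\<lambda>n. (\<Sum>k<n. f k) * x ^ n) \<longlonglongrightarrow> s * 0"
      using f x unfolding sums_def by (intro tendsto_mult LIMSEQ_realpow_zero) auto
    then have "(\<lambda>n. (\<Sum>k<n. f k) * x ^ n + (\<Sum>k<n. S k * (x ^ k - x ^ Suc k))) \<longlonglongrightarrow>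
        s * 0 + (\<Sum>k. S k * (x ^ k - x ^ Suc k))"
      by (intro tendsto_add summable_LIMSEQ *)
    then show "(\<lambda>k. f k * x ^ k) sums (\<Sum>k. S k * (x ^ k - x ^ Suc k))"
      unfolding sums_def S_def sum_by_parts[of f "\<lambda>k. x ^ k"] by simp
  qed
  then show "summable (\<lambda>k. f k * x ^ k)" if "0 < x" "x < 1" for x using that by (auto simp: sums_iff)
  show "((\<lambda>x. \<Sum>k. f k * x ^ k) \<longlongrightarrow> s) (at_left 1)"
  proof (rule tendstoI)
    fix e :: real assume e: "e > 0"
    obtain n0 where n0: "\<And>n. n \<ge> n0 \<Longrightarrow> \<bar>S n - s\<bar> < e / 2"
      using S[unfolded LIMSEQ_def, rule_format, of "e/2"] e by (auto simp: dist_real_def)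
    \<comment> \<open>\<open>Q\<close> controls the finitely many early terms, each of which carries
      a weight of at most \<open>1 - x\<close>.\<close>
    define Q where "Q = (\<Sum>k<n0. \<bar>S k - s\<bar>)"
    have Q: "Q \<ge> 0" unfolding Q_def by (intro sum_nonneg) auto
    have "((\<lambda>x::real. (1 - x) * Q) \<longlongrightarrow> (1 - 1) * Q) (at_left 1)"
      by (intro tendsto_intros)
    then have "\<forall>\<^sub>F x in at_left 1. (1 - x) * Q < e / 2"
      using e by (intro order_tendstoD(2)) auto
    moreover have "\<forall>\<^sub>F x::real in at_left 1. 0 < x \<and> x < 1"
      using eventually_at_left[of 0 "1::real"] by force
    ultimately show "\<forall>\<^sub>F x in at_left 1. dist (\<Sum>k. f k * x ^ k) s < e"
    proof eventually_elim
      case (elim x)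
      then have x: "0 < x" "x < 1" by auto
      have tel: "(\<lambda>k. x ^ k - x ^ Suc k) sums 1"
        using telescope_sums'[of "\<lambda>k. x ^ k" 0] x LIMSEQ_realpow_zero[of x] by simp
      then have tel': "summable (\<lambda>k. x ^ k - x ^ Suc k)" by (rule sums_summable)
      have mono: "x ^ k - x ^ Suc k \<ge> 0" for k using x by (simp add: mult_left_le_one_le)
      have bd: "\<bar>(S k - s) * (x ^ k - x ^ Suc k)\<bar> \<le> (if k < n0 then \<bar>S k - s\<bar> * (1 - x) else 0) + e / 2 * (x ^ k - x ^ Suc k)" for k
      proof (cases "k < n0")
        case True
        have "x ^ k - x ^ Suc k = x ^ k * (1 - x)" by (simp add: algebra_simps)
        also have "\<dots> \<le> 1 * (1 - x)" using x by (intro mult_right_mono power_le_one) auto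
        finally have "\<bar>S k - s\<bar> * (x ^ k - x ^ Suc k) \<le> \<bar>S k - s\<bar> * (1 - x)"
          by (intro mult_left_mono) auto
        moreover have "0 \<le> e / 2 * (x ^ k - x ^ Suc k)" using e mono by (intro mult_nonneg_nonneg) auto
        ultimately show ?thesis using True mono[of k] by (simp add: abs_mult)
      next
        case False
        have "\<bar>S k - s\<bar> * (x ^ k - x ^ Suc k) \<le> e / 2 * (x ^ k - x ^ Suc k)"
          using n0[of k] False mono[of k] by (intro mult_right_mono) auto
        then show ?thesis using False mono[of k] by (simp add: abs_mult)
      qed
      have fin: "(\<lambda>k. if k < n0 then \<bar>S k - s\<bar> * (1 - x) else 0) sums (\<Sum>k<n0. \<bar>S k - s\<bar> * (1 - x))"
        using sums_If_finite_set[of "{..<n0}" "\<lambda>k. \<bar>S k - s\<bar> * (1 - x)"] by simp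
      have bdsums: "(\<lambda>k. (if k < n0 then \<bar>S k - s\<bar> * (1 - x) else 0) + e / 2 * (x ^ k - x ^ Suc k)) sums
         ((\<Sum>k<n0. \<bar>S k - s\<bar> * (1 - x)) + e / 2 * 1)"
        by (intro sums_add fin sums_mult tel)
      have "(\<Sum>k. f k * x ^ k) - s = (\<Sum>k. S k * (x ^ k - x ^ Suc k)) - (\<Sum>k. s * (x ^ k - x ^ Suc k))"
        using sums(1)[OF x] sums_mult[OF tel, of s] by (simp add: sums_iff)
      also have "\<dots> = (\<Sum>k. (S k - s) * (x ^ k - x ^ Suc k))"
        using sums(2)[OF x] tel' by (subst suminf_diff) (auto simp: left_diff_distrib intro: summable_mult)
      finally have "\<bar>(\<Sum>k. f k * x ^ k) - s\<bar> \<le> (\<Sum>k<n0. \<bar>S k - s\<bar> * (1 - x)) + e / 2"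
        using norm_suminf_le[of "\<lambda>k. (S k - s) * (x ^ k - x ^ Suc k)", OF _ sums_summable[OF bdsums]]
          bd bdsums by (simp add: sums_iff)
      also have "(\<Sum>k<n0. \<bar>S k - s\<bar> * (1 - x)) = (1 - x) * Q"
        by (simp add: Q_def sum_distrib_left mult.commute)
      also have "\<dots> < e / 2" using elim by simp
      finally show "dist (\<Sum>k. f k * x ^ k) s < e" by (simp add: dist_real_def)
    qed
  qed
qed

section \<open>Euler product for real arguments above 1\<close>

lemma inj_on_prime_power_prod:
  assumes P: "finite P" "\<And>p. p \<in> P \<Longrightarrow> prime (p::nat)"
  shows "inj_on (\<lambda>g. \<Prod>p\<in>P. p ^ g p) (PiE P B)"
proof (rule inj_onI)
  fix g h assume gh: "g \<in> PiE P B" "h \<in> PiE P B" and eq: "(\<Prod>p\<in>P. p ^ g p) = (\<Prod>p\<in>P. p ^ h p)"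
  show "g = h"
  proof (rule PiE_ext[OF gh])
    fix q assume q: "q \<in> P"
    have "g q = multiplicity q (\<Prod>p\<in>P. p ^ g p)"
      using P q by (subst multiplicity_prod_prime_powers) auto
    also have "\<dots> = h q" unfolding eq using P q by (subst multiplicity_prod_prime_powers) auto
    finally show "g q = h q" .
  qed
qed

text \<open>Exponents up to \<open>n\<close> suffice, since \<open>p^k <= m <= n\<close> forces
  \<open>k < n\<close>.\<close>

lemma atLeast1_atMost_subset_prime_power_prods:
  "{1..n} \<subseteq> (\<lambda>g. \<Prod>p\<in>primes_upto n. p ^ g p) ` (primes_upto n \<rightarrow>\<^sub>E {..n})"
proof
  fix m assume m: "m \<in> {1..n}"
  define g where "g = restrict (\<lambda>p. multiplicity p m) (primes_upto n)"
  have "multiplicity p m \<le> n" if "p \<in> primes_upto n" for p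
  proof -
    have p: "prime p" using that by (simp add: primes_upto_def)
    have "multiplicity p m < p ^ multiplicity p m"
      using prime_gt_1_nat[OF p] by (intro power_gt_expt) simp
    also have "\<dots> \<le> m" using m by (intro dvd_imp_le multiplicity_dvd) auto
    finally show ?thesis using m by simp
  qed
  then have "g \<in> primes_upto n \<rightarrow>\<^sub>E {..n}" by (auto simp: g_def)
  moreover have "m = (\<Prod>p\<in>primes_upto n. p ^ g p)"
  proof -
    have "m = (\<Prod>p\<in>prime_factors m. p ^ multiplicity p m)"
      using m by (intro prime_factorization_nat) auto
    also have "\<dots> = (\<Prod>p\<in>primes_upto n. p ^ g p)"
    proof (rule prod.mono_neutral_cong_left)
      show "prime_factors m \<subseteq> primes_upto n"
        using m by (auto simp: primes_upto_def prime_factors_dvd dest!: dvd_imp_le)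
      show "\<forall>p\<in>primes_upto n - prime_factors m. p ^ g p = 1"
        using m by (auto simp: g_def primes_upto_def prime_factors_multiplicity)
      fix p assume "p \<in> prime_factors m"
      with \<open>prime_factors m \<subseteq> primes_upto n\<close> show "p ^ multiplicity p m = p ^ g p"
        by (auto simp: g_def)
    qed simp
    finally show ?thesis .
  qed
  ultimately show "m \<in> (\<lambda>g. \<Prod>p\<in>primes_upto n. p ^ g p) ` (primes_upto n \<rightarrow>\<^sub>E {..n})"
    by blast
qed

lemma prod_powr: 
  assumes "finite P" "\<And>p. p \<in> P \<Longrightarrow> p > (0::nat)"
  shows "(\<Prod>p\<in>P. (real p powr s) ^ g p) = real (\<Prod>p\<in>P. p ^ g p) powr s"
  using assms
proof (induction P rule: finite_induct)
  case (insert p P)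
  have "real p > 0" using insert.prems[of p] by simp
  then have "(real p powr s) ^ g p = (real p powr s) powr real (g p)" "real p ^ g p = real p powr real (g p)"
    by (auto simp: powr_realpow)
  then have "(real p powr s) ^ g p = (real p ^ g p) powr s"
    by (simp add: powr_powr mult.commute)
  with insert show ?case by (simp add: powr_mult prod_nonneg)
qed simp

text \<open>The product of geometric series truncated at \<open>A\<close> is the sum of
  \<open>m powr - s\<close> over the integers whose prime exponents are at most \<open>A\<close>.
  Such sums stay below the zeta value for every \<open>A\<close>, and for \<open>A = n\<close> they
  contain all positive \<open>m <= n\<close>; a squeeze gives the limit.\<close>

theorem Euler_product:
  fixes s :: real
  assumes s: "s > 1"
  shows "(\<lambda>n. \<Prod>p\<in>primes_upto n. 1 / (1 - real p powr - s)) \<longlonglongrightarrow> (\<Sum>n. real (Suc n) powr - s)"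
proof -
  define z where "z = (\<Sum>n. real (Suc n) powr - s)"
  define f where "f m = (if m = 0 then 0 else real m powr - s)" for m :: nat
  have summ: "summable (\<lambda>n. real (Suc n) powr - s)"
    using s summable_real_powr_iff[of "-s"] by (subst summable_Suc_iff) auto
  then have f_sums: "f sums z"
    using sums_Suc_iff[of f z] summable_sums[OF summ] by (simp add: f_def z_def)
  have f_nonneg: "f m \<ge> 0" for m by (simp add: f_def)
  have p1: "0 < real p powr - s" "real p powr - s < 1" if "p \<in> primes_upto n" for p n
    using primes_upto_gt_1[OF that] s by (auto simp: powr_less_one)
  have prod_eq: "(\<Prod>p\<in>primes_upto n. \<Sum>k\<le>A. (real p powr - s) ^ k) =
     (\<Sum>m\<in>(\<lambda>g. \<Prod>p\<in>primes_upto n. p ^ g p) ` (primes_upto n \<rightarrow>\<^sub>E {..A}). f m)" for n A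
  proof -
    have "(\<Prod>p\<in>primes_upto n. \<Sum>k\<le>A. (real p powr - s) ^ k) =
      (\<Sum>g\<in>primes_upto n \<rightarrow>\<^sub>E {..A}. \<Prod>p\<in>primes_upto n. (real p powr - s) ^ g p)"
      by (intro prod_sum_PiE) auto
    also have "\<dots> = (\<Sum>g\<in>primes_upto n \<rightarrow>\<^sub>E {..A}. f (\<Prod>p\<in>primes_upto n. p ^ g p))"
    proof (rule sum.cong)
      fix g
      have "(\<Prod>p\<in>primes_upto n. p ^ g p) \<noteq> 0" by (auto dest: primes_upto_gt_1)
      then show "(\<Prod>p\<in>primes_upto n. (real p powr - s) ^ g p) = f (\<Prod>p\<in>primes_upto n. p ^ g p)"
        by (subst prod_powr) (auto simp: f_def dest: primes_upto_gt_1)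
    qed simp
    also have "\<dots> = (\<Sum>m\<in>(\<lambda>g. \<Prod>p\<in>primes_upto n. p ^ g p) ` (primes_upto n \<rightarrow>\<^sub>E {..A}). f m)"
      by (subst sum.reindex[OF inj_on_prime_power_prod]) (auto simp: primes_upto_def)
    finally show ?thesis .
  qed
  have geo_lim: "(\<lambda>A. \<Prod>p\<in>primes_upto n. \<Sum>k\<le>A. (real p powr - s) ^ k) \<longlonglongrightarrow>
      (\<Prod>p\<in>primes_upto n. 1 / (1 - real p powr - s))" for n
    using geometric_sums[of "real p powr - s" for p] p1
    by (intro tendsto_prod) (auto simp: sums_def_le)
  have upper: "(\<Prod>p\<in>primes_upto n. 1 / (1 - real p powr - s)) \<le> z" for n
  proof (rule LIMSEQ_le_const2[OF geo_lim], intro exI allI impI)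
    fix A
    show "(\<Prod>p\<in>primes_upto n. \<Sum>k\<le>A. (real p powr - s) ^ k) \<le> z"
      unfolding prod_eq sums_unique[OF f_sums] using f_sums f_nonneg
      by (intro sum_le_suminf) (auto simp: sums_iff intro!: finite_PiE)
  qed
  have lower: "(\<Sum>m\<le>n. f m) \<le> (\<Prod>p\<in>primes_upto n. 1 / (1 - real p powr - s))" for n
  proof -
    have "(\<Sum>m\<le>n. f m) = (\<Sum>m=1..n. f m)"
      by (intro sum.mono_neutral_right) (auto simp: f_def)
    also have "\<dots> \<le> (\<Sum>m\<in>(\<lambda>g. \<Prod>p\<in>primes_upto n. p ^ g p) ` (primes_upto n \<rightarrow>\<^sub>E {..n}). f m)"
      using atLeast1_atMost_subset_prime_power_prods f_nonneg by (intro sum_mono2) (auto intro!: finite_PiE)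
    also have "\<dots> = (\<Prod>p\<in>primes_upto n. \<Sum>k\<le>n. (real p powr - s) ^ k)" by (rule prod_eq [symmetric])
    also have "\<dots> \<le> (\<Prod>p\<in>primes_upto n. 1 / (1 - real p powr - s))"
    proof (intro prod_mono conjI)
      fix p assume p: "p \<in> primes_upto n"
      show "(\<Sum>k\<le>n. (real p powr - s) ^ k) \<ge> 0" by (intro sum_nonneg) auto
      have "(\<Sum>k\<le>n. (real p powr - s) ^ k) \<le> (\<Sum>k. (real p powr - s) ^ k)"
        using p1[OF p] by (intro sum_le_suminf) (auto intro: summable_geometric)
      also have "\<dots> = 1 / (1 - real p powr - s)" using p1[OF p] by (intro suminf_geometric) auto
      finally show "(\<Sum>k\<le>n. (real p powr - s) ^ k) \<le> 1 / (1 - real p powr - s)" .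
    qed
    finally show ?thesis .
  qed
  have "(\<lambda>n. \<Sum>m\<le>n. f m) \<longlonglongrightarrow> z" using f_sums by (simp add: sums_def_le)
  from tendsto_sandwich[OF _ _ this tendsto_const] lower upper
  show ?thesis unfolding z_def[symmetric] by (auto intro: always_eventually)
qed

section \<open>Zeta near 1 and the constant in Mertens' theorem\<close>

text \<open>By the mean value theorem the decrease of \<open>x powr - d\<close> from
  \<open>k\<close> to \<open>k + 1\<close> lies between \<open>d\<close> times two consecutive terms
  of the zeta series, and the total decrease is 1. The extra \<open>d\<close> in the upper bound is
  the first term of the series.\<close>

lemma zeta_near_1:
  fixes d :: real
  assumes d: "d > 0"
  shows "1 \<le> d * (\<Sum>n. real (Suc n) powr - (1 + d))" "d * (\<Sum>n. real (Suc n) powr - (1 + d)) \<le> 1 + d"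
proof -
  define g where "g n = real (Suc n) powr - d" for n
  have g0: "g \<longlonglongrightarrow> 0" unfolding g_def using d by real_asymp
  have tel: "(\<lambda>n. g n - g (Suc n)) sums 1"
    using telescope_sums'[OF g0] by (simp add: g_def)
  have summ: "summable (\<lambda>n. real (Suc n) powr - (1 + d))"
    using d summable_real_powr_iff[of "-(1+d)"] by (subst summable_Suc_iff) auto
  have mvt: "d * real (Suc (Suc n)) powr - (1 + d) \<le> g n - g (Suc n) \<and> g n - g (Suc n) \<le> d * real (Suc n) powr - (1 + d)" for n
  proof -
    have "\<exists>z>real (Suc n). z < real (Suc (Suc n)) \<and> real (Suc (Suc n)) powr - d - real (Suc n) powr - d =
       (real (Suc (Suc n)) - real (Suc n)) * (- d * z powr (- d - 1))"
      by (rule MVT2) (auto intro!: derivative_eq_intros)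
    then obtain z where z: "real (Suc n) < z" "z < real (Suc (Suc n))"
      "g n - g (Suc n) = d * z powr (- d - 1)" unfolding g_def by auto
    have eq: "- d - 1 = - (1 + d)" by simp
    show ?thesis using d z(1,2) unfolding z(3) eq
      by (auto intro!: mult_left_mono powr_mono2')
  qed
  show "1 \<le> d * (\<Sum>n. real (Suc n) powr - (1 + d))"
    using sums_le[OF _ tel summable_sums[OF summable_mult[OF summ, of d]]] mvt suminf_mult[OF summ, of d] by auto
  have "(\<lambda>n. d * real (Suc (Suc n)) powr - (1 + d)) sums (d * (\<Sum>n. real (Suc n) powr - (1 + d)) - d)"
    using sums_mult[OF summable_sums[OF summ], of d] by (subst sums_Suc_iff) simp
  from sums_le[OF _ this tel] mvt show "d * (\<Sum>n. real (Suc n) powr - (1 + d)) \<le> 1 + d" by auto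
qed

lemma ln_one_minus_sums:
  fixes x :: real
  assumes "0 < x" "x < 1"
  shows "(\<lambda>n. x ^ Suc n / real (Suc n)) sums (- ln (1 - x))"
proof -
  have "ln (1 - x) = (\<Sum>n. (-1) ^ n * (1 / real (n + 1)) * (1 - x - 1) ^ Suc n)"
    using assms by (intro ln_series) auto
  moreover have "(-1) ^ n * (1 / real (n + 1)) * (1 - x - 1) ^ Suc n = - (x ^ Suc n / real (Suc n))" for n
  proof -
    have "(1 - x - 1) ^ Suc n = - ((-1) ^ n * x ^ Suc n)"
      using power_mult_distrib[of "-1" x "Suc n"] by simp
    then have "(-1) ^ n * (1 / real (n + 1)) * (1 - x - 1) ^ Suc n =
        - ((-1) ^ n * (-1) ^ n * (x ^ Suc n / real (Suc n)))"
      by (simp only:) (simp add: mult_ac)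
    then show ?thesis by (simp only: minus_one_mult_self mult_1)
  qed
  ultimately have eq: "ln (1 - x) = (\<Sum>n. - (x ^ Suc n / real (Suc n)))" by (simp only:)
  have "summable (\<lambda>n. x ^ Suc n)" using assms by (simp add: summable_geometric)
  then have "summable (\<lambda>n. x ^ Suc n / real (Suc n))"
    by (rule summable_comparison_test'[where N=0]) (use assms in \<open>auto simp: field_simps\<close>)
  then show ?thesis using eq by (simp add: sums_iff suminf_minus)
qed

lemma ln_one_minus_remainder:
  fixes y :: real
  assumes "0 \<le> y" "y \<le> 1 / 2"
  shows "0 \<le> - ln (1 - y) - y" "- ln (1 - y) - y \<le> 2 * y\<^sup>2"
  using ln_le_minus_one[of "1 - y"] ln_one_minus_pos_lower_bound[OF assms] assms by simp_all

text \<open>\<open>r p d\<close> compares the logarithm of the Euler factor at \<open>1 + d\<close>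
  with the weight at 1 damped by \<open>p powr - d\<close>. Both equal
  \<open>p powr - (1 + d)\<close> up to \<open>2 / p^2\<close>, uniformly in \<open>d\<close>, so
  the limit may be taken term by term.\<close>

lemma prime_zeta_shift_tendsto_0:
  defines "r \<equiv> (\<lambda>p d. if prime p then - ln (1 - real p powr - (1 + d)) - real p powr - d * (- ln (1 - 1 / real p)) else 0)"
  shows "((\<lambda>d. \<Sum>p. r p d) \<longlongrightarrow> 0) (at_right 0)" and "\<And>d. d > 0 \<Longrightarrow> summable (\<lambda>p. r p d)"
proof -
  have bound: "\<bar>r p d\<bar> \<le> 2 * (1 / real p ^ 2)" if d: "d > 0" for p d
  proof (cases "prime p")
    case True
    then have p: "real p \<ge> 2" using prime_ge_2_nat of_nat_le_iff[of 2 p, where 'a=real] by simp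
    define y where "y = real p powr - (1 + d)"
    have pd: "0 < real p powr - d" "real p powr - d \<le> 1" using p d powr_le_one_le[of "real p"]
      by (auto simp: powr_minus intro!: inverse_le_1_iff[THEN iffD2] ge_one_powr_ge_zero)
    have y: "y = real p powr - d * (1 / p)" unfolding y_def using p
      by (simp add: powr_diff powr_minus field_simps powr_add)
    have "y \<le> 1 * (1 / p)" unfolding y using pd p by (intro mult_right_mono) auto
    then have y1: "0 \<le> y" "y \<le> 1 / p" using pd p by (auto simp: y)
    have ip: "1 / p \<le> 1 / 2" using p by (intro divide_left_mono) auto
    have A: "0 \<le> - ln (1 - y) - y" "- ln (1 - y) - y \<le> 2 * (1 / p)\<^sup>2"
      using ln_one_minus_remainder[of y] y1 ip power_mono[of y "1 / p" 2] by linarith+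
    have B: "0 \<le> - ln (1 - 1 / p) - 1 / p" "- ln (1 - 1 / p) - 1 / p \<le> 2 * (1 / p)\<^sup>2"
      using ln_one_minus_remainder[of "1 / p"] ip p by auto
    have B': "0 \<le> real p powr - d * (- ln (1 - 1 / p) - 1 / p)"
      "real p powr - d * (- ln (1 - 1 / p) - 1 / p) \<le> 1 * (2 * (1 / p)\<^sup>2)"
      using B pd by (intro mult_nonneg_nonneg mult_mono; simp)+
    have "r p d = (- ln (1 - y) - y) - real p powr - d * (- ln (1 - 1 / p) - 1 / p)"
      using True unfolding r_def y_def[symmetric] by (simp add: y algebra_simps)
    then show ?thesis using A B' by (simp add: power_one_over)
  qed (simp add: r_def)
  have summ: "summable (\<lambda>p. 2 * (1 / real p ^ 2))"
    using inverse_power_summable[of 2, where 'a=real] by (intro summable_mult) (simp add: field_simps)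
  show summr: "summable (\<lambda>p. r p d)" if "d > 0" for d
    using bound[OF that] by (intro summable_comparison_test'[OF summ, where N=0]) auto
  have "((\<lambda>d. \<Sum>p. r p d) \<longlongrightarrow> (\<Sum>p. 0)) (at_right 0)"
  proof (rule tannerys_theorem[THEN conjunct2, THEN conjunct2])
    show "((\<lambda>d. r p d) \<longlongrightarrow> 0) (at_right 0)" for p
    proof (cases "prime p")
      case True
      then have p: "real p > 1" using prime_gt_1_nat by auto
      have "((\<lambda>d. - ln (1 - real p powr - (1 + d)) - real p powr - d * (- ln (1 - 1 / real p))) \<longlongrightarrow>
         - ln (1 - real p powr - (1 + 0)) - real p powr - 0 * (- ln (1 - 1 / real p))) (at_right 0)"
        using p by (intro tendsto_intros) (auto simp: powr_minus field_simps)
      then show ?thesis using True p by (simp add: r_def powr_minus field_simps)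
    qed (simp add: r_def)
    show "\<forall>\<^sub>F (k, n) in sequentially \<times>\<^sub>F at_right 0. norm (r k n) \<le> 2 * (1 / real k ^ 2)"
    proof -
      have "\<forall>\<^sub>F x in sequentially \<times>\<^sub>F at_right (0::real). True \<and> snd x > 0"
        using eventually_prodI[of "\<lambda>_. True" sequentially "\<lambda>d. d > 0" "at_right (0::real)"]
        by (simp add: eventually_at_right_less)
      then show ?thesis by eventually_elim (use bound in auto)
    qed
  qed (use summ in auto)
  then show "((\<lambda>d. \<Sum>p. r p d) \<longlongrightarrow> 0) (at_right 0)" by simp
qed

text \<open>Logarithm of the Euler product at \<open>1 + d\<close>, with its factors exchanged for
  damped weights at 1: these can be grouped into increments of
  \<open>prime_weight_sum\<close>.\<close>

lemma prime_weight_powr_tendsto: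
  fixes d :: real
  assumes d: "d > 0"
  defines "r \<equiv> (\<lambda>p d. if prime p then - ln (1 - real p powr - (1 + d)) - real p powr - d * (- ln (1 - 1 / real p)) else 0)"
  shows "(\<lambda>n. \<Sum>p\<in>primes_upto n. real p powr - d * (- ln (1 - 1 / p))) \<longlonglongrightarrow>
    ln (\<Sum>n. real (Suc n) powr - (1 + d)) - (\<Sum>p. r p d)"
proof -
  define z where "z = (\<Sum>n. real (Suc n) powr - (1 + d))"
  have "d * z > 0" using zeta_near_1(1)[OF d] unfolding z_def by linarith
  then have "z > 0" using d by (simp add: zero_less_mult_iff)
  have p1: "0 < real p powr - (1 + d)" "real p powr - (1 + d) < 1" if "p \<in> primes_upto n" for p n
    using primes_upto_gt_1[OF that] d by (auto simp: powr_less_one)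
  have "(\<lambda>n. \<Prod>p\<in>primes_upto n. 1 / (1 - real p powr - (1 + d))) \<longlonglongrightarrow> z"
    unfolding z_def using d by (intro Euler_product) auto
  then have "(\<lambda>n. ln (\<Prod>p\<in>primes_upto n. 1 / (1 - real p powr - (1 + d)))) \<longlonglongrightarrow> ln z"
    using \<open>z > 0\<close> by (rule tendsto_ln[OF _ less_imp_neq[THEN not_sym]])
  moreover have "ln (\<Prod>p\<in>primes_upto n. 1 / (1 - real p powr - (1 + d))) =
      (\<Sum>p\<in>primes_upto n. - ln (1 - real p powr - (1 + d)))" for n
    using p1[of _ n] by (subst ln_prod) (auto simp: ln_divide_pos intro!: sum.cong dest!: less_imp_neq)
  ultimately have "(\<lambda>n. \<Sum>p\<in>primes_upto n. - ln (1 - real p powr - (1 + d))) \<longlonglongrightarrow> ln z" by simp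
  moreover have "(\<lambda>n. \<Sum>k<Suc n. r k d) \<longlonglongrightarrow> (\<Sum>p. r p d)"
    using prime_zeta_shift_tendsto_0(2)[OF d] unfolding r_def by (intro LIMSEQ_Suc summable_LIMSEQ)
  ultimately have "(\<lambda>n. (\<Sum>p\<in>primes_upto n. - ln (1 - real p powr - (1 + d))) - (\<Sum>k<Suc n. r k d)) \<longlonglongrightarrow> ln z - (\<Sum>p. r p d)"
    by (rule tendsto_diff)
  moreover have "(\<Sum>p\<in>primes_upto n. - ln (1 - real p powr - (1 + d))) - (\<Sum>k<Suc n. r k d) =
     (\<Sum>p\<in>primes_upto n. real p powr - d * (- ln (1 - 1 / p)))" for n
    unfolding sum_primes_upto_conv sum_subtractf[symmetric] by (rule sum.cong) (auto simp: r_def)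
  ultimately show ?thesis by (simp only: z_def)
qed

text \<open>For \<open>p\<close> in \<open>(e^m, e^(m+1)]\<close> the factor
  \<open>p powr - d\<close> lies between \<open>exp (- d) ^ (m + 1)\<close> and
  \<open>exp (- d) ^ m\<close>. A sum over primes thus becomes a power series in
  \<open>exp (- d)\<close>, as Abel's theorem requires, at the cost of a factor that tends to 1 as
  \<open>d\<close> tends to 0.\<close>

lemma prime_weight_powr_bounds:
  fixes d :: real
  assumes d: "d > 0"
  defines "E \<equiv> (\<lambda>m. nat \<lfloor>exp (real m)\<rfloor>)"
  defines "c \<equiv> (\<lambda>m. prime_weight_sum (E (Suc m)) - prime_weight_sum (E m))"
  shows "exp (- d) * (\<Sum>m<M. c m * exp (- d) ^ m) \<le> (\<Sum>p\<in>primes_upto (E M). real p powr - d * (- ln (1 - 1 / p)))"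
        "(\<Sum>p\<in>primes_upto (E M). real p powr - d * (- ln (1 - 1 / p))) \<le> (\<Sum>m<M. c m * exp (- d) ^ m)"
proof -
  define P where "P M = (\<Sum>p\<in>primes_upto (E M). real p powr - d * (- ln (1 - 1 / p)))" for M
  have E0: "primes_upto (E 0) = {}" by (auto simp: E_def primes_upto_def dest: prime_gt_1_nat)
  have sub: "primes_upto (E m) \<subseteq> primes_upto (E (Suc m))" for m
  proof -
    have "E m \<le> E (Suc m)" unfolding E_def by (intro nat_mono floor_mono) auto
    then show ?thesis by (auto simp: primes_upto_def)
  qed
  have wpos: "- ln (1 - 1 / p) \<ge> 0" if "p \<in> primes_upto n" for p n
    using primes_upto_gt_1[OF that] by auto
  have c_eq: "c m = (\<Sum>p\<in>primes_upto (E (Suc m)) - primes_upto (E m). - ln (1 - 1 / p))" for m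
    unfolding c_def prime_weight_sum_def using sub by (subst sum_diff) auto
  have P_eq: "P (Suc m) - P m = (\<Sum>p\<in>primes_upto (E (Suc m)) - primes_upto (E m). real p powr - d * (- ln (1 - 1 / p)))" for m
    unfolding P_def using sub by (subst sum_diff) auto
  have range: "real p powr - d \<le> exp (- d) ^ m" "exp (- d) * exp (- d) ^ m \<le> real p powr - d"
    if "p \<in> primes_upto (E (Suc m)) - primes_upto (E m)" for p m
  proof -
    have p: "p > 1" using that primes_upto_gt_1 by blast
    have "\<not> p \<le> E m" "p \<le> E (Suc m)" using that by (auto simp: primes_upto_def)
    then have "exp (real m) \<le> real p" "real p \<le> exp (real (Suc m))" unfolding E_def by linarith+
    then have "ln (exp (real m)) \<le> ln p" "ln p \<le> ln (exp (real (Suc m)))"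
      using p by (simp_all only: ln_le_cancel_iff exp_gt_zero of_nat_0_less_iff)
    then have "real m \<le> ln p" "ln p \<le> real (Suc m)" by simp_all
    moreover have "real p powr - d = exp (- d * ln p)" using p by (simp add: powr_def)
    moreover have "exp (- d) ^ m = exp (- d * real m)" "exp (- d) * exp (- d) ^ m = exp (- d * real (Suc m))"
      by (simp_all add: exp_of_nat_mult[symmetric] mult.commute algebra_simps flip: exp_add)
    ultimately show "real p powr - d \<le> exp (- d) ^ m" "exp (- d) * exp (- d) ^ m \<le> real p powr - d"
      using d by (simp_all only: exp_le_cancel_iff) (simp_all add: mult_le_cancel_left_neg)
  qed
  have "P (Suc m) - P m \<le> c m * exp (- d) ^ m" for m
    unfolding P_eq c_eq sum_distrib_right
  proof (rule sum_mono)
    fix p assume p: "p \<in> primes_upto (E (Suc m)) - primes_upto (E m)"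
    then have "- ln (1 - 1 / p) \<ge> 0" using wpos by blast
    from mult_right_mono[OF range(1)[OF p] this]
    show "real p powr - d * - ln (1 - 1 / p) \<le> - ln (1 - 1 / p) * exp (- d) ^ m"
      by (simp only: mult.commute)
  qed
  then have upper: "P (Suc m) \<le> P m + c m * exp (- d) ^ m" for m by (simp add: algebra_simps)
  have "exp (- d) * (c m * exp (- d) ^ m) \<le> P (Suc m) - P m" for m
    unfolding P_eq c_eq sum_distrib_right sum_distrib_left
  proof (rule sum_mono)
    fix p assume p: "p \<in> primes_upto (E (Suc m)) - primes_upto (E m)"
    then have "- ln (1 - 1 / p) \<ge> 0" using wpos by blast
    from mult_right_mono[OF range(2)[OF p] this]
    show "exp (- d) * (- ln (1 - 1 / p) * exp (- d) ^ m) \<le> real p powr - d * - ln (1 - 1 / p)"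
      by (simp only: mult_ac)
  qed
  then have lower: "P m + exp (- d) * (c m * exp (- d) ^ m) \<le> P (Suc m)" for m by (simp add: algebra_simps)
  have P0: "P 0 = 0" unfolding P_def E0 by simp
  show "exp (- d) * (\<Sum>m<M. c m * exp (- d) ^ m) \<le> (\<Sum>p\<in>primes_upto (E M). real p powr - d * (- ln (1 - 1 / p)))"
    unfolding P_def[symmetric]
  proof (induction M)
    case (Suc M)
    then show ?case using lower[of M] by (simp add: distrib_left)
  qed (simp add: P0)
  show "(\<Sum>p\<in>primes_upto (E M). real p powr - d * (- ln (1 - 1 / p))) \<le> (\<Sum>m<M. c m * exp (- d) ^ m)"
    unfolding P_def[symmetric]
  proof (induction M)
    case (Suc M)
    then show ?case using upper[of M] by simp
  qed (simp add: P0)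
qed

lemma filterlim_nat_floor_exp: "filterlim (\<lambda>m. nat \<lfloor>exp (real m)\<rfloor>) at_top sequentially"
proof (rule filterlim_at_top_mono)
  show "filterlim (\<lambda>m. m) at_top sequentially" by (rule filterlim_ident)
  show "\<forall>\<^sub>F m in sequentially. m \<le> nat \<lfloor>exp (real m)\<rfloor>"
  proof (intro always_eventually allI)
    fix m
    have "real m \<le> exp (real m)" using exp_ge_add_one_self[of "real m"] by linarith
    then show "m \<le> nat \<lfloor>exp (real m)\<rfloor>" by (simp add: le_nat_iff le_floor_iff)
  qed
qed

lemma ln_ln_nat_floor_exp: "(\<lambda>m. ln (ln (nat \<lfloor>exp (real m)\<rfloor>)) - ln (real m)) \<longlonglongrightarrow> 0"
proof (rule tendsto_sandwich)
  show "(\<lambda>m. ln (ln (exp (real m) - 1)) - ln (real m)) \<longlonglongrightarrow> 0" by real_asymp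
  show "(\<lambda>m. 0) \<longlonglongrightarrow> (0::real)" by simp
  have *: "ln (ln (exp (real m) - 1)) \<le> ln (ln (nat \<lfloor>exp (real m)\<rfloor>)) \<and> ln (ln (nat \<lfloor>exp (real m)\<rfloor>)) \<le> ln (real m)"
    if m: "m \<ge> 2" for m
  proof -
    define E where "E = real (nat \<lfloor>exp (real m)\<rfloor>)"
    have E: "exp (real m) - 1 \<le> E" "E \<le> exp (real m)" unfolding E_def by (linarith, simp add: of_nat_floor)
    have "2 < exp (real m) - 1" using exp_ge_add_one_self[of "real m"] m
      exp_lower_Taylor_quadratic[of "real m"] power_mono[of 2 "real m" 2] by simp
    then have "0 < ln (exp (real m) - 1)" "ln (exp (real m) - 1) \<le> ln E" "ln E \<le> ln (exp (real m))"
      using E m by (auto simp del: ln_exp intro!: ln_gt_zero ln_le_cancel_iff[THEN iffD2])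
    then show ?thesis unfolding E_def[symmetric] by auto
  qed
  show "\<forall>\<^sub>F m in sequentially. ln (ln (exp (real m) - 1)) - ln (real m) \<le> ln (ln (nat \<lfloor>exp (real m)\<rfloor>)) - ln (real m)"
       "\<forall>\<^sub>F m in sequentially. ln (ln (nat \<lfloor>exp (real m)\<rfloor>)) - ln (real m) \<le> 0"
    using * by (auto intro: eventually_sequentiallyI[of 2])
qed

text \<open>
  To identify the limit, collect the weights of the primes in \<open>(e\<^sup>m, e\<^bsup>m+1\<^esup>]\<close> into a coefficient
  \<open>c m\<close>. The partial sums of \<open>c m - 1 / (m + 1)\<close> tend to the limit minus \<open>\<gamma>\<close>, so by Abel's theorem
  this is the limit of \<open>\<Sum>\<^sub>m (c m - 1 / (m + 1)) x\<^sup>m\<close>. At \<open>x = e\<^bsup>-d\<^esup>\<close> both parts are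
  \<open>ln (1 / d) + o(1)\<close>, the first one because it agrees with \<open>ln \<zeta>(1 + d)\<close> up to \<open>o(1)\<close>.
\<close>

theorem Mertens_third_theorem: "(\<lambda>n. prime_weight_sum n - ln (ln n)) \<longlonglongrightarrow> euler_mascheroni"
proof -
  define \<gamma> where "\<gamma> = (euler_mascheroni :: real)"
  obtain C where C: "(\<lambda>n. prime_weight_sum n - ln (ln n)) \<longlonglongrightarrow> C"
    using prime_weight_sum_converges by blast
  define E where "E m = nat \<lfloor>exp (real m)\<rfloor>" for m :: nat
  define c where "c m = prime_weight_sum (E (Suc m)) - prime_weight_sum (E m)" for m
  define f where "f m = c m - 1 / real (Suc m)" for m
  define F where "F x = (\<Sum>k. f k * x ^ k)" for x
  define r where "r p d = (if prime p then - ln (1 - real p powr - (1 + d)) - real p powr - d * (- ln (1 - 1 / real p)) else 0)" for p d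
  define T where "T d = ln (\<Sum>n. real (Suc n) powr - (1 + d)) - (\<Sum>p. r p d)" for d
  have E_top: "filterlim E at_top sequentially" unfolding E_def by (rule filterlim_nat_floor_exp)
  have W0: "prime_weight_sum (E 0) = 0"
    unfolding prime_weight_sum_def E_def by (rule sum.neutral) (auto simp: primes_upto_def dest: prime_gt_1_nat)
  have f_sum: "(\<Sum>m<M. f m) = prime_weight_sum (E M) - harm M" for M
    by (induction M) (auto simp: f_def c_def W0 harm_Suc harm_def inverse_eq_divide)
  \<comment> \<open>Euler's constant enters here, as the limit of
    \<open>harm M - ln M\<close>.\<close>
  have "(\<lambda>M. (prime_weight_sum (E M) - ln (ln (real (E M)))) + (ln (ln (real (E M))) - ln (real M)) - (harm M - ln (real M))) \<longlonglongrightarrow> C + 0 - \<gamma>"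
    unfolding \<gamma>_def E_def using ln_ln_nat_floor_exp
    by (intro tendsto_diff tendsto_add euler_mascheroni_LIMSEQ filterlim_compose[OF C filterlim_nat_floor_exp]) auto
  then have f_sums: "f sums (C - \<gamma>)" unfolding sums_def f_sum by simp
  have exp_lim: "filterlim (\<lambda>d. exp (- d)) (at_left 1) (at_right (0::real))" by real_asymp
  have F_lim: "((\<lambda>d. F (exp (- d))) \<longlongrightarrow> C - \<gamma>) (at_right 0)"
    unfolding F_def by (rule filterlim_compose[OF Abel_limit(1)[OF f_sums] exp_lim])
  have T_bounds: "exp (- d) * F (exp (- d)) - ln (1 - exp (- d)) \<le> T d"
                 "T d \<le> F (exp (- d)) - ln (1 - exp (- d)) / exp (- d)" if d: "d > 0" for d
  proof -
    define x where "x = exp (- d)"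
    have x: "0 < x" "x < 1" unfolding x_def using d by auto
    have "(\<lambda>m. x ^ m / real (Suc m)) sums (- ln (1 - x) / x)"
    proof -
      have "x ^ Suc m / real (Suc m) / x = x ^ m / real (Suc m)" for m
        using x by (simp del: of_nat_Suc)
      then show ?thesis using sums_divide[OF ln_one_minus_sums[OF x], of x] by simp
    qed
    moreover have "(\<lambda>m. f m * x ^ m) sums F x"
      unfolding F_def using Abel_limit(2)[OF f_sums x] by (rule summable_sums)
    ultimately have "(\<lambda>m. f m * x ^ m + x ^ m / real (Suc m)) sums (F x + - ln (1 - x) / x)"
      by (intro sums_add)
    moreover have "f m * x ^ m + x ^ m / real (Suc m) = c m * x ^ m" for m
      by (simp add: f_def algebra_simps)
    ultimately have c_sums: "(\<lambda>M. \<Sum>m<M. c m * x ^ m) \<longlonglongrightarrow> F x - ln (1 - x) / x"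
      by (simp add: sums_def)
    have lim: "(\<lambda>M. \<Sum>p\<in>primes_upto (E M). real p powr - d * (- ln (1 - 1 / p))) \<longlonglongrightarrow> T d"
      unfolding T_def r_def by (rule filterlim_compose[OF prime_weight_powr_tendsto[OF d] E_top])
    have "x * (F x - ln (1 - x) / x) \<le> T d"
      using prime_weight_powr_bounds(1)[OF d, folded E_def, folded c_def, folded x_def]
      by (intro LIMSEQ_le[OF tendsto_mult[OF tendsto_const c_sums] lim]) auto
    then show "x * F x - ln (1 - x) \<le> T d" using x by (simp add: right_diff_distrib)
    show "T d \<le> F x - ln (1 - x) / x"
      using prime_weight_powr_bounds(2)[OF d, folded E_def, folded c_def, folded x_def]
      by (intro LIMSEQ_le[OF lim c_sums]) auto
  qed
  have T_lim: "((\<lambda>d. T d + ln d) \<longlongrightarrow> 0) (at_right 0)"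
  proof -
    have "((\<lambda>d. d * (\<Sum>n. real (Suc n) powr - (1 + d))) \<longlongrightarrow> 1) (at_right 0)"
    proof (rule tendsto_sandwich)
      show "((\<lambda>d::real. 1) \<longlongrightarrow> 1) (at_right (0::real))" by simp
      show "((\<lambda>d::real. 1 + d) \<longlongrightarrow> 1) (at_right 0)" by real_asymp
    qed (use zeta_near_1 in \<open>auto simp: eventually_at_right_less intro: eventually_mono[OF eventually_at_right_less]\<close>)
    then have "((\<lambda>d. ln (d * (\<Sum>n. real (Suc n) powr - (1 + d))) - (\<Sum>p. r p d)) \<longlongrightarrow> ln 1 - 0) (at_right 0)"
      unfolding r_def by (intro tendsto_diff tendsto_ln prime_zeta_shift_tendsto_0(1)) auto
    then have "((\<lambda>d. ln (d * (\<Sum>n. real (Suc n) powr - (1 + d))) - (\<Sum>p. r p d)) \<longlongrightarrow> 0) (at_right 0)" by simp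
    moreover have "\<forall>\<^sub>F d in at_right 0. ln (d * (\<Sum>n. real (Suc n) powr - (1 + d))) - (\<Sum>p. r p d) = T d + ln d"
      using eventually_at_right_less[of 0]
    proof eventually_elim
      case (elim d)
      have "d * (\<Sum>n. real (Suc n) powr - (1 + d)) > 0" using zeta_near_1(1)[OF elim] by linarith
      then have "(\<Sum>n. real (Suc n) powr - (1 + d)) > 0" using elim by (simp add: zero_less_mult_iff)
      then show ?case unfolding T_def using elim by (simp add: ln_mult)
    qed
    ultimately show ?thesis by (rule Lim_transform_eventually)
  qed
  have lo: "((\<lambda>d. exp (- d) * F (exp (- d)) - ln (1 - exp (- d)) + ln d) \<longlongrightarrow> C - \<gamma>) (at_right 0)"
  proof -
    have "((\<lambda>d. exp (- d) :: real) \<longlongrightarrow> 1) (at_right 0)" "((\<lambda>d::real. - ln (1 - exp (- d)) + ln d) \<longlongrightarrow> 0) (at_right 0)"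
      by real_asymp+
    from tendsto_add[OF tendsto_mult[OF this(1) F_lim] this(2)] show ?thesis by (simp add: algebra_simps)
  qed
  \<comment> \<open>Division by \<open>exp (- d)\<close> changes the logarithm by about
    \<open>d * ln (1 / d)\<close>, which tends to 0.\<close>
  have hi: "((\<lambda>d. F (exp (- d)) - ln (1 - exp (- d)) / exp (- d) + ln d) \<longlongrightarrow> C - \<gamma>) (at_right 0)"
  proof -
    have "((\<lambda>d::real. - ln (1 - exp (- d)) / exp (- d) + ln d) \<longlongrightarrow> 0) (at_right 0)"
      by real_asymp
    from tendsto_add[OF F_lim this] show ?thesis by (simp add: algebra_simps)
  qed
  have "C - \<gamma> \<le> 0"
    by (rule tendsto_le[OF _ T_lim lo]) (auto intro!: eventually_mono[OF eventually_at_right_less] T_bounds)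
  moreover have "0 \<le> C - \<gamma>"
    by (rule tendsto_le[OF _ hi T_lim]) (auto intro!: eventually_mono[OF eventually_at_right_less] T_bounds)
  ultimately show ?thesis using C by (simp add: \<gamma>_def)
qed

section \<open>Asymptotics of the product of the minima\<close>

definition gcd_form_bound :: "nat \<Rightarrow> real" where
  "gcd_form_bound n = (\<Prod>p\<in>primes_upto n. (1 - 1 / p) / (1 + 1 / p))"

text \<open>Each factor is \<open>(1 - 1/p)^2 / (1 - 1/p^2)\<close>: the squared Mertens product
  times the Euler product of zeta at 2. These give \<open>exp (- 2 * euler_mascheroni)\<close> and
  \<open>pi^2 / 6\<close>; the remaining 12 in the final constant 72 comes from the integral of
  \<open>psi^2\<close>.\<close>

theorem gcd_form_bound_asymp:
  "(\<lambda>n. gcd_form_bound n * (ln n)\<^sup>2) \<longlonglongrightarrow> pi\<^sup>2 / 6 * exp (- 2 * euler_mascheroni)"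
proof -
  have pos: "0 < 1 - 1 / real p" if "p \<in> primes_upto n" for p n
    using primes_upto_gt_1[OF that] by simp
  have "(\<lambda>n. \<Prod>p\<in>primes_upto n. 1 / (1 - real p powr - 2)) \<longlonglongrightarrow> (\<Sum>n. real (Suc n) powr - 2)"
    by (rule Euler_product) simp
  also have "(\<Sum>n. real (Suc n) powr - 2) = pi\<^sup>2 / 6"
  proof -
    have "real (Suc n) powr - 2 = 1 / (real n + 1)\<^sup>2" for n
      by (simp add: powr_minus inverse_eq_divide add.commute)
    then show ?thesis using inverse_squares_sums by (simp add: sums_iff add.commute)
  qed
  finally have zeta2: "(\<lambda>n. \<Prod>p\<in>primes_upto n. 1 / (1 - real p powr - 2)) \<longlonglongrightarrow> pi\<^sup>2 / 6" .
  have prodw: "(\<Prod>p\<in>primes_upto n. (1 - 1 / real p)) = exp (- prime_weight_sum n)" for n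
  proof -
    have "- prime_weight_sum n = (\<Sum>p\<in>primes_upto n. ln (1 - 1 / p))"
      by (simp add: prime_weight_sum_def sum_negf)
    then have "exp (- prime_weight_sum n) = (\<Prod>p\<in>primes_upto n. exp (ln (1 - 1 / real p)))"
      by (simp only: exp_sum[OF finite_primes_upto])
    also have "\<dots> = (\<Prod>p\<in>primes_upto n. (1 - 1 / real p))"
      by (rule prod.cong[OF refl]) (rule exp_ln[OF pos])
    finally show ?thesis by simp
  qed
  have "(\<lambda>n. exp (- 2 * (prime_weight_sum n - ln (ln n)))) \<longlonglongrightarrow> exp (- 2 * euler_mascheroni)"
    by (intro tendsto_intros Mertens_third_theorem)
  from tendsto_mult[OF zeta2 this]
  have "(\<lambda>n. (\<Prod>p\<in>primes_upto n. 1 / (1 - real p powr - 2)) * exp (- 2 * (prime_weight_sum n - ln (ln n)))) \<longlonglongrightarrow>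
     pi\<^sup>2 / 6 * exp (- 2 * euler_mascheroni)" .
  moreover have "\<forall>\<^sub>F n in sequentially. (\<Prod>p\<in>primes_upto n. 1 / (1 - real p powr - 2)) * exp (- 2 * (prime_weight_sum n - ln (ln n))) =
     gcd_form_bound n * (ln n)\<^sup>2"
    using eventually_ge_at_top[of 2]
  proof eventually_elim
    case (elim n)
    have "exp (- 2 * (prime_weight_sum n - ln (ln n))) = exp (- prime_weight_sum n) ^ 2 * exp (ln (ln n)) ^ 2"
    proof -
      have "- 2 * (prime_weight_sum n - ln (ln n)) = of_nat 2 * - prime_weight_sum n + of_nat 2 * ln (ln n)" by simp
      then show ?thesis by (simp only: exp_add exp_of_nat_mult)
    qed
    also have "\<dots> = (\<Prod>p\<in>primes_upto n. (1 - 1 / real p)\<^sup>2) * (ln n)\<^sup>2"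
      using elim by (simp add: prodw[symmetric] prod_power_distrib)
    finally have "(\<Prod>p\<in>primes_upto n. 1 / (1 - real p powr - 2)) * exp (- 2 * (prime_weight_sum n - ln (ln n))) =
      (\<Prod>p\<in>primes_upto n. 1 / (1 - real p powr - 2) * (1 - 1 / real p)\<^sup>2) * (ln n)\<^sup>2"
      by (simp only: prod.distrib mult.assoc)
    also have "(\<Prod>p\<in>primes_upto n. 1 / (1 - real p powr - 2) * (1 - 1 / real p)\<^sup>2) = gcd_form_bound n"
      unfolding gcd_form_bound_def
    proof (rule prod.cong)
      fix p assume "p \<in> primes_upto n"
      then have p: "real p > 1" using primes_upto_gt_1 by fastforce
      have "1 - real p powr - 2 = (1 - 1 / p) * (1 + 1 / p)"
        using p by (simp add: powr_minus field_simps power2_eq_square)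
      moreover have "1 - 1 / p > 0" "1 + 1 / p > 0" using p by (simp_all add: add_pos_nonneg)
      ultimately show "1 / (1 - real p powr - 2) * (1 - 1 / real p)\<^sup>2 = (1 - 1 / p) / (1 + 1 / p)"
        by (simp add: power2_eq_square)
    qed simp
    finally show ?case .
  qed
  ultimately show ?thesis by (rule Lim_transform_eventually)
qed

section \<open>The GCD form\<close>

lemma psi_add_of_int [simp]: "psi (x + of_int k) = psi x"
  by (simp add: psi_def frac_def)

lemma psi_minus: "x \<notin> \<int> \<Longrightarrow> psi (- x) = - psi x"
  by (simp add: psi_def frac_neg)

lemma abs_psi_le: "\<bar>psi x\<bar> \<le> 1 / 2"
  using frac_ge_0[of x] frac_lt_1[of x] unfolding psi_def by linarith

text \<open>The map from \<open>j\<close> to \<open>m + a j\<close> permutes the residues modulo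
  \<open>b\<close>, and \<open>g\<close> depends only on the residue.\<close>

lemma sum_periodic_coprime:
  fixes g :: "int \<Rightarrow> real" and a b :: nat
  assumes b: "b > 0" and periodic: "\<And>k l. g (k + l * int b) = g k" and ab: "coprime a b"
  shows "(\<Sum>j<b. g (m + int a * int j)) = (\<Sum>j<b. g (int j))"
proof -
  define h where "h j = nat ((m + int a * int j) mod int b)" for j
  have h_int: "int (h j) = (m + int a * int j) mod int b" for j using b by (simp add: h_def)
  have "inj_on h {..<b}"
  proof (rule inj_onI)
    fix i j assume ij: "i \<in> {..<b}" "j \<in> {..<b}" "h i = h j"
    then have "[m + int a * int i = m + int a * int j] (mod int b)"
      unfolding cong_def using h_int by metis
    then have "[int a * int i = int a * int j] (mod int b)" by (simp add: cong_add_lcancel)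
    then have "[int i = int j] (mod int b)" using ab by (simp add: cong_mult_lcancel)
    then show "i = j" using ij by (simp add: cong_def)
  qed
  moreover have "h ` {..<b} \<subseteq> {..<b}" using b by (auto simp: h_def nat_less_iff)
  ultimately have "bij_betw h {..<b} {..<b}" by (simp add: bij_betw_def endo_inj_surj)
  then have "(\<Sum>j<b. g (int j)) = (\<Sum>j<b. g (int (h j)))"
    by (rule sum.reindex_bij_betw [symmetric])
  also have "\<dots> = (\<Sum>j<b. g (m + int a * int j))"
  proof (rule sum.cong[OF refl])
    fix j
    show "g (int (h j)) = g (m + int a * int j)" unfolding h_int
      using periodic[of "(m + int a * int j) mod int b" "(m + int a * int j) div int b"]
      by simp
  qed
  finally show ?thesis ..
qed

text \<open>Distribution relation of the sawtooth. After the permutation of the residues the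
  arguments are \<open>(j + t) / b\<close> with \<open>0 <= t < 1\<close>; they lie in
  \<open>[0, 1)\<close>, so the values form an explicit arithmetic progression.\<close>

lemma sum_psi_residues:
  fixes a b :: nat
  assumes b: "b > 0" and ab: "coprime a b"
  shows "(\<Sum>j<b. psi ((y + real a * real j) / real b)) = psi y"
proof -
  define t where "t = frac y"
  define g where "g k = psi ((of_int k + t) / real b)" for k :: int
  have t: "0 \<le> t" "t < 1" "y = of_int \<lfloor>y\<rfloor> + t"
    using frac_ge_0[of y] frac_lt_1[of y] by (auto simp: t_def frac_def)
  have "g (k + l * int b) = g k" for k l
  proof -
    have "(of_int (k + l * int b) + t) / real b = (of_int k + t) / real b + of_int l"
      using b by (simp add: field_simps)
    then show ?thesis unfolding g_def by (simp only: psi_add_of_int)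
  qed
  then have "(\<Sum>j<b. g (\<lfloor>y\<rfloor> + int a * int j)) = (\<Sum>j<b. g (int j))"
    by (intro sum_periodic_coprime b ab)
  also have "\<dots> = (\<Sum>j<b. 1 / 2 - (real j + t) / real b)"
  proof (rule sum.cong[OF refl])
    fix j assume "j \<in> {..<b}"
    then have "real j + 1 \<le> real b" by (simp add: nat_less_real_le)
    then have "0 \<le> (real j + t) / real b" "(real j + t) / real b < 1" using t b by auto
    then have "frac ((real j + t) / real b) = (real j + t) / real b" by (simp add: frac_eq)
    then show "g (int j) = 1 / 2 - (real j + t) / real b" by (simp add: g_def psi_def)
  qed
  also have "\<dots> = real b / 2 - ((\<Sum>j<b. real j) + real b * t) / real b"
    by (simp add: sum_subtractf sum.distrib flip: sum_divide_distrib)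
  also have "(\<Sum>j<b. real j) = real b * (real b - 1) / 2"
    by (induction b) (auto simp: field_simps)
  also have "real b / 2 - (real b * (real b - 1) / 2 + real b * t) / real b = 1 / 2 - t"
    using b by (simp add: field_simps)
  also have "\<dots> = psi y" by (simp add: psi_def t_def)
  finally have "(\<Sum>j<b. g (\<lfloor>y\<rfloor> + int a * int j)) = psi y" .
  moreover have "g (\<lfloor>y\<rfloor> + int a * int j) = psi ((y + real a * real j) / real b)" for j
  proof -
    have "of_int (\<lfloor>y\<rfloor> + int a * int j) + t = y + real a * real j" using t(3) by simp
    then show ?thesis by (simp only: g_def)
  qed
  ultimately show ?thesis by simp
qed

lemma psi_measurable [measurable]: "psi \<in> borel_measurable borel"
  unfolding psi_def[abs_def] frac_def[abs_def] by measurable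

lemma integrable_psi_mult: "(\<lambda>x. psi (a * x + c) * psi (b * x + d)) integrable_on {u..v}"
proof (rule measurable_bounded_by_integrable_imp_integrable)
  have "(\<lambda>x. psi (a * x + c) * psi (b * x + d)) \<in> borel_measurable borel" by measurable
  then show "(\<lambda>x. psi (a * x + c) * psi (b * x + d)) \<in> borel_measurable (lebesgue_on {u..v})"
    by (intro measurable_restrict_space1 measurable_completion) simp
  show "(\<lambda>x::real. 1 / 2 * (1 / 2) :: real) integrable_on {u..v}" by (rule integrable_const_ivl)
  fix x
  show "norm (psi (a * x + c) * psi (b * x + d)) \<le> 1 / 2 * (1 / 2)"
    unfolding real_norm_def abs_mult by (intro mult_mono abs_psi_le) auto
qed simp

lemma integral_0_1_split:
  fixes F :: "real \<Rightarrow> real"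
  assumes F: "F integrable_on {0..1}" and n: "n > 0"
  shows "integral {0..1} F = (\<Sum>j<n. integral {0..1} (\<lambda>u. F ((u + real j) / real n))) / real n"
proof -
  have sub: "F integrable_on {u..v}" if "0 \<le> u" "v \<le> 1" for u v
    by (rule integrable_subinterval_real[OF F]) (use that in auto)
  have piece: "integral {real j / n..real (Suc j) / n} F = integral {0..1} (\<lambda>u. F ((u + real j) / real n)) / n"
    if "j < n" for j
  proof -
    have "real (Suc j) / n \<le> 1" using that by simp
    then have "(F has_integral integral {real j / n..real (Suc j) / n} F) (cbox (real j / n) (real (Suc j) / n))"
      using sub by (auto intro!: integrable_integral)
    from has_integral_affinity[OF this, of "1 / n" "real j / n"] n
    have "((\<lambda>u. F ((u + real j) / n)) has_integral (n * integral {real j / n..real (Suc j) / n} F))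
      ((\<lambda>x. n * x - real j) ` {real j / n..real (Suc j) / n})"
      by (simp add: add_divide_distrib)
    also have "(\<lambda>x. n * x - real j) ` {real j / n..real (Suc j) / n} = {0..1}"
    proof -
      have "(\<lambda>x. n * x + - real j) ` {real j / n..real (Suc j) / n} = {0..1}"
        using n by (subst image_affinity_atLeastAtMost) (auto simp: divide_right_mono field_simps)
      then show ?thesis by simp
    qed
    finally show ?thesis using n by (simp add: integral_unique)
  qed
  have "m \<le> n \<Longrightarrow> integral {0..real m / n} F = (\<Sum>j<m. integral {real j / n..real (Suc j) / n} F)" for m
  proof (induction m)
    case (Suc m)
    have "integral {0..real m / n} F + integral {real m / n..real (Suc m) / n} F = integral {0..real (Suc m) / n} F"
      using Suc.prems n by (intro Henstock_Kurzweil_Integration.integral_combine sub) (auto simp: divide_right_mono)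
    with Suc show ?case by simp
  qed simp
  from this[of n] have "integral {0..1} F = (\<Sum>j<n. integral {real j / n..real (Suc j) / n} F)"
    using n by simp
  also have "\<dots> = (\<Sum>j<n. integral {0..1} (\<lambda>u. F ((u + real j) / real n)) / n)"
    by (intro sum.cong refl piece) simp
  finally show ?thesis by (simp add: sum_divide_distrib)
qed

text \<open>On each of \<open>b\<close> equal pieces of \<open>[0, 1]\<close> the factor
  \<open>psi (b x)\<close> becomes \<open>psi u\<close>, while the values of
  \<open>psi (a x)\<close> over the pieces add up to \<open>psi (a u)\<close> by the distribution
  relation.\<close>

lemma integral_psi_coprime_step:
  fixes a b :: nat
  assumes b: "b > 0" and ab: "coprime a b"
  shows "integral {0..1} (\<lambda>x. psi (a * x) * psi (b * x)) = integral {0..1} (\<lambda>x. psi (a * x) * psi x) / b"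
proof -
  have int: "(\<lambda>x. psi (a * x) * psi (b * x)) integrable_on {0..1}"
    using integrable_psi_mult[of a 0 b 0] by simp
  have eq: "psi (a * ((u + real j) / b)) * psi (b * ((u + real j) / b)) = psi ((a * u + real a * real j) / b) * psi u" for u :: real and j
  proof -
    have "psi (b * ((u + real j) / b)) = psi (u + of_int (int j))" using b by simp
    also have "\<dots> = psi u" by (rule psi_add_of_int)
    finally show ?thesis by (simp add: distrib_left)
  qed
  have "integral {0..1} (\<lambda>x. psi (a * x) * psi (b * x)) =
    (\<Sum>j<b. integral {0..1} (\<lambda>u. psi ((a * u + real a * real j) / b) * psi u)) / b"
    unfolding integral_0_1_split[OF int b] eq ..
  also have "(\<Sum>j<b. integral {0..1} (\<lambda>u. psi ((a * u + real a * real j) / b) * psi u)) =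
     integral {0..1} (\<lambda>u. \<Sum>j<b. psi ((a * u + real a * real j) / b) * psi u)"
    using integrable_psi_mult[of "a / b" "real a * real j / b" 1 0 for j]
    by (intro integral_sum [symmetric]) (auto simp: add_divide_distrib)
  also have "\<dots> = integral {0..1} (\<lambda>x. psi (a * x) * psi x)"
    unfolding sum_distrib_right[symmetric] sum_psi_residues[OF b ab] ..
  finally show ?thesis .
qed

lemma integral_psi_square: "integral {0..1} (\<lambda>x. psi x * psi x) = 1 / 12"
proof -
  have "((\<lambda>x::real. (1 / 2 - x) * (1 / 2 - x)) has_integral
      (- ((1 / 2 - 1) ^ 3 / 3) - - ((1 / 2 - 0) ^ 3 / 3))) {0..1}"
    by (intro fundamental_theorem_of_calculus)
       (auto intro!: derivative_eq_intros simp: power2_eq_square simp flip: has_real_derivative_iff_has_vector_derivative)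
  then have "((\<lambda>x. psi x * psi x) has_integral (- ((1 / 2 - 1) ^ 3 / 3) - - ((1 / 2 - 0) ^ 3 / 3))) {0..1}"
    by (rule has_integral_spike_finite[rotated 2, of _ _ _ "{1}"]) (auto simp: psi_def frac_eq)
  then show ?thesis by (simp add: integral_unique power3_eq_cube)
qed

lemma integral_psi_nat:
  fixes a b :: nat
  assumes a: "a > 0" and b: "b > 0"
  shows "integral {0..1} (\<lambda>x. psi (a * x) * psi (b * x)) = (real (gcd a b))\<^sup>2 / (12 * a * b)"
proof -
  define d where "d = gcd a b"
  have d: "d > 0" using a by (simp add: d_def)
  then have "\<exists>a' b'. a = a' * d \<and> b = b' * d \<and> coprime a' b'"
    unfolding d_def by (intro gcd_coprime_exists) simp
  then obtain a' b' where ab: "a = a' * d" "b = b' * d" "coprime a' b'" by blast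
  have pos: "d > 0" "a' > 0" "b' > 0" using a b d ab(1,2) by (auto intro: Nat.gr0I)
  define f where "f x = psi (a' * x) * psi (b' * x)" for x :: real
  have "integral {0..1} (\<lambda>x. psi (a * x) * psi (b * x)) = integral {0..1} (\<lambda>x. f (d * x))"
    by (simp add: f_def ab mult_ac)
  \<comment> \<open>\<open>f\<close> has period 1, so dilation by the positive integer
    \<open>d\<close> preserves the integral.\<close>
  also have "\<dots> = integral {0..1} f"
  proof -
    have "(\<lambda>x. f (d * x)) integrable_on {0..1}"
      using integrable_psi_mult[of "a' * d" 0 "b' * d" 0] by (simp add: f_def mult_ac)
    moreover have "f (d * ((u + real j) / d)) = f u" for u j
    proof -
      have "d * ((u + real j) / d) = u + real j" using pos by simp
      then have "a' * (d * ((u + real j) / d)) = a' * u + of_int (int (a' * j))"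
           "b' * (d * ((u + real j) / d)) = b' * u + of_int (int (b' * j))"
        by (simp_all only:) (simp_all add: distrib_left)
      then show ?thesis unfolding f_def by (simp only: psi_add_of_int)
    qed
    ultimately show ?thesis using pos by (subst integral_0_1_split[where n=d]) auto
  qed
  \<comment> \<open>The reduction is used twice: it removes \<open>b'\<close> and then, with the
    roles exchanged, \<open>a'\<close>.\<close>
  also have "\<dots> = integral {0..1} (\<lambda>x. psi (real 1 * x) * psi (a' * x)) / b'"
    unfolding f_def using integral_psi_coprime_step[OF pos(3) ab(3)] by (simp add: mult.commute)
  also have "integral {0..1} (\<lambda>x. psi (real 1 * x) * psi (a' * x)) = (1 / 12) / a'"
    by (subst integral_psi_coprime_step[OF pos(2)]) (auto simp: integral_psi_square)
  also have "1 / 12 / a' / b' = (real d)\<^sup>2 / (12 * a * b)"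
    using pos by (simp add: ab(1,2) power2_eq_square)
  finally show ?thesis by (simp only: d_def)
qed

text \<open>\<open>psi\<close> is odd away from the integers, and \<open>a x\<close> or
  \<open>b x\<close> is an integer for only finitely many \<open>x\<close> in \<open>[0, 1]\<close>;
  hence the signs factor out of the integral.\<close>

lemma integral_psi_int:
  fixes a b :: int
  assumes a: "a \<noteq> 0" and b: "b \<noteq> 0"
  shows "integral {0..1} (\<lambda>x. psi (a * x) * psi (b * x)) = (real_of_int (gcd a b))\<^sup>2 / (12 * a * b)"
proof -
  have fin: "finite {x\<in>{0..1::real}. of_int k * x \<in> \<int>}" if "k \<noteq> 0" for k :: int
  proof (rule finite_subset)
    show "{x\<in>{0..1::real}. of_int k * x \<in> \<int>} \<subseteq> (\<lambda>m. of_int m / of_int k) ` {-\<bar>k\<bar>..\<bar>k\<bar>}"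
    proof (rule subsetI)
      fix x :: real assume "x \<in> {x\<in>{0..1::real}. of_int k * x \<in> \<int>}"
      then have x: "x \<in> {0..1}" "of_int k * x \<in> \<int>" by auto
      then obtain m where m: "of_int k * x = of_int m" by (auto elim: Ints_cases)
      have "\<bar>of_int k * x\<bar> \<le> \<bar>of_int k\<bar> * 1" unfolding abs_mult using x by (intro mult_left_mono) auto
      then have "\<bar>m\<bar> \<le> \<bar>k\<bar>" unfolding m by linarith
      moreover have "x = of_int m / of_int k" using m that by (simp add: field_simps)
      ultimately show "x \<in> (\<lambda>m. of_int m / of_int k) ` {-\<bar>k\<bar>..\<bar>k\<bar>}" by (intro image_eqI[of _ _ m]) auto
    qed
  qed simp
  have sgn: "psi (of_int k * x) = of_int (sgn k) * psi (of_int \<bar>k\<bar> * x)" if "of_int k * x \<notin> \<int>" for k x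
    using that psi_minus[of "of_int k * x"] by (cases "k = 0"; cases "k > 0") (auto simp: psi_def[of 0])
  have "integral {0..1} (\<lambda>x. psi (a * x) * psi (b * x)) =
    integral {0..1} (\<lambda>x. of_int (sgn a * sgn b) * (psi (nat \<bar>a\<bar> * x) * psi (nat \<bar>b\<bar> * x)))"
    by (rule integral_spike[of "{x\<in>{0..1::real}. of_int a * x \<in> \<int>} \<union> {x\<in>{0..1::real}. of_int b * x \<in> \<int>}"])
       (use fin[OF a] fin[OF b] in \<open>auto simp: sgn intro: negligible_finite\<close>)
  also have "\<dots> = of_int (sgn a * sgn b) * ((real (gcd (nat \<bar>a\<bar>) (nat \<bar>b\<bar>)))\<^sup>2 / (12 * nat \<bar>a\<bar> * nat \<bar>b\<bar>))"
    using a b by (simp add: integral_psi_nat del: of_nat_nat)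
  also have "real (gcd (nat \<bar>a\<bar>) (nat \<bar>b\<bar>)) = real_of_int (gcd a b)"
    by (simp only: gcd_int_def of_int_of_nat_eq)
  also have "of_int (sgn a * sgn b) * ((real_of_int (gcd a b))\<^sup>2 / (12 * nat \<bar>a\<bar> * nat \<bar>b\<bar>)) =
      (real_of_int (gcd a b))\<^sup>2 / (12 * a * b)"
    using a b by (cases "a > 0"; cases "b > 0") (auto simp: sgn_if)
  finally show ?thesis .
qed

theorem N_eq_gcd_sum:
  assumes "0 \<notin> set as"
  shows "N as = (\<Sum>i<length as. \<Sum>j<length as. (real_of_int (gcd (as ! i) (as ! j)))\<^sup>2 / (as ! i * as ! j)) / 12"
proof -
  let ?n = "length as"
  have nz: "as ! i \<noteq> 0" if "i < ?n" for i using assms that nth_mem by fastforce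
  have "(list_fun as x)\<^sup>2 = (\<Sum>i<?n. \<Sum>j<?n. psi (as ! i * x) * psi (as ! j * x))" for x :: real
    by (simp add: list_fun_def power2_eq_square sum_list_sum_nth atLeast0LessThan sum_product)
  moreover have int: "(\<lambda>x. psi (of_int k * x) * psi (of_int l * x)) integrable_on {0..1}" for k l
    using integrable_psi_mult[of "of_int k" 0 "of_int l" 0] by simp
  ultimately have "N as = (\<Sum>i<?n. \<Sum>j<?n. integral {0..1} (\<lambda>x. psi (as ! i * x) * psi (as ! j * x)))"
    unfolding N_def by (simp add: integral_sum integrable_sum)
  also have "\<dots> = (\<Sum>i<?n. \<Sum>j<?n. (real_of_int (gcd (as ! i) (as ! j)))\<^sup>2 / (as ! i * as ! j) / 12)"
    using nz by (intro sum.cong refl) (simp add: integral_psi_int)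
  finally show ?thesis by (simp add: sum_divide_distrib)
qed

section \<open>The lower bound\<close>

text \<open>
  The independent unimodular variables are uniform \<open>M\<close>-th roots of unity, so that every mean is a
  finite sum; \<open>M\<close> tends to infinity only at the end.
\<close>

definition unity_root :: "nat \<Rightarrow> nat \<Rightarrow> complex" where
  "unity_root M k = exp (2 * of_real pi * \<i> * of_nat k / of_nat M)"

lemma norm_unity_root [simp]: "norm (unity_root M k) = 1"
proof -
  have "2 * of_real pi * \<i> * of_nat k / of_nat M = \<i> * of_real (2 * pi * k / M)" by simp
  then show ?thesis unfolding unity_root_def by (simp only: norm_exp_i_times)
qed

lemma unity_root_power: "unity_root M k ^ d = unity_root M 1 ^ (k * d)"
  unfolding unity_root_def by (simp add: exp_of_nat_mult [symmetric] mult_ac)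

lemma unity_root_power_self: "M > 0 \<Longrightarrow> unity_root M k ^ M = 1"
  unfolding unity_root_def using complex_root_unity[of M k] by simp

lemma sum_unity_root_powers:
  assumes M: "M > 0"
  shows "(\<Sum>k<M. unity_root M k ^ d) = (if M dvd d then of_nat M else 0)"
proof -
  have eq: "unity_root M k ^ d = unity_root M d ^ k" for k
    by (metis unity_root_power mult.commute)
  show ?thesis
  proof (cases "M dvd d")
    case True
    then have "unity_root M d = 1"
      unfolding unity_root_def using M by (subst complex_root_unity_eq_1) auto
    then show ?thesis using True by (simp add: eq)
  next
    case False
    then have "unity_root M d \<noteq> 1"
      unfolding unity_root_def using M by (subst complex_root_unity_eq_1) auto
    then have "(\<Sum>k<M. unity_root M d ^ k) = (unity_root M d ^ M - 1) / (unity_root M d - 1)"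
      by (rule geometric_sum)
    then show ?thesis using False M by (simp add: eq unity_root_power_self)
  qed
qed

text \<open>The absolute difference: one of the two truncated subtractions vanishes.\<close>

definition exp_diff :: "nat \<Rightarrow> nat \<Rightarrow> nat" where
  "exp_diff a b = (a - b) + (b - a)"

text \<open>On the unit circle the product is \<open>z\<close> to the power \<open>a - b\<close>; a
  negative power is a conjugate, so all exponents stay natural numbers.\<close>

lemma unity_power_mult_cnj:
  assumes "norm z = 1"
  shows "z ^ a * cnj (z ^ b) = (if b \<le> a then z ^ exp_diff a b else cnj (z ^ exp_diff a b))"
proof -
  have c: "z * cnj z = 1" using assms by (simp add: complex_norm_square [symmetric])
  show ?thesis
  proof (cases "b \<le> a")
    case True
    then have "z ^ a * cnj (z ^ b) = z ^ (a - b) * (z * cnj z) ^ b"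
      by (simp add: power_mult_distrib flip: power_add mult.assoc)
    then show ?thesis using True by (simp add: c exp_diff_def)
  next
    case False
    then have "z ^ a * cnj (z ^ b) = (z * cnj z) ^ a * cnj (z ^ (b - a))"
      by (simp add: power_mult_distrib mult.assoc flip: power_add)
    then show ?thesis using False by (simp add: c exp_diff_def)
  qed
qed

text \<open>
  For \<open>0 \<le> d \<le> M\<close> this is the sum of \<open>r\<^bsup>|d + j M|\<^esup>\<close> over all integers \<open>j\<close>, the Fourier coefficient
  of the Poisson kernel on the \<open>M\<close>-th roots of unity.
\<close>

definition periodized_power :: "nat \<Rightarrow> real \<Rightarrow> nat \<Rightarrow> real" where
  "periodized_power M r d = (r ^ d + r ^ (M - d)) / (1 - r ^ M)"

definition poisson_weight :: "real \<Rightarrow> complex \<Rightarrow> real" where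
  "poisson_weight r z = (1 - r\<^sup>2) / (norm (1 - of_real r * z))\<^sup>2"

text \<open>The two-sided Fourier series is split into the frequencies \<open>>= 0\<close>
  (\<open>w\<close>) and \<open>< 0\<close> (\<open>w'\<close>). On \<open>M\<close>-th roots of
  unity each half folds to a finite geometric sum, and the division by \<open>q = 1 - r^M\<close>
  accounts for all shifts by \<open>M\<close>.\<close>

lemma poisson_weight_unity_root:
  assumes r: "0 < r" "r < 1" and M: "M > 0" and z: "z ^ M = 1" "norm z = 1"
  shows "of_real (poisson_weight r z) = (\<Sum>j<M. of_real (periodized_power M r j) * z ^ j)"
proof -
  have rM: "r ^ M < 1" using r M by (simp add: power_less_one_iff)
  define q where "q = (1 - of_real r ^ M :: complex)"
  define w where "w = (\<Sum>j<M. of_real r ^ j * z ^ j)"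
  define w' where "w' = (\<Sum>j<M. of_real r ^ (M - j) * z ^ j)"
  have nz: "1 - of_real r * z \<noteq> 0"
  proof
    assume "1 - of_real r * z = 0"
    then have "norm (of_real r * z) = 1" by simp
    then show False using r z by (simp add: norm_mult)
  qed
  have zc: "z * cnj z = 1" using z by (simp add: complex_norm_square [symmetric])
  have w1: "(1 - of_real r * z) * w = q"
    unfolding w_def q_def using one_diff_power_eq[of "of_real r * z" M] z
    by (simp add: power_mult_distrib)
  have "w' = of_real r * (\<Sum>j<M. of_real r ^ (M - Suc j) * z ^ j)"
    unfolding w'_def sum_distrib_left mult.assoc[symmetric]
    by (intro sum.cong refl) (simp add: Suc_diff_Suc flip: power_Suc)
  moreover have "q = (z - of_real r) * (\<Sum>j<M. of_real r ^ (M - Suc j) * z ^ j)"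
    using power_diff_sumr2[of z M "of_real r"] z by (simp add: q_def)
  ultimately have "(z - of_real r) * w' = of_real r * q" by (simp add: mult_ac)
  \<comment> \<open>Multiplication by \<open>cnj z = 1 / z\<close> turns the factor into
    \<open>1 - r * cnj z\<close>, the conjugate of the one belonging to \<open>w\<close>.\<close>
  then have "cnj z * ((z - of_real r) * w') = cnj z * (of_real r * q)" by simp
  then have w2: "(1 - of_real r * cnj z) * w' = of_real r * cnj z * q"
    using zc by (simp add: algebra_simps)
  have norm_eq: "of_real ((norm (1 - of_real r * z))\<^sup>2) = (1 - of_real r * z) * (1 - of_real r * cnj z)"
    by (subst complex_norm_square) simp
  have "of_real ((norm (1 - of_real r * z))\<^sup>2) * (w + w') =
      (1 - of_real r * cnj z) * ((1 - of_real r * z) * w) + (1 - of_real r * z) * ((1 - of_real r * cnj z) * w')"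
    unfolding norm_eq by (simp add: algebra_simps)
  also have "\<dots> = q * (1 - of_real r ^ 2 * (z * cnj z))"
    unfolding w1 w2 by (simp add: algebra_simps power2_eq_square)
  finally have eq: "of_real ((norm (1 - of_real r * z))\<^sup>2) * (w + w') = q * of_real (1 - r\<^sup>2)"
    by (simp add: zc)
  have q: "q = of_real (1 - r ^ M)" "q \<noteq> 0"
  proof -
    show "q = of_real (1 - r ^ M)" by (simp add: q_def)
    then show "q \<noteq> 0" using rM by (simp only: of_real_eq_0_iff)
  qed
  have "(\<Sum>j<M. of_real (periodized_power M r j) * z ^ j) = (w + w') / q"
    unfolding w_def w'_def q(1) sum.distrib[symmetric] sum_divide_distrib periodized_power_def
    by (intro sum.cong refl) (simp add: distrib_right)
  also have "\<dots> = of_real (1 - r\<^sup>2) / of_real ((norm (1 - of_real r * z))\<^sup>2)"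
    using eq q(2) nz by (simp add: field_simps)
  finally show ?thesis by (simp add: poisson_weight_def)
qed

lemma sum_poisson_weight:
  assumes r: "0 < r" "r < 1" and d: "a < M" "b < M"
  shows "(\<Sum>k<M. of_real (poisson_weight r (unity_root M k)) * (unity_root M k ^ a * cnj (unity_root M k ^ b))) =
    of_nat M * of_real (periodized_power M r (exp_diff a b))"
proof -
  have M: "M > 0" using d by simp
  define e where "e = exp_diff a b"
  have e: "e < M" using d by (auto simp: e_def exp_diff_def)
  have sum_e: "(\<Sum>k<M. of_real (poisson_weight r (unity_root M k)) * unity_root M k ^ e) =
      of_nat M * of_real (periodized_power M r e)"
  proof -
    have "(\<Sum>k<M. of_real (poisson_weight r (unity_root M k)) * unity_root M k ^ e) =
        (\<Sum>k<M. \<Sum>j<M. of_real (periodized_power M r j) * unity_root M k ^ (j + e))"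
      using M by (simp add: poisson_weight_unity_root[OF r M] unity_root_power_self sum_distrib_right power_add mult.assoc)
    also have "\<dots> = (\<Sum>j<M. of_real (periodized_power M r j) * (\<Sum>k<M. unity_root M k ^ (j + e)))"
      by (subst sum.swap) (simp add: sum_distrib_left)
    \<comment> \<open>Only the frequency congruent to \<open>- e\<close> survives; the outer
      \<open>mod M\<close> sends \<open>M\<close> to 0 when \<open>e = 0\<close>. The symmetry of
      \<open>periodized_power\<close> under exchange of \<open>d\<close> and \<open>M - d\<close>
      identifies its coefficient with that of \<open>e\<close>.\<close>
    also have "\<dots> = (\<Sum>j<M. if j = (M - e) mod M then of_nat M * of_real (periodized_power M r e) else 0)"
    proof (rule sum.cong[OF refl])
      fix j assume j: "j \<in> {..<M}"
      have dvd: "M dvd (j + e) \<longleftrightarrow> j = (M - e) mod M"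
      proof (cases "e = 0")
        case True
        then show ?thesis using j by (auto dest: dvd_imp_le)
      next
        case False
        have "j = M - e" if "M dvd (j + e)"
        proof -
          from that obtain c where c: "j + e = M * c" by (elim dvdE)
          have "c < 2"
          proof (rule ccontr)
            assume "\<not> c < 2"
            then have "M * 2 \<le> M * c" by (intro mult_le_mono2) simp
            then show False using j e unfolding c[symmetric] by simp
          qed
          moreover have "c \<noteq> 0" using c False by (intro notI) simp
          ultimately have "c = 1" by simp
          then show ?thesis using c by simp
        qed
        then show ?thesis using False e by auto
      qed
      have "periodized_power M r ((M - e) mod M) = periodized_power M r e"
        using e by (cases "e = 0") (auto simp: periodized_power_def)
      then show "of_real (periodized_power M r j) * (\<Sum>k<M. unity_root M k ^ (j + e)) =
        (if j = (M - e) mod M then of_nat M * of_real (periodized_power M r e) else 0 :: complex)"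
        unfolding sum_unity_root_powers[OF M] dvd by auto
    qed
    also have "\<dots> = of_nat M * of_real (periodized_power M r e)" using M by simp
    finally show ?thesis .
  qed
  show ?thesis
  proof (cases "b \<le> a")
    case True
    then show ?thesis unfolding unity_power_mult_cnj[OF norm_unity_root] using sum_e by (simp add: e_def)
  next
    case False
    have "(\<Sum>k<M. of_real (poisson_weight r (unity_root M k)) * cnj (unity_root M k ^ e)) =
      cnj (\<Sum>k<M. of_real (poisson_weight r (unity_root M k)) * unity_root M k ^ e)" by simp
    also have "\<dots> = of_nat M * of_real (periodized_power M r e)" unfolding sum_e by simp
    finally show ?thesis
      unfolding unity_power_mult_cnj[OF norm_unity_root] using False by (simp only: e_def if_False)
  qed
qed

lemma sum_unity_root_mult_cnj:
  assumes d: "a < M" "b < M"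
  shows "(\<Sum>k<M. unity_root M k ^ a * cnj (unity_root M k ^ b)) = (if a = b then of_nat M else 0)"
proof -
  have M: "M > 0" using d by simp
  define e where "e = exp_diff a b"
  have e: "M dvd e \<longleftrightarrow> a = b" using d by (auto simp: e_def exp_diff_def dest: dvd_imp_le)
  show ?thesis
  proof (cases "b \<le> a")
    case True
    then show ?thesis unfolding unity_power_mult_cnj[OF norm_unity_root]
      using sum_unity_root_powers[OF M, of e] e by (simp add: e_def)
  next
    case False
    have "(\<Sum>k<M. cnj (unity_root M k ^ e)) = cnj (\<Sum>k<M. unity_root M k ^ e)" by simp
    also have "\<dots> = (if a = b then of_nat M else 0)"
      unfolding sum_unity_root_powers[OF M] e by simp
    finally show ?thesis
      unfolding unity_power_mult_cnj[OF norm_unity_root] using False by (simp only: e_def if_False)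
  qed
qed

section \<open>Pointwise and exponential moment bounds\<close>

text \<open>The first bound, the value at \<open>z = - 1\<close>, serves the small primes. The
  second serves the large ones: it depends on \<open>z\<close> through an exponential, so products
  become sums. It follows from
  \<open>|1 - r z|^2 = 1 + (r^2 - 2 r Re z) <= exp (r^2 - 2 r Re z)\<close> and
  \<open>exp (- r^2) >= 1 - r^2\<close>.\<close>

lemma poisson_weight_bounds:
  assumes r: "0 < r" "r < 1" and z: "norm z = 1"
  shows "(1 - r) / (1 + r) \<le> poisson_weight r z"
    and "(1 - r\<^sup>2)\<^sup>2 * exp (2 * r * Re z) \<le> poisson_weight r z"
proof -
  define D where "D = (norm (1 - of_real r * z))\<^sup>2"
  have "norm (1 - of_real r * z) \<ge> norm (1::complex) - norm (of_real r * z)" by (rule norm_triangle_ineq2)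
  then have "norm (1 - of_real r * z) \<ge> 1 - r" using r z by (simp add: norm_mult)
  then have "norm (1 - of_real r * z) > 0" using r by linarith
  then have D0: "D > 0" by (simp add: D_def)
  have r2: "r\<^sup>2 < 1" using r by (simp add: power_less_one_iff)
  have "norm (1 - of_real r * z) \<le> norm (1::complex) + norm (of_real r * z)" by (rule norm_triangle_ineq4)
  then have "norm (1 - of_real r * z) \<le> 1 + r" using r z by (simp add: norm_mult)
  then have "D \<le> (1 + r)\<^sup>2" unfolding D_def by (intro power_mono) auto
  then have "(1 - r\<^sup>2) / (1 + r)\<^sup>2 \<le> (1 - r\<^sup>2) / D" using D0 r2 r by (intro divide_left_mono mult_pos_pos) auto
  moreover have "(1 - r\<^sup>2) / (1 + r)\<^sup>2 = (1 - r) / (1 + r)"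
  proof -
    have "1 - r\<^sup>2 = (1 - r) * (1 + r)" by (simp add: power2_eq_square algebra_simps)
    then show ?thesis using r by (simp add: power2_eq_square)
  qed
  ultimately show "(1 - r) / (1 + r) \<le> poisson_weight r z" by (simp add: poisson_weight_def D_def)
  have "D = (1 - r * Re z)\<^sup>2 + (r * Im z)\<^sup>2" unfolding D_def by (simp add: cmod_power2)
  also have "\<dots> = 1 - 2 * r * Re z + r\<^sup>2 * ((Re z)\<^sup>2 + (Im z)\<^sup>2)"
    by (simp add: power2_eq_square algebra_simps)
  also have "(Re z)\<^sup>2 + (Im z)\<^sup>2 = 1" using z by (simp add: cmod_power2 [symmetric])
  finally have "D = 1 + (r\<^sup>2 - 2 * r * Re z)" by simp
  also have "\<dots> \<le> exp (r\<^sup>2 - 2 * r * Re z)" by (rule exp_ge_add_one_self)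
  finally have "1 / exp (r\<^sup>2 - 2 * r * Re z) \<le> 1 / D" using D0 by (intro divide_left_mono) auto
  then have D_le: "exp (- r\<^sup>2) * exp (2 * r * Re z) \<le> 1 / D"
    by (simp add: exp_minus exp_diff exp_add divide_inverse mult_ac)
  have "(1 - r\<^sup>2)\<^sup>2 * exp (2 * r * Re z) = (1 - r\<^sup>2) * ((1 - r\<^sup>2) * exp (2 * r * Re z))"
    by (simp add: power2_eq_square)
  also have "\<dots> \<le> (1 - r\<^sup>2) * (exp (- r\<^sup>2) * exp (2 * r * Re z))"
    using r2 exp_ge_add_one_self[of "- r\<^sup>2"] by (intro mult_left_mono mult_right_mono) auto
  also have "\<dots> \<le> (1 - r\<^sup>2) * (1 / D)" using D_le r2 by (intro mult_left_mono) auto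
  finally show "(1 - r\<^sup>2)\<^sup>2 * exp (2 * r * Re z) \<le> poisson_weight r z"
    by (simp add: poisson_weight_def D_def)
qed

text \<open>For a centred random variable the linear term disappears on averaging, which leaves a
  subgaussian bound.\<close>

lemma exp_le_add_exp_square: "exp x \<le> x + exp (x\<^sup>2)" for x :: real
proof -
  have ge: "1 + x\<^sup>2 \<le> exp (x\<^sup>2)" by (rule exp_ge_add_one_self)
  consider "x \<le> 0" | "0 \<le> x" "x \<le> 1" | "1 \<le> x" by linarith
  then show ?thesis
  proof cases
    case 1
    have "exp x * (1 - x) \<le> exp x * exp (- x)"
      using exp_ge_add_one_self[of "- x"] by (intro mult_left_mono) auto
    also have "\<dots> = 1" by (simp flip: exp_add)
    also have "1 \<le> 1 - x * x\<^sup>2" using 1 by (simp add: mult_le_0_iff)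
    also have "\<dots> = (1 + x + x\<^sup>2) * (1 - x)" by (simp add: power2_eq_square algebra_simps)
    finally have "exp x \<le> 1 + x + x\<^sup>2" using 1 by (simp add: mult_le_cancel_right)
    then show ?thesis using ge by linarith
  next
    case 2
    then show ?thesis using exp_bound[of x] ge by linarith
  next
    case 3
    then have "x \<le> x\<^sup>2" by (simp add: power2_eq_square)
    then have "exp x \<le> exp (x\<^sup>2)" by simp
    then show ?thesis using 3 by linarith
  qed
qed

lemma sum_exp_Re_unity_root_le:
  assumes M: "M \<ge> 2"
  shows "(\<Sum>k<M. exp (c * Re (unity_root M k))) \<le> M * exp (c\<^sup>2)"
proof -
  have "(\<Sum>k<M. exp (c * Re (unity_root M k))) \<le> (\<Sum>k<M. c * Re (unity_root M k) + exp (c\<^sup>2))"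
  proof (rule sum_mono)
    fix k
    define x where "x = c * Re (unity_root M k)"
    have "\<bar>x\<bar> \<le> \<bar>c\<bar> * 1"
      unfolding x_def abs_mult using abs_Re_le_cmod[of "unity_root M k"] by (intro mult_left_mono) auto
    then have "x\<^sup>2 \<le> c\<^sup>2" by (simp add: abs_le_square_iff[symmetric])
    then show "exp x \<le> x + exp (c\<^sup>2)" using exp_le_add_exp_square[of x] by (smt (verit) exp_le_cancel_iff)
  qed
  also have "\<dots> = c * Re (\<Sum>k<M. unity_root M k ^ 1) + M * exp (c\<^sup>2)"
    by (simp add: sum.distrib sum_distrib_left)
  also have "(\<Sum>k<M. unity_root M k ^ 1) = 0"
    using M by (subst sum_unity_root_powers) auto
  finally show ?thesis by simp
qed

section \<open>The random model of the form\<close>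

text \<open>Expanding the square and using the independence of the coordinates of
  \<open>\<omega>\<close> factors each term over \<open>P\<close>. The weights are arbitrary because
  the identity is applied twice: with Poisson weights, which give the periodized form, and with
  weight 1, which gives the plain mean square.\<close>

lemma model_second_moment:
  fixes \<alpha> :: "nat \<Rightarrow> nat \<Rightarrow> nat" and s :: "nat \<Rightarrow> real" and w :: "nat \<Rightarrow> nat \<Rightarrow> real"
  assumes P: "finite P"
  shows "of_real (\<Sum>\<omega>\<in>P \<rightarrow>\<^sub>E {..<M}. (\<Prod>p\<in>P. w p (\<omega> p)) *
      (norm (\<Sum>i<n. of_real (s i) * (\<Prod>p\<in>P. unity_root M (\<omega> p) ^ \<alpha> i p)))\<^sup>2) =
    (\<Sum>i<n. \<Sum>j<n. of_real (s i * s j) *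
      (\<Prod>p\<in>P. \<Sum>k<M. of_real (w p k) * (unity_root M k ^ \<alpha> i p * cnj (unity_root M k ^ \<alpha> j p))))"
proof -
  define X where "X i \<omega> = (\<Prod>p\<in>P. unity_root M (\<omega> p) ^ \<alpha> i p)" for i \<omega>
  define W where "W \<omega> = (\<Prod>p\<in>P. w p (\<omega> p))" for \<omega>
  have "of_real (W \<omega> * (norm (\<Sum>i<n. of_real (s i) * X i \<omega>))\<^sup>2) =
      (\<Sum>i<n. \<Sum>j<n. of_real (s i * s j) * (of_real (W \<omega>) * (X i \<omega> * cnj (X j \<omega>))))" for \<omega>
  proof -
    have "of_real (W \<omega> * (norm (\<Sum>i<n. of_real (s i) * X i \<omega>))\<^sup>2) =
        of_real (W \<omega>) * ((\<Sum>i<n. of_real (s i) * X i \<omega>) * cnj (\<Sum>i<n. of_real (s i) * X i \<omega>))"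
      by (simp only: of_real_mult complex_norm_square)
    also have "\<dots> = (\<Sum>i<n. \<Sum>j<n. of_real (s i * s j) * (of_real (W \<omega>) * (X i \<omega> * cnj (X j \<omega>))))"
      by (simp only: cnj_sum sum_product) (simp add: sum_distrib_left mult_ac)
    finally show ?thesis .
  qed
  moreover have "of_real (W \<omega>) * (X i \<omega> * cnj (X j \<omega>)) =
     (\<Prod>p\<in>P. of_real (w p (\<omega> p)) * (unity_root M (\<omega> p) ^ \<alpha> i p * cnj (unity_root M (\<omega> p) ^ \<alpha> j p)))" for i j \<omega>
    by (simp add: W_def X_def prod.distrib)
  ultimately have "of_real (\<Sum>\<omega>\<in>P \<rightarrow>\<^sub>E {..<M}. W \<omega> * (norm (\<Sum>i<n. of_real (s i) * X i \<omega>))\<^sup>2) =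
     (\<Sum>\<omega>\<in>P \<rightarrow>\<^sub>E {..<M}. \<Sum>i<n. \<Sum>j<n. of_real (s i * s j) *
       (\<Prod>p\<in>P. of_real (w p (\<omega> p)) * (unity_root M (\<omega> p) ^ \<alpha> i p * cnj (unity_root M (\<omega> p) ^ \<alpha> j p))))"
    by (simp only: of_real_sum)
  also have "\<dots> = (\<Sum>i<n. \<Sum>j<n. of_real (s i * s j) * (\<Sum>\<omega>\<in>P \<rightarrow>\<^sub>E {..<M}.
       (\<Prod>p\<in>P. of_real (w p (\<omega> p)) * (unity_root M (\<omega> p) ^ \<alpha> i p * cnj (unity_root M (\<omega> p) ^ \<alpha> j p)))))"
    unfolding sum_distrib_left by (subst sum.swap, rule sum.cong[OF refl], rule sum.swap)
  also have "\<dots> = (\<Sum>i<n. \<Sum>j<n. of_real (s i * s j) *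
      (\<Prod>p\<in>P. \<Sum>k<M. of_real (w p k) * (unity_root M k ^ \<alpha> i p * cnj (unity_root M k ^ \<alpha> j p))))"
    using P by (subst prod_sum_PiE) auto
  finally show ?thesis unfolding W_def X_def .
qed

text \<open>At each prime the exponent is \<open>2 min k l - k - l = - |k - l|\<close>.
  \<open>P\<close> may contain further primes, so that one set serves all pairs of entries.\<close>

lemma gcd_square_quotient:
  fixes a b :: nat
  assumes P: "finite P" "\<And>p. p \<in> P \<Longrightarrow> prime p" and a: "a > 0" "prime_factors a \<subseteq> P" and b: "b > 0" "prime_factors b \<subseteq> P"
  shows "(real (gcd a b))\<^sup>2 / (a * b) = (\<Prod>p\<in>P. (1 / p) ^ exp_diff (multiplicity p a) (multiplicity p b))"
proof -
  have prod_eq: "real x = (\<Prod>p\<in>P. real p ^ multiplicity p x)" if "x > 0" "prime_factors x \<subseteq> P" for x :: nat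
  proof -
    have "x = (\<Prod>p\<in>prime_factors x. p ^ multiplicity p x)"
      using that by (intro prime_factorization_nat) auto
    also have "\<dots> = (\<Prod>p\<in>P. p ^ multiplicity p x)"
      using that P by (intro prod.mono_neutral_left) (auto simp: prime_factors_multiplicity)
    finally have "real x = real (\<Prod>p\<in>P. p ^ multiplicity p x)" by (rule arg_cong)
    then show ?thesis by simp
  qed
  have g: "gcd a b > 0" "prime_factors (gcd a b) \<subseteq> P"
    using a b by (auto simp: prime_factors_dvd)
  have "(real (gcd a b))\<^sup>2 / (a * b) = (\<Prod>p\<in>P. (real p ^ multiplicity p (gcd a b))\<^sup>2 / (real p ^ multiplicity p a * real p ^ multiplicity p b))"
    unfolding of_nat_mult prod_eq[OF g] prod_eq[OF a] prod_eq[OF b] prod_dividef prod.distrib prod_power_distrib ..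
  also have "\<dots> = (\<Prod>p\<in>P. (1 / p) ^ exp_diff (multiplicity p a) (multiplicity p b))"
  proof (rule prod.cong[OF refl])
    fix p assume "p \<in> P"
    have p: "real p > 0" using P(2)[OF \<open>p \<in> P\<close>] prime_gt_0_nat by auto
    define k l where "k = multiplicity p a" and "l = multiplicity p b"
    have m: "multiplicity p (gcd a b) = min k l"
      unfolding k_def l_def using a b P(2)[OF \<open>p \<in> P\<close>] by (intro multiplicity_gcd) auto
    have "2 * min k l + exp_diff k l = k + l" by (auto simp: exp_diff_def)
    then have "real p ^ (2 * min k l + exp_diff k l) = real p ^ (k + l)" by (rule arg_cong)
    then have "(real p ^ min k l)\<^sup>2 * real p ^ exp_diff k l = real p ^ k * real p ^ l"
      by (simp only: power_add power_even_eq)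
    then have "(real p ^ min k l)\<^sup>2 / (real p ^ k * real p ^ l) = (1 / p) ^ exp_diff k l"
      using p by (simp add: field_simps power_one_over)
    then show "(real p ^ multiplicity p (gcd a b))\<^sup>2 / (real p ^ multiplicity p a * real p ^ multiplicity p b) =
        (1 / p) ^ exp_diff (multiplicity p a) (multiplicity p b)"
      by (simp add: m k_def l_def)
  qed
  finally show ?thesis .
qed

lemma sum_inverse_squares_tail:
  assumes "y \<ge> 1"
  shows "(\<Sum>k\<in>{y<..m}. 1 / (real k)\<^sup>2) \<le> 1 / y"
proof -
  have "(\<Sum>k\<in>{y<..y+d}. 1 / (real k)\<^sup>2) \<le> 1 / y - 1 / real (y + d)" for d
  proof (induction d)
    case (Suc d)
    define x where "x = real (y + d)"
    have x: "x \<ge> 1" using assms by (simp add: x_def)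
    have "{y<..y + Suc d} = insert (y + Suc d) {y<..y+d}" by auto
    then have "(\<Sum>k\<in>{y<..y+Suc d}. 1 / (real k)\<^sup>2) = 1 / (x + 1)\<^sup>2 + (\<Sum>k\<in>{y<..y+d}. 1 / (real k)\<^sup>2)"
      by (simp add: x_def add_ac)
    also have "\<dots> \<le> 1 / (x + 1)\<^sup>2 + (1 / y - 1 / x)" using Suc unfolding x_def by simp
    also have "1 / (x + 1)\<^sup>2 \<le> 1 / (x * (x + 1))"
      using x by (intro divide_left_mono) (auto simp: power2_eq_square)
    also have "1 / (x * (x + 1)) = 1 / x - 1 / (x + 1)" using x by (simp add: field_simps)
    finally show ?case by (simp add: x_def add_ac)
  qed simp
  from this[of "m - y"] have "(\<Sum>k\<in>{y<..y + (m - y)}. 1 / (real k)\<^sup>2) \<le> 1 / y"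
    by (smt (verit) divide_nonneg_nonneg of_nat_0_le_iff)
  moreover have "{y<..m} \<subseteq> {y<..y + (m - y)}" by auto
  then have "(\<Sum>k\<in>{y<..m}. 1 / (real k)\<^sup>2) \<le> (\<Sum>k\<in>{y<..y + (m - y)}. 1 / (real k)\<^sup>2)"
    by (intro sum_mono2) auto
  ultimately show ?thesis by simp
qed

lemma gcd_form_bound_pos: "gcd_form_bound n > 0"
  unfolding gcd_form_bound_def
  by (intro prod_pos) (auto dest!: primes_upto_gt_1 intro!: divide_pos_pos add_pos_nonneg)

text \<open>Primes up to \<open>y\<close> receive the minimum of their kernel. The larger ones
  receive the exponential bound, whose constants \<open>(1 - 1/p^2)^2\<close> multiply to at least
  \<open>(1 - 1/y)^2\<close> by Weierstrass' product inequality and the tail of the inverse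
  squares.\<close>

lemma prod_poisson_weight_ge:
  fixes z :: "nat \<Rightarrow> complex"
  assumes y: "y \<ge> 1" "y \<le> B" and z: "\<And>p. p \<in> primes_upto B \<Longrightarrow> norm (z p) = 1"
  shows "gcd_form_bound y * (1 - 1 / y)\<^sup>2 * exp (2 * (\<Sum>p\<in>primes_upto B - primes_upto y. Re (z p) / p)) \<le>
    (\<Prod>p\<in>primes_upto B. poisson_weight (1 / p) (z p))"
proof -
  define L where "L = primes_upto B - primes_upto y"
  have split: "primes_upto B = primes_upto y \<union> L" "primes_upto y \<inter> L = {}" "finite L"
    using y by (auto simp: L_def primes_upto_def)
  have r: "0 < 1 / real p" "1 / real p < 1" if "p \<in> primes_upto B" for p
    using primes_upto_gt_1[OF that] by auto
  have small: "gcd_form_bound y \<le> (\<Prod>p\<in>primes_upto y. poisson_weight (1 / p) (z p))"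
    unfolding gcd_form_bound_def using r z split(1)
    by (intro prod_mono conjI poisson_weight_bounds) (auto intro!: divide_nonneg_nonneg add_nonneg_nonneg simp: less_imp_le)
  have sum_le: "(\<Sum>p\<in>L. (1 / real p)\<^sup>2) \<le> 1 / y"
  proof -
    have "(\<Sum>p\<in>L. (1 / real p)\<^sup>2) \<le> (\<Sum>p\<in>{y<..B}. (1 / real p)\<^sup>2)"
      by (intro sum_mono2) (auto simp: L_def primes_upto_def)
    also have "\<dots> = (\<Sum>p\<in>{y<..B}. 1 / (real p)\<^sup>2)" by (simp add: power_one_over)
    also have "\<dots> \<le> 1 / y" using y(1) by (rule sum_inverse_squares_tail)
    finally show ?thesis .
  qed
  have "1 - 1 / y \<le> 1 - (\<Sum>p\<in>L. (1 / real p)\<^sup>2)" using sum_le by simp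
  also have "\<dots> \<le> (\<Prod>p\<in>L. 1 - (1 / real p)\<^sup>2)"
  proof (rule Weierstrass_prod_ineq)
    fix p assume "p \<in> L"
    then have "0 < 1 / real p" "1 / real p < 1" using r[of p] split(1) by blast+
    then show "(1 / real p)\<^sup>2 \<in> {0..1}" using power_le_one[of "1 / real p" 2] by simp
  qed
  finally have "(1 - 1 / y)\<^sup>2 \<le> (\<Prod>p\<in>L. 1 - (1 / real p)\<^sup>2)\<^sup>2"
    using y by (intro power_mono) auto
  then have "(1 - 1 / y)\<^sup>2 * exp (2 * (\<Sum>p\<in>L. Re (z p) / p)) \<le>
     (\<Prod>p\<in>L. 1 - (1 / real p)\<^sup>2)\<^sup>2 * exp (2 * (\<Sum>p\<in>L. Re (z p) / p))"
    by (rule mult_right_mono) simp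
  also have "\<dots> = (\<Prod>p\<in>L. (1 - (1 / real p)\<^sup>2)\<^sup>2 * exp (2 * (1 / p) * Re (z p)))"
    using split(3) by (simp add: prod.distrib prod_power_distrib exp_sum sum_distrib_left)
  also have "\<dots> \<le> (\<Prod>p\<in>L. poisson_weight (1 / p) (z p))"
    using r z split(1) by (intro prod_mono conjI poisson_weight_bounds) auto
  finally have large: "(1 - 1 / y)\<^sup>2 * exp (2 * (\<Sum>p\<in>L. Re (z p) / p)) \<le> (\<Prod>p\<in>L. poisson_weight (1 / p) (z p))" .
  have "gcd_form_bound y * ((1 - 1 / y)\<^sup>2 * exp (2 * (\<Sum>p\<in>L. Re (z p) / p))) \<le>
     (\<Prod>p\<in>primes_upto y. poisson_weight (1 / p) (z p)) * (\<Prod>p\<in>L. poisson_weight (1 / p) (z p))"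
    using small large gcd_form_bound_pos[of y] by (intro mult_mono) auto
  also have "\<dots> = (\<Prod>p\<in>primes_upto B. poisson_weight (1 / p) (z p))"
    unfolding split(1) using split by (subst prod.union_disjoint) auto
  finally show ?thesis by (simp add: L_def mult.assoc)
qed

text \<open>Independence factors the exponential moment, each large prime contributes at most
  \<open>exp ((c/p)^2)\<close>, and the tail of the inverse squares sums the exponents to at most
  \<open>c^2 / y\<close>.\<close>

lemma sum_exp_large_primes_le:
  fixes B :: nat
  assumes y: "y \<ge> 1" and M: "M \<ge> 2"
  defines "L \<equiv> primes_upto B - primes_upto y"
  shows "(\<Sum>\<omega>\<in>primes_upto B \<rightarrow>\<^sub>E {..<M}. exp (c * (\<Sum>p\<in>L. Re (unity_root M (\<omega> p)) / p))) \<le>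
    real M ^ card (primes_upto B) * exp (c\<^sup>2 / y)"
proof -
  \<comment> \<open>Zero coefficients at the small primes let the product run over all of
    \<open>primes_upto B\<close>.\<close>
  define g where "g p = (if p \<in> L then c / real p else 0)" for p
  have L: "L \<subseteq> primes_upto B" "finite L" by (auto simp: L_def)
  have "(\<Sum>\<omega>\<in>primes_upto B \<rightarrow>\<^sub>E {..<M}. exp (c * (\<Sum>p\<in>L. Re (unity_root M (\<omega> p)) / p))) =
      (\<Sum>\<omega>\<in>primes_upto B \<rightarrow>\<^sub>E {..<M}. \<Prod>p\<in>primes_upto B. exp (g p * Re (unity_root M (\<omega> p))))"
  proof (rule sum.cong[OF refl])
    fix \<omega>
    have "c * (\<Sum>p\<in>L. Re (unity_root M (\<omega> p)) / p) = (\<Sum>p\<in>primes_upto B. g p * Re (unity_root M (\<omega> p)))"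
      unfolding sum_distrib_left using L by (intro sum.mono_neutral_cong_left) (auto simp: g_def)
    then show "exp (c * (\<Sum>p\<in>L. Re (unity_root M (\<omega> p)) / p)) = (\<Prod>p\<in>primes_upto B. exp (g p * Re (unity_root M (\<omega> p))))"
      by (simp add: exp_sum)
  qed
  also have "\<dots> = (\<Prod>p\<in>primes_upto B. \<Sum>k<M. exp (g p * Re (unity_root M k)))"
    by (subst prod_sum_PiE) auto
  also have "\<dots> \<le> (\<Prod>p\<in>primes_upto B. M * exp ((g p)\<^sup>2))"
    by (intro prod_mono conjI sum_exp_Re_unity_root_le M sum_nonneg) auto
  also have "\<dots> = real M ^ card (primes_upto B) * exp (\<Sum>p\<in>primes_upto B. (g p)\<^sup>2)"
    by (simp add: prod.distrib exp_sum)
  also have "(\<Sum>p\<in>primes_upto B. (g p)\<^sup>2) = c\<^sup>2 * (\<Sum>p\<in>L. 1 / (real p)\<^sup>2)"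
    unfolding sum_distrib_left using L by (intro sum.mono_neutral_cong_right) (auto simp: g_def power_divide)
  also have "(\<Sum>p\<in>L. 1 / (real p)\<^sup>2) \<le> (\<Sum>p\<in>{y<..B}. 1 / (real p)\<^sup>2)"
    by (intro sum_mono2) (auto simp: L_def primes_upto_def)
  also have "\<dots> \<le> 1 / y" using y by (rule sum_inverse_squares_tail)
  finally show ?thesis by (simp add: mult_left_mono)
qed


lemma periodized_power_tendsto:
  assumes "0 < r" "r < 1"
  shows "(\<lambda>M. periodized_power M r d) \<longlonglongrightarrow> r ^ d"
proof -
  have lim: "(\<lambda>M. r ^ M) \<longlonglongrightarrow> 0" using assms by (intro LIMSEQ_realpow_zero) auto
  have "(\<lambda>M. r ^ (M - d)) \<longlonglongrightarrow> 0"
    by (rule LIMSEQ_offset[where k=d]) (simp add: lim)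
  then have "(\<lambda>M. (r ^ d + r ^ (M - d)) / (1 - r ^ M)) \<longlonglongrightarrow> (r ^ d + 0) / (1 - 0)"
    by (intro tendsto_intros lim) auto
  then show ?thesis by (simp add: periodized_power_def)
qed

text \<open>The Poisson-weighted mean of \<open>F\<close> is compared with its plain mean. The
  weight is at least a constant times \<open>exp (2 S)\<close>, where \<open>S\<close> is the random
  sum over the large primes, hence at least \<open>?c\<close> unless \<open>S < - e\<close>. There
  the bound \<open>F <= n^2\<close> and the exponential moment of \<open>- S\<close> account for the
  subtracted \<open>?d\<close>.\<close>

lemma periodized_form_lower_bound:
  fixes \<alpha> :: "nat \<Rightarrow> nat \<Rightarrow> nat" and s :: "nat \<Rightarrow> real"
  assumes s: "\<And>i. i < n \<Longrightarrow> \<bar>s i\<bar> = 1"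
    and compat: "\<And>i j. i < n \<Longrightarrow> j < n \<Longrightarrow> (\<And>p. p \<in> primes_upto B \<Longrightarrow> \<alpha> i p = \<alpha> j p) \<Longrightarrow> s i = s j"
    and M: "M \<ge> 2" "\<And>i p. i < n \<Longrightarrow> p \<in> primes_upto B \<Longrightarrow> \<alpha> i p < M"
    and y: "y \<ge> 1" "y \<le> B" and e: "e > 0"
  shows "gcd_form_bound y * (1 - 1 / y)\<^sup>2 * exp (- 2 * e) * (n - (real n)\<^sup>2 * exp (- e\<^sup>2 * y / 4)) \<le>
    (\<Sum>i<n. \<Sum>j<n. s i * s j * (\<Prod>p\<in>primes_upto B. periodized_power M (1 / p) (exp_diff (\<alpha> i p) (\<alpha> j p))))"
    (is "?c * (real n - ?d) \<le> ?Q")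
proof -
  define P where "P = primes_upto B"
  define L where "L = primes_upto B - primes_upto y"
  define \<Omega> where "\<Omega> = (P \<rightarrow>\<^sub>E {..<M})"
  define F where "F \<omega> = (norm (\<Sum>i<n. of_real (s i) * (\<Prod>p\<in>P. unity_root M (\<omega> p) ^ \<alpha> i p)))\<^sup>2" for \<omega>
  define W where "W \<omega> = (\<Prod>p\<in>P. poisson_weight (1 / p) (unity_root M (\<omega> p)))" for \<omega>
  define S where "S \<omega> = (\<Sum>p\<in>L. Re (unity_root M (\<omega> p)) / p)" for \<omega>
  define V where "V = real M ^ card P"
  have V: "V > 0" using M by (simp add: V_def)
  have finP: "finite P" by (simp add: P_def)
  have moment: "of_real (\<Sum>\<omega>\<in>\<Omega>. W \<omega> * F \<omega>) = (of_real (V * ?Q) :: complex)"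
  proof -
    have "of_real (\<Sum>\<omega>\<in>\<Omega>. W \<omega> * F \<omega>) = (\<Sum>i<n. \<Sum>j<n. of_real (s i * s j) * (\<Prod>p\<in>P. \<Sum>k<M.
        of_real (poisson_weight (1 / p) (unity_root M k)) * (unity_root M k ^ \<alpha> i p * cnj (unity_root M k ^ \<alpha> j p))))"
      unfolding \<Omega>_def W_def F_def
      by (rule model_second_moment[OF finP, where w="\<lambda>p k. poisson_weight (1 / p) (unity_root M k)"])
    also have "\<dots> = (\<Sum>i<n. \<Sum>j<n. of_real (s i * s j) * (\<Prod>p\<in>P. of_nat M * of_real (periodized_power M (1 / p) (exp_diff (\<alpha> i p) (\<alpha> j p)))))"
    proof (intro sum.cong prod.cong refl arg_cong2[where f="(*)"])
      fix i j p assume *: "i \<in> {..<n}" "j \<in> {..<n}" "p \<in> P"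
      then have "p > 1" unfolding P_def by (auto dest: primes_upto_gt_1)
      then show "(\<Sum>k<M. of_real (poisson_weight (1 / p) (unity_root M k)) * (unity_root M k ^ \<alpha> i p * cnj (unity_root M k ^ \<alpha> j p))) =
        of_nat M * of_real (periodized_power M (1 / p) (exp_diff (\<alpha> i p) (\<alpha> j p)))"
        using * M(2) by (intro sum_poisson_weight) (auto simp: P_def)
    qed
    also have "\<dots> = of_real (V * ?Q)"
      by (simp add: V_def P_def prod.distrib sum_distrib_left mult_ac)
    finally show ?thesis .
  qed
  then have WF: "(\<Sum>\<omega>\<in>\<Omega>. W \<omega> * F \<omega>) = V * ?Q" by (simp only: of_real_eq_iff)
  have F_sum: "(\<Sum>\<omega>\<in>\<Omega>. F \<omega>) \<ge> V * n"
  proof -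
    define same where "same i j \<longleftrightarrow> (\<forall>p\<in>P. \<alpha> i p = \<alpha> j p)" for i j
    have "of_real (\<Sum>\<omega>\<in>\<Omega>. F \<omega>) = (\<Sum>i<n. \<Sum>j<n. of_real (s i * s j) * (\<Prod>p\<in>P. \<Sum>k<M.
        unity_root M k ^ \<alpha> i p * cnj (unity_root M k ^ \<alpha> j p)))"
      unfolding \<Omega>_def F_def
      using model_second_moment[OF finP, where w="\<lambda>p k. 1" and s=s and \<alpha>=\<alpha> and M=M and n=n] by simp
    also have "\<dots> = (\<Sum>i<n. \<Sum>j<n. of_real (s i * s j) * (\<Prod>p\<in>P. if \<alpha> i p = \<alpha> j p then of_nat M else 0))"
      using M(2) by (intro sum.cong prod.cong refl arg_cong2[where f="(*)"] sum_unity_root_mult_cnj) (auto simp: P_def)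
    also have "\<dots> = (\<Sum>i<n. \<Sum>j<n. of_real (s i * s j * (if same i j then V else 0)))"
    proof (intro sum.cong refl)
      fix i j
      have "(\<Prod>p\<in>P. if \<alpha> i p = \<alpha> j p then of_nat M else 0 :: complex) = of_real (if same i j then V else 0)"
        using finP by (auto simp: same_def V_def intro!: prod_zero)
      then show "of_real (s i * s j) * (\<Prod>p\<in>P. if \<alpha> i p = \<alpha> j p then of_nat M else 0 :: complex) =
         of_real (s i * s j * (if same i j then V else 0))" by (simp only: of_real_mult)
    qed
    also have "\<dots> = of_real (\<Sum>i<n. \<Sum>j<n. s i * s j * (if same i j then V else 0))" by simp
    finally have F_eq: "(\<Sum>\<omega>\<in>\<Omega>. F \<omega>) = (\<Sum>i<n. \<Sum>j<n. s i * s j * (if same i j then V else 0))"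
      by (simp only: of_real_eq_iff)
    \<comment> \<open>The diagonal alone gives \<open>V * n\<close>. Other pairs with the same
      monomial contribute \<open>+ V\<close>, because \<open>compat\<close> makes their signs agree,
      and all remaining pairs contribute 0.\<close>
    have "V * n = (\<Sum>i<n. \<Sum>j<n. if i = j then V else 0)" by (simp add: mult.commute)
    also have "\<dots> \<le> (\<Sum>i<n. \<Sum>j<n. s i * s j * (if same i j then V else 0))"
    proof (intro sum_mono)
      fix i j assume ij: "i \<in> {..<n}" "j \<in> {..<n}"
      show "(if i = j then V else 0) \<le> s i * s j * (if same i j then V else 0)"
      proof (cases "same i j")
        case True
        then have "s i = s j" using ij by (intro compat) (auto simp: same_def P_def)
        moreover have "s j * s j = 1" using s[of j] ij abs_mult_self_eq[of "s j"] by simp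
        ultimately show ?thesis using True V by simp
      next
        case False
        then show ?thesis by (auto simp: same_def)
      qed
    qed
    finally show ?thesis by (simp only: F_eq)
  qed
  have F_le: "F \<omega> \<le> (real n)\<^sup>2" for \<omega>
    unfolding F_def
  proof (rule power_mono)
    have "norm (\<Sum>i<n. of_real (s i) * (\<Prod>p\<in>P. unity_root M (\<omega> p) ^ \<alpha> i p)) \<le> (\<Sum>i<n. 1)"
      using s by (intro sum_norm_le) (simp add: norm_mult norm_power flip: prod_norm)
    then show "norm (\<Sum>i<n. of_real (s i) * (\<Prod>p\<in>P. unity_root M (\<omega> p) ^ \<alpha> i p)) \<le> n" by simp
  qed simp
  \<comment> \<open>This \<open>t\<close> minimises \<open>- t * e + t^2 / y\<close>, with minimum
    \<open>- e^2 * y / 4\<close>.\<close>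
  define t where "t = e * y / 2"
  have c: "?c \<ge> 0" using gcd_form_bound_pos[of y] by simp
  have pointwise: "?c * (F \<omega> - (real n)\<^sup>2 * exp (- t * e) * exp (- t * S \<omega>)) \<le> W \<omega> * F \<omega>" for \<omega>
  proof -
    have F0: "F \<omega> \<ge> 0" by (simp add: F_def)
    have W_ge: "gcd_form_bound y * (1 - 1 / y)\<^sup>2 * exp (2 * S \<omega>) \<le> W \<omega>"
      unfolding S_def L_def W_def P_def using y by (intro prod_poisson_weight_ge) auto
    \<comment> \<open>If \<open>S \<omega> < - e\<close> the left-hand side is nonpositive: this is Markov's inequality for \<open>exp (- t S)\<close>.\<close>
    have "exp (- 2 * e) * (F \<omega> - (real n)\<^sup>2 * exp (- t * e) * exp (- t * S \<omega>)) \<le> exp (2 * S \<omega>) * F \<omega>"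
    proof (cases "S \<omega> \<ge> - e")
      case True
      have "exp (- 2 * e) * (F \<omega> - (real n)\<^sup>2 * exp (- t * e) * exp (- t * S \<omega>)) \<le> exp (- 2 * e) * F \<omega>"
        by (intro mult_left_mono) auto
      also have "\<dots> \<le> exp (2 * S \<omega>) * F \<omega>" using True F0 by (intro mult_right_mono) auto
      finally show ?thesis .
    next
      case False
      have "t \<ge> 0" using e by (simp add: t_def)
      then have "0 \<le> - t * (S \<omega> + e)" using False by (intro mult_nonpos_nonpos) auto
      then have "1 \<le> exp (- t * (S \<omega> + e))" by simp
      also have "exp (- t * (S \<omega> + e)) = exp (- t * e) * exp (- t * S \<omega>)"
        by (simp add: algebra_simps flip: exp_add)
      finally have "(real n)\<^sup>2 * 1 \<le> (real n)\<^sup>2 * (exp (- t * e) * exp (- t * S \<omega>))"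
        by (intro mult_left_mono) auto
      then have "F \<omega> - (real n)\<^sup>2 * exp (- t * e) * exp (- t * S \<omega>) \<le> 0"
        using F_le[of \<omega>] by (simp add: mult.assoc)
      then have "exp (- 2 * e) * (F \<omega> - (real n)\<^sup>2 * exp (- t * e) * exp (- t * S \<omega>)) \<le> 0"
        by (intro mult_nonneg_nonpos) auto
      also have "\<dots> \<le> exp (2 * S \<omega>) * F \<omega>" using F0 by simp
      finally show ?thesis .
    qed
    then have "gcd_form_bound y * (1 - 1 / y)\<^sup>2 * (exp (- 2 * e) * (F \<omega> - (real n)\<^sup>2 * exp (- t * e) * exp (- t * S \<omega>))) \<le>
        gcd_form_bound y * (1 - 1 / y)\<^sup>2 * (exp (2 * S \<omega>) * F \<omega>)"
      using gcd_form_bound_pos[of y] by (intro mult_left_mono) auto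
    also have "\<dots> = gcd_form_bound y * (1 - 1 / y)\<^sup>2 * exp (2 * S \<omega>) * F \<omega>" by simp
    also have "\<dots> \<le> W \<omega> * F \<omega>" using W_ge F0 by (rule mult_right_mono)
    finally show ?thesis by (simp only: mult.assoc)
  qed
  have exp_sum: "(\<Sum>\<omega>\<in>\<Omega>. exp (- t * S \<omega>)) \<le> V * exp (t\<^sup>2 / y)"
    using sum_exp_large_primes_le[OF y(1) M(1), where B=B and c="- t"] by (simp add: \<Omega>_def P_def S_def L_def V_def)
  have Vd: "V * ?d = (real n)\<^sup>2 * exp (- t * e) * (V * exp (t\<^sup>2 / y))"
  proof -
    have "- t * e + t\<^sup>2 / y = - e\<^sup>2 * y / 4"
      using y by (simp add: t_def power2_eq_square field_simps)
    then have "exp (- t * e) * exp (t\<^sup>2 / y) = exp (- e\<^sup>2 * y / 4)" by (simp only: exp_add[symmetric])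
    then show ?thesis by (simp add: mult_ac)
  qed
  have "(real n)\<^sup>2 * exp (- t * e) * (\<Sum>\<omega>\<in>\<Omega>. exp (- t * S \<omega>)) \<le> V * ?d"
    unfolding Vd using exp_sum by (intro mult_left_mono) auto
  then have "V * (n - ?d) \<le> (\<Sum>\<omega>\<in>\<Omega>. F \<omega>) - (real n)\<^sup>2 * exp (- t * e) * (\<Sum>\<omega>\<in>\<Omega>. exp (- t * S \<omega>))"
    using F_sum by (simp add: right_diff_distrib)
  then have "?c * (V * (n - ?d)) \<le> ?c * ((\<Sum>\<omega>\<in>\<Omega>. F \<omega>) - (real n)\<^sup>2 * exp (- t * e) * (\<Sum>\<omega>\<in>\<Omega>. exp (- t * S \<omega>)))"
    using c by (rule mult_left_mono)
  also have "\<dots> = (\<Sum>\<omega>\<in>\<Omega>. ?c * (F \<omega> - (real n)\<^sup>2 * exp (- t * e) * exp (- t * S \<omega>)))"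
    by (simp only: sum_distrib_left sum_subtractf[symmetric])
  also have "\<dots> \<le> (\<Sum>\<omega>\<in>\<Omega>. W \<omega> * F \<omega>)" by (intro sum_mono pointwise)
  finally have "V * (?c * (n - ?d)) \<le> V * ?Q" unfolding WF by (simp only: mult.left_commute)
  then show ?thesis using V by simp
qed

text \<open>The bound for roots of unity does not involve \<open>M\<close>, so it survives the
  limit, in which the periodized powers become true powers and the form becomes
  \<open>12 * N as\<close>.\<close>

theorem N_lower_bound:
  assumes nz: "0 \<notin> set as" and nondeg: "\<not> degenerate as" and n: "length as = n" and y: "y \<ge> 1" and e: "e > 0"
  shows "gcd_form_bound y * (1 - 1 / y)\<^sup>2 * exp (- 2 * e) * (n - (real n)\<^sup>2 * exp (- e\<^sup>2 * y / 4)) \<le> 12 * N as"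
    (is "?lhs \<le> _")
proof -
  define b where "b i = nat \<bar>as ! i\<bar>" for i
  \<comment> \<open>One number that bounds \<open>y\<close>, all prime factors of the entries and
    all their exponents.\<close>
  define B where "B = y + (\<Sum>i<n. b i)"
  define \<alpha> where "\<alpha> i p = multiplicity p (b i)" for i p
  define s where "s i = real_of_int (sgn (as ! i))" for i
  have nz': "as ! i \<noteq> 0" if "i < n" for i using nz that n nth_mem by fastforce
  then have b: "b i > 0" "b i \<le> B" if "i < n" for i
    using that member_le_sum[of i "{..<n}" b] by (auto simp: b_def B_def)
  have fac: "prime_factors (b i) \<subseteq> primes_upto B" if "i < n" for i
    using b[OF that] by (auto simp: primes_upto_def prime_factors_dvd dest!: dvd_imp_le)
  have small: "\<alpha> i p \<le> B" if "i < n" "p \<in> primes_upto B" for i p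
  proof -
    have "\<alpha> i p < p ^ \<alpha> i p" using primes_upto_gt_1[OF that(2)] by (intro power_gt_expt) simp
    also have "\<dots> \<le> b i" using b[OF that(1)] unfolding \<alpha>_def by (intro dvd_imp_le multiplicity_dvd) auto
    finally show ?thesis using b[OF that(1)] by simp
  qed
  have s1: "\<bar>s i\<bar> = 1" if "i < n" for i using nz'[OF that] by (simp add: s_def sgn_if)
  have compat: "s i = s j" if ij: "i < n" "j < n" and eq: "\<And>p. p \<in> primes_upto B \<Longrightarrow> \<alpha> i p = \<alpha> j p" for i j
  proof -
    have "multiplicity p (b i) = multiplicity p (b j)" if p: "prime p" for p
    proof (cases "p \<in> primes_upto B")
      case False
      then have "p \<notin> prime_factors (b i)" "p \<notin> prime_factors (b j)" using fac ij by blast+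
      then show ?thesis using p b ij by (simp add: prime_factors_multiplicity)
    qed (use eq in \<open>auto simp: \<alpha>_def\<close>)
    then have "b i = b j" by (rule multiplicity_eq_nat[OF b(1)[OF ij(1)] b(1)[OF ij(2)]])
    then have "int (b i) = int (b j)" by (rule arg_cong)
    then have "\<bar>as ! i\<bar> = \<bar>as ! j\<bar>" unfolding b_def by (simp only: int_nat_eq abs_ge_zero if_True)
    then have "as ! i = as ! j \<or> as ! i = - as ! j" by (simp only: abs_eq_iff)
    \<comment> \<open>Non-degeneracy enters here: equal exponent vectors force equal signs.\<close>
    moreover have "as ! i \<noteq> - as ! j"
      using nondeg nth_mem ij n unfolding degenerate_def by metis
    ultimately show ?thesis by (simp add: s_def)
  qed
  have kernel: "s i * s j * (\<Prod>p\<in>primes_upto B. (1 / real p) ^ exp_diff (\<alpha> i p) (\<alpha> j p)) =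
      (real_of_int (gcd (as ! i) (as ! j)))\<^sup>2 / (as ! i * as ! j)" if ij: "i < n" "j < n" for i j
  proof -
    have "(\<Prod>p\<in>primes_upto B. (1 / real p) ^ exp_diff (\<alpha> i p) (\<alpha> j p)) = (real (gcd (b i) (b j)))\<^sup>2 / (b i * b j)"
      unfolding \<alpha>_def using b fac ij
      by (intro gcd_square_quotient [symmetric]) (auto simp: primes_upto_def)
    also have "real (gcd (b i) (b j)) = real_of_int (gcd (as ! i) (as ! j))"
      by (simp only: b_def gcd_int_def of_int_of_nat_eq)
    finally show ?thesis using nz'[OF ij(1)] nz'[OF ij(2)]
      by (cases "as ! i > 0"; cases "as ! j > 0") (auto simp: s_def b_def sgn_if)
  qed
  define Q where "Q M = (\<Sum>i<n. \<Sum>j<n. s i * s j * (\<Prod>p\<in>primes_upto B. periodized_power M (1 / p) (exp_diff (\<alpha> i p) (\<alpha> j p))))" for M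
  have "Q \<longlonglongrightarrow> (\<Sum>i<n. \<Sum>j<n. s i * s j * (\<Prod>p\<in>primes_upto B. (1 / real p) ^ exp_diff (\<alpha> i p) (\<alpha> j p)))"
    unfolding Q_def by (intro tendsto_intros periodized_power_tendsto) (auto dest: primes_upto_gt_1)
  also have "(\<Sum>i<n. \<Sum>j<n. s i * s j * (\<Prod>p\<in>primes_upto B. (1 / real p) ^ exp_diff (\<alpha> i p) (\<alpha> j p))) = 12 * N as"
    unfolding N_eq_gcd_sum[OF nz] n by (simp add: kernel)
  finally have "Q \<longlonglongrightarrow> 12 * N as" .
  moreover have "?lhs \<le> Q M" if "M \<ge> B + 2" for M
    unfolding Q_def
  proof (rule periodized_form_lower_bound)
    show "\<alpha> i p < M" if "i < n" "p \<in> primes_upto B" for i p using small[OF that] \<open>M \<ge> B + 2\<close> by simp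
    show "s i = s j" if "i < n" "j < n" "\<And>p. p \<in> primes_upto B \<Longrightarrow> \<alpha> i p = \<alpha> j p" for i j
      using that by (rule compat)
    show "\<bar>s i\<bar> = 1" if "i < n" for i using that by (rule s1)
    show "M \<ge> 2" "y \<le> B" using \<open>M \<ge> B + 2\<close> by (simp_all add: B_def)
  qed (rule y e)+
  ultimately show ?thesis by (intro LIMSEQ_le_const) auto
qed

section \<open>The upper bound\<close>

text \<open>For non-zero \<open>a\<close> and \<open>b\<close> this is 12 times the integral of
  \<open>psi (a x) psi (b x)\<close>.\<close>

definition gcd_kernel :: "int \<Rightarrow> int \<Rightarrow> real" where
  "gcd_kernel a b = (real_of_int (gcd a b))\<^sup>2 / (real_of_int a * real_of_int b)"

lemma N_eq_sum_list:
  assumes "0 \<notin> set as"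
  shows "12 * N as = (\<Sum>a\<leftarrow>as. \<Sum>b\<leftarrow>as. gcd_kernel a b)"
  unfolding N_eq_gcd_sum[OF assms]
  by (simp add: sum_list_sum_nth atLeast0LessThan gcd_kernel_def)

lemma abs_sum_list_le:
  fixes f :: "'a \<Rightarrow> real" and c :: real
  shows "(\<And>x. x \<in> set xs \<Longrightarrow> \<bar>f x\<bar> \<le> c) \<Longrightarrow> \<bar>\<Sum>x\<leftarrow>xs. f x\<bar> \<le> length xs * c"
proof (induction xs)
  case (Cons x xs)
  then have "\<bar>f x\<bar> \<le> c" "\<bar>\<Sum>x\<leftarrow>xs. f x\<bar> \<le> length xs * c" by auto
  then show ?case by (simp add: distrib_right)
qed simp

lemma double_sum_list_le:
  fixes f :: "'a \<Rightarrow> 'b \<Rightarrow> real" and c :: real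
  assumes "\<And>x y. x \<in> set xs \<Longrightarrow> y \<in> set ys \<Longrightarrow> \<bar>f x y\<bar> \<le> c"
  shows "(\<Sum>x\<leftarrow>xs. \<Sum>y\<leftarrow>ys. f x y) \<le> length xs * (length ys * c)"
proof -
  have "\<bar>\<Sum>x\<leftarrow>xs. \<Sum>y\<leftarrow>ys. f x y\<bar> \<le> length xs * (length ys * c)"
    using assms by (intro abs_sum_list_le)
  then show ?thesis by linarith
qed

text \<open>The kernel does not change when both arguments are multiplied by \<open>k\<close>, and
  \<open>gcd x (k y) <= |x|\<close> bounds a cross term by \<open>|x| / (k |y|) <= B / k\<close>.
  The two cross blocks give the factor 2.\<close>

lemma N_append_dilate:
  assumes a: "0 \<notin> set as" and b: "0 \<notin> set bs" and k: "k > 0"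
    and bound: "\<And>x. x \<in> set as \<Longrightarrow> \<bar>x\<bar> \<le> B"
  shows "12 * N (as @ map ((*) k) bs) \<le> 12 * N as + 12 * N bs + 2 * (length as * length bs * (real_of_int B / real_of_int k))"
proof -
  define cs where "cs = map ((*) k) bs"
  have c: "0 \<notin> set cs" using b k by (auto simp: cs_def)
  have cross: "\<bar>gcd_kernel x z\<bar> \<le> real_of_int B / k" "\<bar>gcd_kernel z x\<bar> \<le> real_of_int B / k"
    if x: "x \<in> set as" and z: "z \<in> set cs" for x z
  proof -
    obtain y where y: "y \<in> set bs" "z = k * y" using z by (auto simp: cs_def)
    have x0: "x \<noteq> 0" and y0: "y \<noteq> 0" using x y a b by auto
    define g where "g = gcd x z"
    have "g \<le> \<bar>x\<bar>" using x0 dvd_imp_le_int[of x g] by (simp add: g_def)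
    moreover have "g \<ge> 0" by (simp add: g_def)
    ultimately have "(real_of_int g)\<^sup>2 \<le> (real_of_int \<bar>x\<bar>)\<^sup>2" by (intro power_mono) auto
    then have "(real_of_int g)\<^sup>2 / (\<bar>real_of_int x\<bar> * \<bar>real_of_int z\<bar>) \<le> (real_of_int \<bar>x\<bar>)\<^sup>2 / (\<bar>real_of_int x\<bar> * \<bar>real_of_int z\<bar>)"
      by (intro divide_right_mono) auto
    also have "\<dots> = \<bar>real_of_int x\<bar> / (k * \<bar>real_of_int y\<bar>)"
      using x0 y0 k by (simp add: y(2) power2_eq_square abs_mult del: abs_mult_self_eq power2_abs)
    also have "\<dots> \<le> \<bar>real_of_int x\<bar> / (real_of_int k * 1)"
    proof -
      have "real_of_int 1 \<le> real_of_int \<bar>y\<bar>" using y0 by (intro of_int_le_iff[THEN iffD2]) simp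
      then show ?thesis using k by (intro divide_left_mono mult_left_mono mult_pos_pos) auto
    qed
    also have "\<dots> \<le> real_of_int B / k"
      using bound[OF x] k by (simp add: divide_right_mono flip: of_int_abs)
    finally have *: "(real_of_int g)\<^sup>2 / (\<bar>real_of_int x\<bar> * \<bar>real_of_int z\<bar>) \<le> real_of_int B / k" .
    from * show "\<bar>gcd_kernel x z\<bar> \<le> real_of_int B / k" by (simp add: gcd_kernel_def g_def abs_mult)
    from * show "\<bar>gcd_kernel z x\<bar> \<le> real_of_int B / k"
      by (simp add: gcd_kernel_def g_def abs_mult gcd.commute mult.commute)
  qed
  have "12 * N (as @ cs) = (\<Sum>x\<leftarrow>as. \<Sum>y\<leftarrow>as. gcd_kernel x y) + (\<Sum>x\<leftarrow>as. \<Sum>y\<leftarrow>cs. gcd_kernel x y) +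
      ((\<Sum>x\<leftarrow>cs. \<Sum>y\<leftarrow>as. gcd_kernel x y) + (\<Sum>x\<leftarrow>cs. \<Sum>y\<leftarrow>cs. gcd_kernel x y))"
    using a c by (subst N_eq_sum_list) (auto simp: sum_list_addf)
  also have "(\<Sum>x\<leftarrow>cs. \<Sum>y\<leftarrow>cs. gcd_kernel x y) = (\<Sum>x\<leftarrow>bs. \<Sum>y\<leftarrow>bs. gcd_kernel x y)"
  proof -
    have "gcd_kernel (k * x) (k * y) = gcd_kernel x y" for x y
    proof -
      have "gcd (k * x) (k * y) = k * gcd x y" using k by (simp add: gcd_mult_distrib_int[symmetric])
      then show ?thesis using k by (simp add: gcd_kernel_def power2_eq_square)
    qed
    then show ?thesis by (simp add: cs_def o_def)
  qed
  also have "(\<Sum>x\<leftarrow>as. \<Sum>y\<leftarrow>cs. gcd_kernel x y) \<le> length as * (length cs * (real_of_int B / k))"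
    by (intro double_sum_list_le cross)
  also have "(\<Sum>x\<leftarrow>cs. \<Sum>y\<leftarrow>as. gcd_kernel x y) \<le> length cs * (length as * (real_of_int B / k))"
    by (intro double_sum_list_le cross)
  finally show ?thesis
    unfolding N_eq_sum_list[OF a, symmetric] N_eq_sum_list[OF b, symmetric] cs_def by (simp add: algebra_simps)
qed

section \<open>Subadditivity of \<open>G\<close>\<close>

definition admissible :: "nat \<Rightarrow> int list set" where
  "admissible n = {as. length as = n \<and> 0 \<notin> set as \<and> \<not> degenerate as}"

lemma G_eq: "G n = (INF as\<in>admissible n. N as)"
  by (simp add: G_def admissible_def)

lemma N_nonneg: "N as \<ge> 0"
  unfolding N_def
  by (cases "(\<lambda>x. (list_fun as x)\<^sup>2) integrable_on {0..1}")
     (auto intro: Henstock_Kurzweil_Integration.integral_nonneg simp: not_integrable_integral)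

lemma admissible_nonempty: "admissible n \<noteq> {}"
proof -
  have "replicate n 1 \<in> admissible n" by (auto simp: admissible_def degenerate_def)
  then show ?thesis by blast
qed

lemma G_le: "as \<in> admissible n \<Longrightarrow> G n \<le> N as"
  unfolding G_eq by (rule cINF_lower[OF bdd_belowI2[of _ 0]]) (auto simp: N_nonneg)

lemma G_greatest: "(\<And>as. as \<in> admissible n \<Longrightarrow> c \<le> N as) \<Longrightarrow> c \<le> G n"
  unfolding G_eq by (rule cINF_greatest[OF admissible_nonempty])

text \<open>Appending a dilate of the second list to the first adds their values up to a cross term
  that vanishes as the dilation grows; the two infima are then taken one after the other.\<close>

lemma G_add_le: "G (m + n) \<le> G m + G n"
proof -
  have *: "G (m + n) \<le> N as + N bs" if as: "as \<in> admissible m" and bs: "bs \<in> admissible n" for as bs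
  proof -
    define B where "B = Max (insert 0 (abs ` set as))"
    have B: "\<bar>x\<bar> \<le> B" if "x \<in> set as" for x using that by (auto simp: B_def)
    have B0: "B \<ge> 0" by (simp add: B_def)
    have bound: "12 * G (m + n) \<le> 12 * N as + 12 * N bs + 2 * (real m * real n * (B / (B + 1 + real k)))" for k :: nat
    proof -
      \<comment> \<open>\<open>K > B\<close> excludes opposite entries across the two lists, since
        \<open>- x = K * y\<close> would give \<open>|x| >= K\<close>.\<close>
      define K where "K = B + 1 + int k"
      have K: "K > 0" "K > B" using B0 by (simp_all add: K_def)
      have "as @ map ((*) K) bs \<in> admissible (m + n)"
      proof -
        have False if "x \<in> set as" "- x = K * y" "y \<noteq> 0" for x y
        proof -
          have "K * 1 \<le> K * \<bar>y\<bar>" using K that by (intro mult_left_mono) auto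
          also have "\<dots> = \<bar>x\<bar>" using K that by (metis abs_minus_cancel abs_mult abs_of_pos)
          finally show False using B[OF that(1)] K by simp
        qed
        then show ?thesis using as bs K
          unfolding admissible_def degenerate_def
          by (auto simp: mult_eq_0_iff) (metis mult_minus_right mult_left_cancel less_irrefl minus_minus)+
      qed
      from G_le[OF this] have "12 * G (m + n) \<le> 12 * N (as @ map ((*) K) bs)" by simp
      also have "\<dots> \<le> 12 * N as + 12 * N bs + 2 * (length as * length bs * (real_of_int B / real_of_int K))"
        using as bs K B by (intro N_append_dilate) (auto simp: admissible_def)
      finally show ?thesis using as bs by (simp add: K_def admissible_def)
    qed
    have "(\<lambda>k. 12 * N as + 12 * N bs + 2 * (real m * real n * (B / (B + 1 + real k)))) \<longlonglongrightarrow>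
       12 * N as + 12 * N bs + 2 * (real m * real n * 0)"
      by (intro tendsto_intros) real_asymp
    from LIMSEQ_le_const[OF this] bound show ?thesis by force
  qed
  have "G (m + n) - N as \<le> G n" if "as \<in> admissible m" for as
    using *[OF that] by (intro G_greatest) (simp add: algebra_simps)
  then have "G (m + n) - G n \<le> G m" by (intro G_greatest) (simp add: algebra_simps)
  then show ?thesis by simp
qed

lemma G_0: "G 0 \<le> 0" and G_1: "G 1 \<le> 1 / 12"
proof -
  have "[] \<in> admissible 0" "[1] \<in> admissible 1" by (auto simp: admissible_def degenerate_def)
  from this[THEN G_le] show "G 0 \<le> 0" "G 1 \<le> 1 / 12"
    using N_eq_sum_list[of "[]"] N_eq_sum_list[of "[1]"] by (simp_all add: gcd_kernel_def)
qed

lemma G_mult_add_le: "G (q * m + r) \<le> q * G m + r / 12"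
proof (induction q)
  case 0
  show ?case
  proof (induction r)
    case (Suc r)
    then show ?case using G_add_le[of r 1] G_1 by simp
  qed (simp add: G_0)
next
  case (Suc q)
  then show ?case using G_add_le[of m "q * m + r"] by (simp add: algebra_simps)
qed

section \<open>The Liouville block\<close>

text \<open>Quadratic form of the all-ones vector for the Toeplitz kernel \<open>x^|a-b|\<close>.
  Enlarging the square adds a row and a column, equal by symmetry, and a diagonal entry 1. Taken at
  \<open>x = - r\<close> it includes the Liouville signs.\<close>

lemma alternating_sum_closed_form:
  fixes x :: real
  shows "(1 - x)\<^sup>2 * (\<Sum>a\<le>A. \<Sum>b\<le>A. x ^ exp_diff a b) = (real A + 1) * (1 - x\<^sup>2) - 2 * x * (1 - x ^ (A + 1))"
proof (induction A)
  case (Suc A)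
  have row: "(1 - x) * (\<Sum>a\<le>A. x ^ (Suc A - a)) = x * (1 - x ^ (A + 1))" for A
  proof -
    have "(\<Sum>a\<le>A. x ^ (Suc A - a)) = (\<Sum>a\<le>A. x ^ Suc a)"
      by (rule sum.reindex_bij_witness[of _ "\<lambda>a. A - a" "\<lambda>a. A - a"]) (auto simp: Suc_diff_le)
    also have "(1 - x) * \<dots> = x * ((1 - x) * (\<Sum>a\<le>A. x ^ a))" by (simp add: sum_distrib_left mult_ac)
    also have "(1 - x) * (\<Sum>a\<le>A. x ^ a) = 1 - x ^ Suc A" by (rule sum_gp_basic)
    finally show ?thesis by simp
  qed
  have "(\<Sum>a\<le>Suc A. \<Sum>b\<le>Suc A. x ^ exp_diff a b) =
     (\<Sum>a\<le>A. \<Sum>b\<le>A. x ^ exp_diff a b) + 2 * (\<Sum>a\<le>A. x ^ (Suc A - a)) + 1"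
    by (simp add: sum.distrib exp_diff_def)
  then have "(1 - x)\<^sup>2 * (\<Sum>a\<le>Suc A. \<Sum>b\<le>Suc A. x ^ exp_diff a b) =
     (1 - x)\<^sup>2 * (\<Sum>a\<le>A. \<Sum>b\<le>A. x ^ exp_diff a b) + 2 * (1 - x) * ((1 - x) * (\<Sum>a\<le>A. x ^ (Suc A - a))) + (1 - x)\<^sup>2"
    by (simp add: power2_eq_square algebra_simps)
  also have "\<dots> = (real A + 1) * (1 - x\<^sup>2) - 2 * x * (1 - x ^ (A + 1)) + 2 * (1 - x) * (x * (1 - x ^ (A + 1))) + (1 - x)\<^sup>2"
    by (simp only: Suc.IH row)
  also have "\<dots> = (real (Suc A) + 1) * (1 - x\<^sup>2) - 2 * x * (1 - x ^ (Suc A + 1))"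
    by (simp add: power2_eq_square algebra_simps)
  finally show ?case .
qed (simp add: exp_diff_def power2_eq_square algebra_simps)

lemma minus_one_power_exp_diff: "(-1) ^ (a + b) * r ^ exp_diff a b = (- r) ^ exp_diff a b" for r :: real
proof -
  have "even (a + b) \<longleftrightarrow> even (exp_diff a b)" by (auto simp: exp_diff_def)
  then show ?thesis by (simp add: power_minus[of r] minus_one_power_iff)
qed

text \<open>Nonnegativity permits the upper bounds for the individual primes to be
  multiplied.\<close>

lemma alternating_sum_nonneg:
  fixes r :: real
  assumes r: "0 < r" "r < 1"
  shows "0 \<le> (\<Sum>a\<le>A. \<Sum>b\<le>A. (-1) ^ (a + b) * r ^ exp_diff a b)"
proof -
  have "(1 + r)\<^sup>2 * (\<Sum>a\<le>A. \<Sum>b\<le>A. (- r) ^ exp_diff a b) = (real A + 1) * (1 - r\<^sup>2) + 2 * r * (1 - (- r) ^ (A + 1))"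
    using alternating_sum_closed_form[of "- r" A] by simp
  also have "\<dots> \<ge> 0"
  proof -
    have "\<bar>(- r) ^ (A + 1)\<bar> \<le> 1" unfolding power_abs using r by (intro power_le_one) auto
    then have "1 - (- r) ^ (A + 1) \<ge> 0" by linarith
    then show ?thesis using r by (intro add_nonneg_nonneg mult_nonneg_nonneg) (auto simp: power_le_one)
  qed
  finally show ?thesis using r by (simp add: minus_one_power_exp_diff zero_le_mult_iff)
qed

text \<open>The main term is \<open>A + 1\<close> times the minimum of the Poisson kernel. The
  boundary adds at most 2, which is at most 6 times that minimum, since the latter is at least 1/3
  for \<open>r <= 1/2\<close>. An exponential error factor is convenient in the product over
  primes.\<close>

lemma alternating_sum_upper_bound:
  fixes r :: real
  assumes r: "0 < r" "r \<le> 1 / 2"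
  shows "(\<Sum>a\<le>A. \<Sum>b\<le>A. (-1) ^ (a + b) * r ^ exp_diff a b) \<le> (A + 1) * ((1 - r) / (1 + r)) * exp (6 / (A + 1))"
    (is "?T \<le> _")
proof -
  define l where "l = (1 - r) / (1 + r)"
  have l: "1 / 3 \<le> l" using r by (simp add: l_def field_simps)
  have "(1 + r)\<^sup>2 * ?T = (A + 1) * (1 - r\<^sup>2) + 2 * r * (1 - (- r) ^ (A + 1))"
    using alternating_sum_closed_form[of "- r" A] by (simp add: minus_one_power_exp_diff)
  also have "\<dots> \<le> (A + 1) * (1 - r\<^sup>2) + 2 * r * (1 + r)"
  proof -
    have "\<bar>(- r) ^ (A + 1)\<bar> = r * r ^ A" using r by (simp add: power_abs abs_mult)
    also have "\<dots> \<le> r * 1" using r by (intro mult_left_mono power_le_one) auto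
    finally have "1 - (- r) ^ (A + 1) \<le> 1 + r" by linarith
    then show ?thesis using r by (intro add_left_mono mult_left_mono) auto
  qed
  also have "\<dots> \<le> (1 + r)\<^sup>2 * ((A + 1) * l + 2)"
  proof -
    have "(1 + r)\<^sup>2 * ((A + 1) * l) = (A + 1) * (1 - r\<^sup>2)"
      using r by (simp add: l_def power2_eq_square field_simps)
    moreover have "2 * r * (1 + r) \<le> 2 * (1 + r) * (1 + r)" using r by (intro mult_right_mono) auto
    ultimately show ?thesis by (simp add: power2_eq_square algebra_simps)
  qed
  finally have "?T \<le> (A + 1) * l + 2" using r by simp
  also have "\<dots> \<le> (A + 1) * l + 6 * l" using l by simp
  also have "\<dots> = (A + 1) * l * (1 + 6 / (A + 1))" by (simp add: field_simps)
  also have "\<dots> \<le> (A + 1) * l * exp (6 / (A + 1))"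
    using l exp_ge_add_one_self[of "6 / (A + 1)"] by (intro mult_left_mono) auto
  finally show ?thesis by (simp add: l_def add.commute)
qed


text \<open>\<open>v g\<close> is the integer with exponent vector \<open>g\<close> and \<open>l g\<close> is its Liouville sign.\<close>

lemma G_block_le:
  assumes y: "y \<ge> 1"
  defines "m \<equiv> (y\<^sup>2) ^ card (primes_upto y)"
  shows "12 * G m \<le> m * (gcd_form_bound y * exp (6 / y))"
proof -
  define P where "P = primes_upto y"
  \<comment> \<open>There are at most \<open>y\<close> primes, each with an error factor
    \<open>exp (6 / (A + 1))\<close>; with \<open>A + 1 = y^2\<close> they multiply to at most
    \<open>exp (6 / y)\<close>.\<close>
  define A where "A = y\<^sup>2 - 1"
  have A: "A + 1 = y\<^sup>2" using y by (simp add: A_def)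
  then have rA: "real A + 1 = (real y)\<^sup>2" by (metis of_nat_1 of_nat_add of_nat_power)
  define I where "I = (P \<rightarrow>\<^sub>E {..A})"
  have P: "finite P" "\<And>p. p \<in> P \<Longrightarrow> prime p" by (auto simp: P_def primes_upto_def)
  have finI: "finite I" unfolding I_def using P by (intro finite_PiE) auto
  have cardI: "card I = m" using P(1) A by (simp add: I_def m_def P_def card_PiE)
  define v where "v g = (\<Prod>p\<in>P. p ^ g p)" for g :: "nat \<Rightarrow> nat"
  define l where "l g = (\<Prod>p\<in>P. (-1) ^ g p :: int)" for g :: "nat \<Rightarrow> nat"
  define a where "a g = l g * int (v g)" for g
  have inj_v: "inj_on v I" unfolding v_def I_def using P by (rule inj_on_prime_power_prod)
  have v_pos: "v g > 0" for g unfolding v_def using P(2) by (intro prod_pos) (auto dest: prime_gt_0_nat)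
  have abs_l: "\<bar>l g\<bar> = 1" for g by (simp add: l_def abs_prod power_abs)
  have abs_a: "\<bar>a g\<bar> = int (v g)" for g by (simp add: a_def abs_mult abs_l)
  have l_eq: "l g = 1 \<or> l g = -1" for g using abs_l[of g] by linarith
  obtain gs where gs: "set gs = I" "distinct gs" using finite_distinct_list[OF finI] by blast
  define as where "as = map a gs"
  have nz: "0 \<notin> set as" using abs_a v_pos by (auto simp: as_def) (metis abs_zero less_irrefl of_nat_eq_0_iff)
  have "\<not> degenerate as"
  proof
    assume "degenerate as"
    then obtain g h where gh: "g \<in> I" "h \<in> I" "a h = - a g"
      using gs by (auto simp: degenerate_def as_def)
    \<comment> \<open>Opposite entries have equal absolute value, so unique factorization gives
      \<open>g = h\<close>, and then \<open>a g = - a g\<close> is 0.\<close>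
    then have "v g = v h" using abs_a[of g] abs_a[of h] by simp
    then have "g = h" using inj_v gh by (auto dest: inj_onD)
    then have "a g = 0" using gh by simp
    then show False using abs_a[of g] v_pos[of g] by simp
  qed
  then have "as \<in> admissible m"
    using nz gs distinct_card[of gs] cardI by (auto simp: admissible_def as_def)
  then have "12 * G m \<le> 12 * N as" by (simp add: G_le)
  also have "\<dots> = (\<Sum>g\<in>I. \<Sum>h\<in>I. gcd_kernel (a g) (a h))"
    unfolding N_eq_sum_list[OF nz] using gs by (simp add: as_def o_def sum_list_distinct_conv_sum_set)
  also have "\<dots> = (\<Sum>g\<in>I. \<Sum>h\<in>I. \<Prod>p\<in>P. (-1) ^ (g p + h p) * (1 / p) ^ exp_diff (g p) (h p))"
  proof (intro sum.cong refl)
    fix g h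
    have mult: "multiplicity p (v g) = g p" if "p \<in> P" for p g
      using P that unfolding v_def by (subst multiplicity_prod_prime_powers) auto
    have fac: "prime_factors (v g) \<subseteq> P" for g
      using P v_pos[of g] unfolding v_def
      by (auto simp: prime_factors_multiplicity multiplicity_prod_prime_powers split: if_splits)
    have "gcd (a g) (a h) = int (gcd (v g) (v h))"
      using gcd_abs1_int[of "a g" "a h"] gcd_abs2_int[of "\<bar>a g\<bar>" "a h"] by (simp add: abs_a)
    moreover have "real_of_int (a g) * real_of_int (a h) = real_of_int (l g * l h) * (real (v g) * real (v h))"
      by (simp add: a_def)
    moreover have "l g * l h = 1 \<or> l g * l h = -1" using l_eq[of g] l_eq[of h] by auto
    ultimately have "gcd_kernel (a g) (a h) = real_of_int (l g * l h) * ((real (gcd (v g) (v h)))\<^sup>2 / (real (v g) * real (v h)))"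
      unfolding gcd_kernel_def by (elim disjE) (simp_all only:, simp_all)
    also have "(real (gcd (v g) (v h)))\<^sup>2 / (real (v g) * real (v h)) = (\<Prod>p\<in>P. (1 / p) ^ exp_diff (g p) (h p))"
    proof -
      have "(\<Prod>p\<in>P. (1 / real p) ^ exp_diff (multiplicity p (v g)) (multiplicity p (v h))) =
          (\<Prod>p\<in>P. (1 / p) ^ exp_diff (g p) (h p))"
        by (rule prod.cong) (simp_all add: mult)
      then show ?thesis
        using gcd_square_quotient[OF P v_pos[of g] fac[of g] v_pos[of h] fac[of h]] by simp
    qed
    also have "real_of_int (l g * l h) * \<dots> = (\<Prod>p\<in>P. (-1) ^ (g p + h p) * (1 / p) ^ exp_diff (g p) (h p))"
      by (simp add: l_def prod.distrib power_add)
    finally show "gcd_kernel (a g) (a h) = (\<Prod>p\<in>P. (-1) ^ (g p + h p) * (1 / p) ^ exp_diff (g p) (h p))" .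
  qed
  \<comment> \<open>The exponents range over a full box, so the sum of products is a product of
    sums, one for each prime.\<close>
  also have "\<dots> = (\<Prod>p\<in>P. \<Sum>i\<le>A. \<Sum>j\<le>A. (-1) ^ (i + j) * (1 / p) ^ exp_diff i j)"
    unfolding I_def using P(1) by (simp add: prod_sum_PiE)
  also have "\<dots> \<le> (\<Prod>p\<in>P. (real A + 1) * ((1 - 1 / p) / (1 + 1 / p)) * exp (6 / (real A + 1)))"
  proof (rule prod_mono, rule conjI)
    fix p assume "p \<in> P"
    then have p: "real p \<ge> 2" using P(2) prime_ge_2_nat of_nat_le_iff[of 2 p, where 'a=real] by simp
    show "(\<Sum>i\<le>A. \<Sum>j\<le>A. (-1) ^ (i + j) * (1 / p) ^ exp_diff i j) \<le> (real A + 1) * ((1 - 1 / p) / (1 + 1 / p)) * exp (6 / (real A + 1))"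
      using alternating_sum_upper_bound[of "1 / p" A] p by (simp add: field_simps)
    show "0 \<le> (\<Sum>i\<le>A. \<Sum>j\<le>A. (-1) ^ (i + j) * (1 / p) ^ exp_diff i j)"
      using alternating_sum_nonneg[of "1 / p" A] p by simp
  qed
  also have "\<dots> = (real A + 1) ^ card P * (gcd_form_bound y * exp (6 / (real A + 1)) ^ card P)"
    unfolding gcd_form_bound_def P_def[symmetric] by (simp only: prod.distrib prod_constant mult.assoc)
  also have "(real A + 1) ^ card P = m"
    using rA by (simp add: m_def P_def)
  also have "exp (6 / (real A + 1)) ^ card P \<le> exp (6 / y)"
  proof -
    have "exp (6 / (real A + 1)) ^ card P = exp (card P * (6 / (real A + 1)))" by (simp only: exp_of_nat_mult)
    also have "card P * (6 / (real A + 1)) \<le> y * (6 / (real A + 1))"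
      unfolding P_def using card_primes_upto_le[of y] by (intro mult_right_mono) auto
    also have "y * (6 / (real A + 1)) = 6 / y" using y unfolding rA by (simp add: power2_eq_square)
    finally show ?thesis by simp
  qed
  finally show ?thesis using gcd_form_bound_pos[of y] by (simp add: mult_left_mono)
qed

text \<open>Dividing \<open>n\<close> by the block length \<open>m\<close> leaves fewer than
  \<open>m <= y^(2y)\<close> entries, each of which costs at most 1 in
  \<open>12 * G n\<close>.\<close>

lemma G_upper_bound:
  assumes y: "y \<ge> 1"
  shows "12 * G n \<le> n * (gcd_form_bound y * exp (6 / y)) + real y ^ (2 * y)"
proof -
  define m where "m = (y\<^sup>2) ^ card (primes_upto y)"
  define c where "c = gcd_form_bound y * exp (6 / y)"
  have c: "c > 0" using gcd_form_bound_pos[of y] by (simp add: c_def)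
  have m: "m > 0" using y by (simp add: m_def)
  have "12 * G n = 12 * G (n div m * m + n mod m)" by simp
  also have "\<dots> \<le> 12 * (real (n div m) * G m + real (n mod m) / 12)"
    using G_mult_add_le[of "n div m" m "n mod m"] by simp
  also have "\<dots> = real (n div m) * (12 * G m) + real (n mod m)" by simp
  also have "\<dots> \<le> real (n div m) * (m * c) + real m"
  proof (intro add_mono mult_left_mono)
    show "12 * G m \<le> m * c" using G_block_le[OF y, folded m_def c_def] .
    show "real (n mod m) \<le> real m" using m by (simp only: of_nat_le_iff mod_le_divisor)
  qed simp
  also have "real (n div m) * (m * c) = real (n div m * m) * c" by simp
  also have "\<dots> \<le> n * c" using c by (intro mult_right_mono) (auto simp only: of_nat_le_iff div_times_less_eq_dividend)
  also have "real m \<le> real y ^ (2 * y)"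
  proof -
    have "m \<le> (y\<^sup>2) ^ y" unfolding m_def using y by (intro power_increasing card_primes_upto_le) auto
    then have "m \<le> y ^ (2 * y)" by (simp only: power_mult)
    then have "real m \<le> real (y ^ (2 * y))" by (simp only: of_nat_le_iff)
    then show ?thesis by simp
  qed
  finally show ?thesis by (simp add: c_def)
qed

lemma G_lower_bound:
  assumes "y \<ge> 1" "e > 0"
  shows "gcd_form_bound y * (1 - 1 / y)\<^sup>2 * exp (- 2 * e) * (n - (real n)\<^sup>2 * exp (- e\<^sup>2 * y / 4)) \<le> 12 * G n"
proof -
  have "gcd_form_bound y * (1 - 1 / y)\<^sup>2 * exp (- 2 * e) * (n - (real n)\<^sup>2 * exp (- e\<^sup>2 * y / 4)) / 12 \<le> G n"
  proof (rule G_greatest)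
    fix as assume "as \<in> admissible n"
    then have "0 \<notin> set as" "\<not> degenerate as" "length as = n" by (auto simp: admissible_def)
    from N_lower_bound[OF this assms]
    show "gcd_form_bound y * (1 - 1 / y)\<^sup>2 * exp (- 2 * e) * (n - (real n)\<^sup>2 * exp (- e\<^sup>2 * y / 4)) / 12 \<le> N as"
      by (subst pos_divide_le_eq) (simp, simp only: mult.commute)
  qed
  then show ?thesis by simp
qed

section \<open>Choice of the cutoffs\<close>

text \<open>Cutoffs are rounded to integers, but only their logarithm matters, and it is squeezed
  between those of \<open>X - 1\<close> and \<open>X + 1\<close>.\<close>

lemma ln_ratio_tendsto:
  fixes X L :: "nat \<Rightarrow> real" and y :: "nat \<Rightarrow> nat"
  assumes X: "filterlim X at_top sequentially"
    and y: "\<And>n. n \<ge> n0 \<Longrightarrow> \<bar>real (y n) - X n\<bar> \<le> 1"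
    and lo: "(\<lambda>n. ln (X n - 1) / L n) \<longlonglongrightarrow> 1" and hi: "(\<lambda>n. ln (X n + 1) / L n) \<longlonglongrightarrow> 1"
    and L: "\<And>n. n \<ge> n0 \<Longrightarrow> L n > 0"
  shows "(\<lambda>n. L n / ln (y n)) \<longlonglongrightarrow> 1" "filterlim y at_top sequentially"
proof -
  have ev: "\<forall>\<^sub>F n in sequentially. n \<ge> n0 \<and> X n > 2"
    using X by (intro eventually_conj eventually_ge_at_top) (simp add: filterlim_at_top_dense)
  have "(\<lambda>n. ln (y n) / L n) \<longlonglongrightarrow> 1"
  proof (rule tendsto_sandwich[OF _ _ lo hi])
    show "\<forall>\<^sub>F n in sequentially. ln (X n - 1) / L n \<le> ln (y n) / L n"
      using ev
    proof eventually_elim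
      case (elim n)
      then have "X n - 1 \<le> real (y n)" using y[of n] by linarith
      then show ?case using elim L[of n] by (intro divide_right_mono) auto
    qed
    show "\<forall>\<^sub>F n in sequentially. ln (y n) / L n \<le> ln (X n + 1) / L n"
      using ev
    proof eventually_elim
      case (elim n)
      then have "real (y n) \<le> X n + 1" "real (y n) > 0" using y[of n] by linarith+
      then show ?case using elim L[of n] by (intro divide_right_mono) auto
    qed
  qed
  from tendsto_inverse[OF this] show "(\<lambda>n. L n / ln (y n)) \<longlonglongrightarrow> 1" by (simp add: inverse_eq_divide)
  have "filterlim (\<lambda>n. X n - 1) at_top sequentially"
    using filterlim_tendsto_add_at_top[OF tendsto_const[of "-1"] X] by simp
  then have "filterlim (\<lambda>n. real (y n)) at_top sequentially"
    by (rule filterlim_at_top_mono) (use ev y in \<open>force elim: eventually_mono\<close>)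
  then show "filterlim y at_top sequentially" by (simp add: filterlim_sequentially_iff_filterlim_real)
qed

text \<open>The factor 4 gives \<open>y^(2y) = exp (2 y ln y) <= exp (ln n / 2)\<close>, so the
  leftover entries cost at most about the square root of \<open>n\<close>, while \<open>ln y\<close>
  is still asymptotic to \<open>ln (ln n)\<close>.\<close>

lemma small_cutoff:
  defines "y \<equiv> (\<lambda>n. nat \<lfloor>ln (real n) / (4 * ln (ln (real n)))\<rfloor>)"
  shows "(\<lambda>n. ln (ln (real n)) / ln (y n)) \<longlonglongrightarrow> 1" "filterlim y at_top sequentially"
    "(\<lambda>n. real (y n) ^ (2 * y n) * (ln (ln (real n)))\<^sup>2 / real n) \<longlonglongrightarrow> 0"
proof -
  have "\<forall>\<^sub>F n in sequentially. ln (ln (real n)) > 1 \<and> ln (real n) / (4 * ln (ln (real n))) > 2"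
    by (intro eventually_conj; real_asymp)
  then obtain n0 where n0: "\<And>n. n \<ge> n0 \<Longrightarrow> ln (ln (real n)) > 1 \<and> ln (real n) / (4 * ln (ln (real n))) > 2"
    unfolding eventually_sequentially by blast
  have y_bounds: "real (y n) \<le> ln (real n) / (4 * ln (ln (real n)))" "ln (real n) / (4 * ln (ln (real n))) - 1 \<le> real (y n)" "y n \<ge> 1"
    if "n \<ge> n0" for n
    using n0[OF that] unfolding y_def by linarith+
  show *: "(\<lambda>n. ln (ln (real n)) / ln (y n)) \<longlonglongrightarrow> 1" "filterlim y at_top sequentially"
  proof -
    have 1: "filterlim (\<lambda>n. ln (real n) / (4 * ln (ln (real n)))) at_top sequentially" by real_asymp
    have 2: "\<bar>real (y n) - ln (real n) / (4 * ln (ln (real n)))\<bar> \<le> 1" if "n \<ge> n0" for n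
      using y_bounds[OF that] by linarith
    have 3: "(\<lambda>n. ln (ln (real n) / (4 * ln (ln (real n))) - 1) / ln (ln (real n))) \<longlonglongrightarrow> 1"
            "(\<lambda>n. ln (ln (real n) / (4 * ln (ln (real n))) + 1) / ln (ln (real n))) \<longlonglongrightarrow> 1" by real_asymp+
    have 4: "ln (ln (real n)) > 0" if "n \<ge> n0" for n using n0[OF that] by simp
    show "(\<lambda>n. ln (ln (real n)) / ln (y n)) \<longlonglongrightarrow> 1" "filterlim y at_top sequentially"
      using ln_ratio_tendsto[OF 1 2 3 4] by blast+
  qed
  show "(\<lambda>n. real (y n) ^ (2 * y n) * (ln (ln (real n)))\<^sup>2 / real n) \<longlonglongrightarrow> 0"
  proof (rule Lim_null_comparison)
    show "(\<lambda>n. exp (ln (real n) / 2) * (ln (ln (real n)))\<^sup>2 / real n) \<longlonglongrightarrow> 0" by real_asymp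
    show "\<forall>\<^sub>F n in sequentially. norm (real (y n) ^ (2 * y n) * (ln (ln (real n)))\<^sup>2 / real n) \<le>
        exp (ln (real n) / 2) * (ln (ln (real n)))\<^sup>2 / real n"
    proof (rule eventually_sequentiallyI[of n0])
      fix n assume n: "n \<ge> n0"
      define L where "L = ln (ln (real n))"
      have L: "L > 1" "ln (real n) > 0"
      proof -
        show "L > 1" using n0[OF n] by (simp add: L_def)
        then have "ln (real n) / (4 * L) > 2 \<Longrightarrow> ln (real n) > 0" by (simp add: zero_less_divide_iff field_simps)
        then show "ln (real n) > 0" using n0[OF n] by (simp add: L_def)
      qed
      have y1: "real (y n) \<ge> 1" using y_bounds(3)[OF n] by simp
      have "real (y n) \<le> ln (real n) / (4 * L)" using y_bounds(1)[OF n] by (simp add: L_def)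
      also have "\<dots> \<le> ln (real n) / 1" using L by (intro divide_left_mono) auto
      finally have "ln (real (y n)) \<le> L" unfolding L_def using y1 L by simp
      then have "2 * y n * ln (real (y n)) \<le> 2 * (ln (real n) / (4 * L)) * L"
        using y_bounds(1)[OF n] y1 L by (intro mult_mono) (auto simp: L_def)
      also have "\<dots> = ln (real n) / 2" using L by simp
      finally have "exp (2 * y n * ln (real (y n))) \<le> exp (ln (real n) / 2)" by simp
      moreover have "real (y n) ^ (2 * y n) = exp (2 * y n * ln (real (y n)))"
        using y1 exp_of_nat_mult[of "2 * y n" "ln (real (y n))"] by simp
      ultimately have "real (y n) ^ (2 * y n) \<le> exp (ln (real n) / 2)" by simp
      then show "norm (real (y n) ^ (2 * y n) * (ln (ln (real n)))\<^sup>2 / real n) \<le>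
        exp (ln (real n) / 2) * (ln (ln (real n)))\<^sup>2 / real n"
        by (simp add: divide_right_mono mult_right_mono)
    qed
  qed
qed

text \<open>With \<open>L = ln (ln n)\<close>, the choice \<open>e = sqrt (8 / L)\<close> tends to
  0, and \<open>y >= L * ln n\<close> makes \<open>e^2 * y / 4 >= 2 * ln n\<close>, so the
  exceptional term is at most a fraction \<open>1/n\<close> of the main one. The \<open>+ 1\<close>
  secures \<open>y >= L * ln n\<close> as well as \<open>y >= 1\<close>.\<close>

lemma large_cutoff:
  defines "y \<equiv> (\<lambda>n. nat \<lfloor>ln (real n) * ln (ln (real n))\<rfloor> + 1)"
  shows "(\<lambda>n. ln (ln (real n)) / ln (y n)) \<longlonglongrightarrow> 1" "filterlim y at_top sequentially"
    "\<forall>\<^sub>F n in sequentially. real n * exp (- (sqrt (8 / ln (ln (real n))))\<^sup>2 * y n / 4) \<le> 1 / n"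
proof -
  have "\<forall>\<^sub>F n in sequentially. ln (ln (real n)) > 1 \<and> ln (real n) * ln (ln (real n)) > 2"
    by (intro eventually_conj; real_asymp)
  then obtain n0 where n0: "\<And>n. n \<ge> n0 \<Longrightarrow> ln (ln (real n)) > 1 \<and> ln (real n) * ln (ln (real n)) > 2"
    unfolding eventually_sequentially by blast
  have y_bounds: "real (y n) \<le> ln (real n) * ln (ln (real n)) + 1" "ln (real n) * ln (ln (real n)) \<le> real (y n)"
    if "n \<ge> n0" for n
    using n0[OF that] unfolding y_def by linarith+
  have 1: "filterlim (\<lambda>n. ln (real n) * ln (ln (real n))) at_top sequentially" by real_asymp
  have 2: "\<bar>real (y n) - ln (real n) * ln (ln (real n))\<bar> \<le> 1" if "n \<ge> n0" for n
    using y_bounds[OF that] by linarith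
  have 3: "(\<lambda>n. ln (ln (real n) * ln (ln (real n)) - 1) / ln (ln (real n))) \<longlonglongrightarrow> 1"
          "(\<lambda>n. ln (ln (real n) * ln (ln (real n)) + 1) / ln (ln (real n))) \<longlonglongrightarrow> 1" by real_asymp+
  have 4: "ln (ln (real n)) > 0" if "n \<ge> n0" for n using n0[OF that] by simp
  show "(\<lambda>n. ln (ln (real n)) / ln (y n)) \<longlonglongrightarrow> 1" "filterlim y at_top sequentially"
    using ln_ratio_tendsto[OF 1 2 3 4] by blast+
  show "\<forall>\<^sub>F n in sequentially. real n * exp (- (sqrt (8 / ln (ln (real n))))\<^sup>2 * y n / 4) \<le> 1 / n"
    using eventually_ge_at_top[of n0] eventually_gt_at_top[of 0]
  proof eventually_elim
    case (elim n)
    define L where "L = ln (ln (real n))"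
    have L: "L > 1" using n0[OF elim(1)] by (simp add: L_def)
    have "2 * ln (real n) = 8 / L * (ln (real n) * L) / 4" using L by simp
    also have "\<dots> \<le> 8 / L * y n / 4"
      using y_bounds(2)[OF elim(1)] L by (intro divide_right_mono mult_left_mono) (auto simp: L_def)
    also have "8 / L = (sqrt (8 / L))\<^sup>2" using L by simp
    finally have "exp (- (sqrt (8 / L))\<^sup>2 * y n / 4) \<le> exp (- (2 * ln (real n)))" by simp
    also have "\<dots> = 1 / (real n)\<^sup>2"
      using elim by (simp add: exp_minus exp_double inverse_eq_divide)
    finally have "real n * exp (- (sqrt (8 / L))\<^sup>2 * y n / 4) \<le> real n * (1 / (real n)\<^sup>2)"
      by (intro mult_left_mono) auto
    then show ?case using elim by (simp add: L_def power2_eq_square)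
  qed
qed

lemma gcd_form_bound_cutoff:
  fixes y :: "nat \<Rightarrow> nat" and L :: "nat \<Rightarrow> real"
  assumes ratio: "(\<lambda>n. L n / ln (y n)) \<longlonglongrightarrow> 1" and y: "filterlim y at_top sequentially"
  shows "(\<lambda>n. gcd_form_bound (y n) * (L n)\<^sup>2) \<longlonglongrightarrow> pi\<^sup>2 / 6 * exp (- 2 * euler_mascheroni)"
proof -
  have "(\<lambda>n. gcd_form_bound (y n) * (ln (y n))\<^sup>2 * (L n / ln (y n))\<^sup>2) \<longlonglongrightarrow>
      pi\<^sup>2 / 6 * exp (- 2 * euler_mascheroni) * 1\<^sup>2"
    by (intro tendsto_mult tendsto_power ratio filterlim_compose[OF gcd_form_bound_asymp y])
  moreover have "\<forall>\<^sub>F n in sequentially. gcd_form_bound (y n) * (ln (y n))\<^sup>2 * (L n / ln (y n))\<^sup>2 = gcd_form_bound (y n) * (L n)\<^sup>2"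
  proof -
    have "\<forall>\<^sub>F n in sequentially. y n \<ge> 2" using y by (simp add: filterlim_at_top)
    then show ?thesis by eventually_elim (simp add: power_divide)
  qed
  ultimately show ?thesis by (simp add: Lim_transform_eventually)
qed

lemma G_limit:
  "(\<lambda>n. 12 * G n * (ln (ln (real n)))\<^sup>2 / n) \<longlonglongrightarrow> pi\<^sup>2 / 6 * exp (- 2 * euler_mascheroni)"
proof -
  define L where "L n = ln (ln (real n))" for n :: nat
  define \<kappa> :: real where "\<kappa> = pi\<^sup>2 / 6 * exp (- 2 * euler_mascheroni)"
  define y1 where "y1 n = nat \<lfloor>ln (real n) / (4 * ln (ln (real n)))\<rfloor>" for n :: nat
  define y2 where "y2 n = nat \<lfloor>ln (real n) * ln (ln (real n))\<rfloor> + 1" for n :: nat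
  note y1 = small_cutoff[folded y1_def L_def]
  note y2 = large_cutoff[folded y2_def L_def]
  have inv: "(\<lambda>n. c / real (y n)) \<longlonglongrightarrow> 0" if "filterlim y at_top sequentially" for c and y :: "nat \<Rightarrow> nat"
    by (rule tendsto_divide_0[OF tendsto_const filterlim_at_top_imp_at_infinity[OF filterlim_compose[OF filterlim_real_sequentially that]]])
  have upper_lim: "(\<lambda>n. gcd_form_bound (y1 n) * (L n)\<^sup>2 * exp (6 / y1 n) + real (y1 n) ^ (2 * y1 n) * (L n)\<^sup>2 / n) \<longlonglongrightarrow> \<kappa>"
  proof -
    have "(\<lambda>n. gcd_form_bound (y1 n) * (L n)\<^sup>2 * exp (6 / y1 n) + real (y1 n) ^ (2 * y1 n) * (L n)\<^sup>2 / n) \<longlonglongrightarrow> \<kappa> * exp 0 + 0"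
      unfolding \<kappa>_def by (intro tendsto_add tendsto_mult tendsto_exp gcd_form_bound_cutoff inv y1)
    then show ?thesis by simp
  qed
  have lower_lim: "(\<lambda>n. gcd_form_bound (y2 n) * (L n)\<^sup>2 * (1 - 1 / y2 n)\<^sup>2 * exp (- 2 * sqrt (8 / L n)) * (1 - 1 / n)) \<longlonglongrightarrow> \<kappa>"
  proof -
    have "(\<lambda>n. exp (- 2 * sqrt (8 / L n)) * (1 - 1 / n)) \<longlonglongrightarrow> 1" unfolding L_def by real_asymp
    then have "(\<lambda>n. gcd_form_bound (y2 n) * (L n)\<^sup>2 * (1 - 1 / y2 n)\<^sup>2 * (exp (- 2 * sqrt (8 / L n)) * (1 - 1 / n))) \<longlonglongrightarrow> \<kappa> * (1 - 0)\<^sup>2 * 1"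
      unfolding \<kappa>_def by (intro tendsto_mult tendsto_power tendsto_diff tendsto_const gcd_form_bound_cutoff inv y2)
    then show ?thesis by (simp add: mult.assoc)
  qed
  show ?thesis
    unfolding L_def[symmetric] \<kappa>_def[symmetric]
  proof (rule tendsto_sandwich[OF _ _ lower_lim upper_lim])
    have "\<forall>\<^sub>F n in sequentially. y1 n \<ge> 1" using y1(2) by (simp add: filterlim_at_top)
    then show "\<forall>\<^sub>F n in sequentially. 12 * G n * (L n)\<^sup>2 / n \<le>
        gcd_form_bound (y1 n) * (L n)\<^sup>2 * exp (6 / y1 n) + real (y1 n) ^ (2 * y1 n) * (L n)\<^sup>2 / n"
      using eventually_gt_at_top[of 0]
    proof eventually_elim
      case (elim n)
      have "12 * G n * ((L n)\<^sup>2 / n) \<le> (n * (gcd_form_bound (y1 n) * exp (6 / y1 n)) + real (y1 n) ^ (2 * y1 n)) * ((L n)\<^sup>2 / n)"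
        by (intro mult_right_mono G_upper_bound elim) auto
      then show ?case using elim by (simp add: field_simps)
    qed
    have "\<forall>\<^sub>F n in sequentially. L n > 0" unfolding L_def by real_asymp
    then show "\<forall>\<^sub>F n in sequentially. gcd_form_bound (y2 n) * (L n)\<^sup>2 * (1 - 1 / y2 n)\<^sup>2 * exp (- 2 * sqrt (8 / L n)) * (1 - 1 / n)
        \<le> 12 * G n * (L n)\<^sup>2 / n"
      using y2(3) eventually_gt_at_top[of 0]
    proof eventually_elim
      case (elim n)
      define c where "c = gcd_form_bound (y2 n) * (1 - 1 / y2 n)\<^sup>2 * exp (- 2 * sqrt (8 / L n))"
      have c: "c \<ge> 0" using gcd_form_bound_pos[of "y2 n"] by (simp add: c_def)
      have "real n * (1 - 1 / n) \<le> real n * (1 - real n * exp (- (sqrt (8 / L n))\<^sup>2 * y2 n / 4))"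
        using elim by (intro mult_left_mono) auto
      then have "c * (real n * (1 - 1 / n)) \<le> c * (real n - (real n)\<^sup>2 * exp (- (sqrt (8 / L n))\<^sup>2 * y2 n / 4))"
        by (intro mult_left_mono c) (simp add: power2_eq_square right_diff_distrib mult.assoc)
      also have "\<dots> \<le> 12 * G n"
        unfolding c_def using elim by (intro G_lower_bound) (auto simp: y2_def)
      finally have "c * (real n * (1 - 1 / n)) * ((L n)\<^sup>2 / n) \<le> 12 * G n * ((L n)\<^sup>2 / n)"
        by (rule mult_right_mono) simp
      moreover have "c * (real n * (1 - 1 / n)) * ((L n)\<^sup>2 / n) = c * (1 - 1 / n) * (L n)\<^sup>2"
        using elim by simp
      ultimately show ?case by (simp add: c_def mult_ac)
    qed
  qed
qed

theorem theorem1p4: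
  shows "G \<sim>[sequentially]
    (\<lambda>n. pi\<^sup>2 / (72 * exp (2 * euler_mascheroni)) * (real n / (ln (ln (real n)))\<^sup>2))"
proof (rule asymp_equivI')
  define \<kappa> :: real where "\<kappa> = pi\<^sup>2 / 6 * exp (- 2 * euler_mascheroni)"
  have \<kappa>: "\<kappa> \<noteq> 0" by (simp add: \<kappa>_def)
  have const: "pi\<^sup>2 / (72 * exp (2 * euler_mascheroni)) = \<kappa> / 12"
    by (simp add: \<kappa>_def exp_minus field_simps)
  have "(\<lambda>n. 12 * G n * (ln (ln (real n)))\<^sup>2 / n / \<kappa>) \<longlonglongrightarrow> \<kappa> / \<kappa>"
    using G_limit[folded \<kappa>_def] \<kappa> by (intro tendsto_divide tendsto_const)
  moreover have "12 * G n * (ln (ln (real n)))\<^sup>2 / n / \<kappa> =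
      G n / (pi\<^sup>2 / (72 * exp (2 * euler_mascheroni)) * (real n / (ln (ln (real n)))\<^sup>2))" for n
    unfolding const by (simp add: mult_ac)
  ultimately show "(\<lambda>n. G n / (pi\<^sup>2 / (72 * exp (2 * euler_mascheroni)) * (real n / (ln (ln (real n)))\<^sup>2))) \<longlonglongrightarrow> 1"
    using \<kappa> by simp
qed

end
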